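(* Let $G=(V,E\cup A)$ be a mixed graph that has a mixed edge cover. The linear system in variables $x\in\mathbb{R}^{E\cup A}$ $$0\le x_e\le 1\quad\text{for every } e\in E\cup A,$$ $$x(E[\cup\mathcal{S}])+x(\delta_E(\cup\mathcal{S}))+\sum_{Z\in\mathcal{S}} x(\delta^{in}_A(Z))\ \ge\ \lceil |\mathcal{S}|/2\rceil\quad\text{for every subpartition } \mathcal{S} \text{ of } V$$ is totally dual integral, and its set of solutions is the convex hull of the incidence vectors of mixed edge covers of $G$.
   Context: A mixed graph $G=(V,E\cup A)$ has a finite vertex set $V$, undirected edges $E$ and directed arcs $A$; no loops, parallel edges/arcs allowed. A mixed edge cover is a subset $F\subseteq E\cup A$ such that for every $v\in V$ there is a directed path (possibly of length $0$) using only arcs of $F\cap A$ from an endpoint of some edge of $F\cap E$ to $v$. A subpartition $\mathcal{S}$ of $V$ is a collection of pairwise disjoint nonempty subsets of $V$; $\cup\mathcal{S}$ is their union and $|\mathcal{S}|$ the number of classes. For $U\subseteq V$, $E[U]$ is the set of edges with both endpoints in $U$, $\delta_E(U)$ the set of edges with exactly one endpoint in $U$, and $\delta^{in}_A(U)$ the set of arcs with head in $U$ and tail outside $U$. For $S\subseteq E\cup A$, $x(S)=\sum_{e\in S}x_e$. *)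

theory Defs
  imports
    "HOL-Analysis.Analysis"
    "HOL-Library.Disjoint_Sets"
    "Graph_Theory.Arc_Walk"
begin

section \<open>Linear systems and total dual integrality\<close>

text \<open>
  The space of real vectors indexed by a subset J of the finite type \<open>'j\<close> is rendered as the
  coordinate subspace of \<open>real ^ 'j\<close> of all vectors that vanish outside J; so J may be empty.
\<close>

definition coord_space :: "'j::finite set \<Rightarrow> (real ^ 'j) set" where
  "coord_space J = {x. \<forall>j. j \<notin> J \<longrightarrow> x $ j = 0}"

text \<open>
  A system with row index set I and column index set J consists of the inequalities
  \<open>a i \<bullet> x \<ge> b i\<close> for i in I. An upper bound is entered with both sides negated.
\<close>

definition solutions ::
    "'j::finite set \<Rightarrow> 'i set \<Rightarrow> ('i \<Rightarrow> real ^ 'j) \<Rightarrow> ('i \<Rightarrow> real) \<Rightarrow> (real ^ 'j) set" where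
  "solutions J I a b = {x \<in> coord_space J. \<forall>i\<in>I. a i \<bullet> x \<ge> b i}"

definition dual_feasible ::
    "'j::finite set \<Rightarrow> 'i set \<Rightarrow> ('i \<Rightarrow> real ^ 'j) \<Rightarrow> real ^ 'j \<Rightarrow> ('i \<Rightarrow> real) \<Rightarrow> bool" where
  "dual_feasible J I a c y \<longleftrightarrow>
     (\<forall>i\<in>I. y i \<ge> 0) \<and> (\<forall>j\<in>J. (\<Sum>i\<in>I. y i * a i $ j) = c $ j)"

definition dual_optimal ::
    "'j::finite set \<Rightarrow> 'i set \<Rightarrow> ('i \<Rightarrow> real ^ 'j) \<Rightarrow> ('i \<Rightarrow> real) \<Rightarrow> real ^ 'j \<Rightarrow> ('i \<Rightarrow> real) \<Rightarrow> bool"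
  where
  "dual_optimal J I a b c y \<longleftrightarrow>
     dual_feasible J I a c y \<and>
     (\<forall>y'. dual_feasible J I a c y' \<longrightarrow> (\<Sum>i\<in>I. y' i * b i) \<le> (\<Sum>i\<in>I. y i * b i))"

text \<open>
  A finite rational system is totally dual integral if, for every integral cost vector c for which
  the minimum of \<open>c \<bullet> x\<close> over the solutions x is finite, the dual linear program
  (maximise the y-combination of the right-hand sides) has an integral optimal solution.
\<close>

definition totally_dual_integral ::
    "'j::finite set \<Rightarrow> 'i set \<Rightarrow> ('i \<Rightarrow> real ^ 'j) \<Rightarrow> ('i \<Rightarrow> real) \<Rightarrow> bool" where
  "totally_dual_integral J I a b \<longleftrightarrow>
     finite I \<and>
     (\<forall>i\<in>I. b i \<in> \<rat> \<and> (\<forall>j\<in>J. a i $ j \<in> \<rat>)) \<and>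
     (\<forall>c\<in>coord_space J.
        (\<forall>j\<in>J. c $ j \<in> \<int>) \<and>
        solutions J I a b \<noteq> {} \<and> bdd_below ((\<lambda>x. c \<bullet> x) ` solutions J I a b) \<longrightarrow>
        (\<exists>y. dual_optimal J I a b c y \<and> (\<forall>i\<in>I. y i \<in> \<int>)))"

definition incidence :: "'j::finite set \<Rightarrow> real ^ 'j" where
  "incidence F = (\<chi> j. if j \<in> F then 1 else 0)"

lemma inner_incidence: "incidence F \<bullet> x = (\<Sum>j\<in>F. x $ j)"
  unfolding incidence_def inner_vec_def
  by (simp add: if_distrib[where f = "\<lambda>r. r * _"] sum.If_cases cong: if_cong)


section \<open>Mixed graphs\<close>

text \<open>
  D is the digraph of the vertices and arcs; E is the set of undirected edges, each edge e having
  the two-element set \<open>ends e\<close> of endpoints. Edges and arcs are named objects of one type, so both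
  may be parallel.
\<close>

locale mixed_graph = fin_digraph D + loopfree_digraph D
  for D :: "('v, 'e) pre_digraph" +
  fixes E :: "'e set"
    and ends :: "'e \<Rightarrow> 'v set"
  assumes finite_edges: "finite E"
    and edges_arcs_disjoint: "E \<inter> arcs D = {}"
    and ends_in_verts: "e \<in> E \<Longrightarrow> ends e \<subseteq> verts D"
    and card_ends: "e \<in> E \<Longrightarrow> card (ends e) = 2"

text \<open>
  A path (\<open>apath\<close>) is a walk without repeated vertices, given by its list of arcs; the empty list is
  the path of length 0 at a vertex.
\<close>

definition mixed_edge_cover ::
    "('v, 'e) pre_digraph \<Rightarrow> 'e set \<Rightarrow> ('e \<Rightarrow> 'v set) \<Rightarrow> 'e set \<Rightarrow> bool" where
  "mixed_edge_cover D E ends F \<longleftrightarrow>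
     F \<subseteq> E \<union> arcs D \<and>
     (\<forall>v\<in>verts D. \<exists>e\<in>F \<inter> E. \<exists>u\<in>ends e. \<exists>p.
        pre_digraph.apath (D\<lparr>arcs := F \<inter> arcs D\<rparr>) u p v)"

definition subpartition :: "'v set \<Rightarrow> 'v set set \<Rightarrow> bool" where
  "subpartition V S \<longleftrightarrow> \<Union>S \<subseteq> V \<and> partition_on (\<Union>S) S"

definition induced_edges :: "'e set \<Rightarrow> ('e \<Rightarrow> 'v set) \<Rightarrow> 'v set \<Rightarrow> 'e set" where
  "induced_edges E ends U = {e \<in> E. ends e \<subseteq> U}"

definition edge_cut :: "'e set \<Rightarrow> ('e \<Rightarrow> 'v set) \<Rightarrow> 'v set \<Rightarrow> 'e set" where
  "edge_cut E ends U = {e \<in> E. card (ends e \<inter> U) = 1}"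

definition in_cut :: "('v, 'e) pre_digraph \<Rightarrow> 'v set \<Rightarrow> 'e set" where
  "in_cut D Z = {a \<in> arcs D. head D a \<in> Z \<and> tail D a \<notin> Z}"


section \<open>The linear system\<close>

datatype ('v, 'e) constr = Lower 'e | Upper 'e | Cover "'v set set"

definition mec_constrs :: "('v, 'e) pre_digraph \<Rightarrow> 'e set \<Rightarrow> ('v, 'e) constr set" where
  "mec_constrs D E =
     Lower ` (E \<union> arcs D) \<union> Upper ` (E \<union> arcs D) \<union> Cover ` {S. subpartition (verts D) S}"

fun mec_row ::
    "('v, 'e::finite) pre_digraph \<Rightarrow> 'e set \<Rightarrow> ('e \<Rightarrow> 'v set) \<Rightarrow> ('v, 'e) constr \<Rightarrow> real ^ 'e" where
  "mec_row D E ends (Lower e) = incidence {e}"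
| "mec_row D E ends (Upper e) = - incidence {e}"
| "mec_row D E ends (Cover S) =
     incidence (induced_edges E ends (\<Union>S)) + incidence (edge_cut E ends (\<Union>S)) +
     (\<Sum>Z\<in>S. incidence (in_cut D Z))"

fun mec_rhs :: "('v, 'e) constr \<Rightarrow> real" where
  "mec_rhs (Lower e) = 0"
| "mec_rhs (Upper e) = - 1"
| "mec_rhs (Cover S) = of_int \<lceil>real (card S) / 2\<rceil>"

lemma mec_solutions_explicit:
  "solutions (E \<union> arcs D) (mec_constrs D E) (mec_row D E ends) mec_rhs =
     {x \<in> coord_space (E \<union> arcs D).
        (\<forall>e\<in>E \<union> arcs D. 0 \<le> x $ e \<and> x $ e \<le> 1) \<and>
        (\<forall>S. subpartition (verts D) S \<longrightarrow>
           (\<Sum>e\<in>induced_edges E ends (\<Union>S). x $ e) + (\<Sum>e\<in>edge_cut E ends (\<Union>S). x $ e) +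
           (\<Sum>Z\<in>S. \<Sum>a\<in>in_cut D Z. x $ a) \<ge> of_int \<lceil>real (card S) / 2\<rceil>)}"
  unfolding solutions_def mec_constrs_def
  by (auto simp: ball_Un inner_incidence inner_add_left inner_sum_left)

end

theory Submission
  imports Defs "HOL-Library.Multiset"
begin

text \<open>
  An edge is treated as an element with two heads and no tail, an arc as one with a head and a tail; F is
  a mixed edge cover iff some element of F enters every nonempty vertex set. For integral costs
  \<open>c \<ge> 0\<close> a cover F and a multiset Z of subpartitions are produced by induction on the total cost
  such that no element is loaded by Z beyond its cost and \<open>c F\<close> is at most the value of Z;
  negative costs are absorbed by the upper bounds.

  Every vertex v gets a half-edge, with v as its only head, so expensive that no optimal cover uses it. One
  then lowers the costs of the half-edges until each lies in some optimal cover, and discards every element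
  that costs at least as much as the half-edges at its heads. If the remaining graph is connected, let L
  be the partition into its weak components with respect to arcs. Subtracting the row of L from the costs
  lowers the optimum by at most \<open>\<lceil>|L| / 2\<rceil>\<close>, so that L can be added to the packing for the reduced costs.
  To see this, take a cover optimal for the reduced costs and, among those, with the fewest edges and
  half-edges. An alternating-path exchange between two covers, in which Edmonds' theorem on two
  disjoint branchings redistributes the arcs, shows as in Lovasz's proof of the existence of odd components
  that it has at most one half-edge, and then that each member of L contains at most one end of an edge.
\<close>

section \<open>Two disjoint branchings\<close>

text \<open>Subtracting the row of L lowers the cost of a cover by its number k of edges and
  half-edges, so what is needed is an optimal cover for the reduced costs with small k. If it has
  one half-edge and all ends of its edges and the half-edge lie in different members of L, then
  \<open>2 * k - 1 \<le> card L\<close>; this is where the rounding up comes from. Half-edges also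
  make every subproblem of the induction feasible.

  The obstacle is that edges cannot be swapped between covers as in matching theory: the arcs of a
  cover start from its edges, and a swap may leave sets unentered. Only the minimal sets that no arc
  of either cover enters matter. If each of them keeps an item from both covers, disjoint branchings
  repair the rest. These sets are disjoint and an item has at most two heads, which restores
  alternating paths. The bookkeeping is by slack, 2 minus the degree of an item: an alternating
  chain has total slack at most 2 and each half-edge on it takes at least 1, so that most
  contradictions below consist in finding a third unit.\<close>

text \<open>
  The functions \<open>hs\<close> and \<open>ts\<close> give the heads and the tails of the elements. They are parameters because the
  exchange arguments work with tagged copies of elements, where one element may occur in both covers.
\<close>

definition enters :: "('j \<Rightarrow> 'v set) \<Rightarrow> ('j \<Rightarrow> 'v set) \<Rightarrow> 'j \<Rightarrow> 'v set \<Rightarrow> bool" where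
  "enters hs ts e U \<longleftrightarrow> hs e \<inter> U \<noteq> {} \<and> ts e \<inter> U = {}"

definition covering :: "'v set \<Rightarrow> ('j \<Rightarrow> 'v set) \<Rightarrow> ('j \<Rightarrow> 'v set) \<Rightarrow> 'j set \<Rightarrow> bool" where
  "covering V hs ts F \<longleftrightarrow> (\<forall>U\<subseteq>V. U \<noteq> {} \<longrightarrow> (\<exists>e\<in>F. enters hs ts e U))"

definition entering :: "('j \<Rightarrow> 'v set) \<Rightarrow> ('j \<Rightarrow> 'v set) \<Rightarrow> 'j set \<Rightarrow> 'v set \<Rightarrow> 'j set" where
  "entering hs ts F U = {e \<in> F. enters hs ts e U}"

definition is_arc :: "'v set \<Rightarrow> ('j \<Rightarrow> 'v set) \<Rightarrow> ('j \<Rightarrow> 'v set) \<Rightarrow> 'j \<Rightarrow> bool" where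
  "is_arc V hs ts e \<longleftrightarrow> (\<exists>x\<in>V. \<exists>y\<in>V. x \<noteq> y \<and> ts e = {x} \<and> hs e = {y})"

definition is_item :: "'v set \<Rightarrow> ('j \<Rightarrow> 'v set) \<Rightarrow> ('j \<Rightarrow> 'v set) \<Rightarrow> 'j \<Rightarrow> bool" where
  "is_item V hs ts e \<longleftrightarrow> ts e = {} \<and> hs e \<subseteq> V \<and> finite (hs e)"

lemma coveringD: "covering V hs ts F \<Longrightarrow> U \<subseteq> V \<Longrightarrow> U \<noteq> {} \<Longrightarrow> \<exists>e\<in>F. enters hs ts e U"
  unfolding covering_def by blast

lemma covering_mono: "covering V hs ts F \<Longrightarrow> F \<subseteq> G \<Longrightarrow> covering V hs ts G"
  unfolding covering_def by blast

lemma finite_entering [simp]: "finite F \<Longrightarrow> finite (entering hs ts F U)"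
  unfolding entering_def by simp

lemma enters_submodular:
  assumes "is_item V hs ts e \<or> is_arc V hs ts e"
  shows "of_bool (enters hs ts e (U \<inter> W)) + of_bool (enters hs ts e (U \<union> W))
    \<le> (of_bool (enters hs ts e U) + of_bool (enters hs ts e W) :: nat)"
  using assms unfolding enters_def is_arc_def is_item_def by (auto simp: of_bool_def)

lemma card_entering_sum:
  "finite F \<Longrightarrow> card (entering hs ts F U) = (\<Sum>e\<in>F. of_bool (enters hs ts e U))"
  unfolding entering_def by (simp add: of_bool_def sum.If_cases Int_def)

lemma card_entering_submodular:
  assumes "finite F" "\<And>e. e \<in> F \<Longrightarrow> is_item V hs ts e \<or> is_arc V hs ts e"
  shows "card (entering hs ts F (U \<inter> W)) + card (entering hs ts F (U \<union> W))
    \<le> card (entering hs ts F U) + card (entering hs ts F W)"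
  unfolding card_entering_sum[OF assms(1)] sum.distrib[symmetric]
  using assms(2) by (intro sum_mono enters_submodular)

lemma covering_card:
  assumes "covering V hs ts F" "finite F" "U \<subseteq> V" "U \<noteq> {}"
  shows "1 \<le> card (entering hs ts F U)"
proof -
  have "entering hs ts F U \<noteq> {}" using coveringD[OF assms(1,3,4)] unfolding entering_def by blast
  then show ?thesis using assms(2) by (simp add: Suc_le_eq card_gt_0_iff)
qed

lemma card_ge2_obtain:
  assumes "2 \<le> card A"
  obtains b where "b \<in> A" "b \<noteq> a"
proof -
  have "\<not> A \<subseteq> {a}"
  proof
    assume "A \<subseteq> {a}"
    then have "card A \<le> card {a}" by (intro card_mono) auto
    then show False using assms by simp
  qed
  then show thesis using that by blast
qed

text \<open>Lovasz's proof of Edmonds' disjoint branchings theorem: \<open>R1\<close> grows along an arc leaving it inside a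
  minimal tight set.\<close>

lemma two_branchings:
  assumes "finite V" "finite A" "\<And>a. a \<in> A \<Longrightarrow> is_arc V hs ts a" "R1 \<subseteq> V" "R2 \<subseteq> V"
    and "\<And>U. U \<subseteq> V \<Longrightarrow> U \<noteq> {} \<Longrightarrow>
      2 \<le> card (entering hs ts A U) + of_bool (U \<inter> R1 \<noteq> {}) + of_bool (U \<inter> R2 \<noteq> {})"
  shows "\<exists>A1 A2. A1 \<union> A2 = A \<and> A1 \<inter> A2 = {} \<and>
    (\<forall>U\<subseteq>V. U \<noteq> {} \<longrightarrow> U \<inter> R1 \<noteq> {} \<or> (\<exists>a\<in>A1. enters hs ts a U)) \<and>
    (\<forall>U\<subseteq>V. U \<noteq> {} \<longrightarrow> U \<inter> R2 \<noteq> {} \<or> (\<exists>a\<in>A2. enters hs ts a U))"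
  using assms
proof (induction "card (V - R1)" arbitrary: R1 A rule: less_induct)
  case less
  note finV = less.prems(1) and finA = less.prems(2) and arcs = less.prems(3)
    and R1 = less.prems(4) and R2 = less.prems(5) and cond = less.prems(6)
  \<comment> \<open>\<open>f\<close> leaves out \<open>R1\<close>. Once v is added to
    \<open>R1\<close>, a set U entered by the arc from u to v meets \<open>R1\<close>, so it
    tolerates the loss of the arc exactly when \<open>2 \<le> f U\<close>.\<close>
  define f where "f U = card (entering hs ts A U) + of_bool (U \<inter> R2 \<noteq> {})" for U
  show ?case
  proof (cases "R1 = V")
    case True
    have "U \<inter> R2 \<noteq> {} \<or> (\<exists>a\<in>A. enters hs ts a U)" if "U \<subseteq> V" "U \<noteq> {}" for U
    proof (rule ccontr)
      assume "\<not> ?thesis"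
      then have "card (entering hs ts A U) = 0" "U \<inter> R2 = {}"
        unfolding entering_def by (auto simp: card_eq_0_iff)
      then show False using cond[OF that] by (auto simp: of_bool_def split: if_splits)
    qed
    then have "\<forall>U\<subseteq>V. U \<noteq> {} \<longrightarrow> U \<inter> R2 \<noteq> {} \<or> (\<exists>a\<in>A. enters hs ts a U)" by blast
    moreover have "\<forall>U\<subseteq>V. U \<noteq> {} \<longrightarrow> U \<inter> R1 \<noteq> {} \<or> (\<exists>a\<in>{}. enters hs ts a U)" using True by blast
    moreover have "{} \<union> A = A" "{} \<inter> A = {}" by auto
    ultimately show ?thesis by metis
  next
    case False
    then have R1V: "V - R1 \<noteq> {}" using R1 by blast
    have f1: "1 \<le> f U" if "U \<subseteq> V" "U \<noteq> {}" for U
      using cond[OF that] unfolding f_def by (auto simp: of_bool_def split: if_splits)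
    have f2: "2 \<le> f U" if "U \<subseteq> V" "U \<noteq> {}" "U \<inter> R1 = {}" for U
      using cond[OF that(1,2)] that(3) unfolding f_def by simp
    have fsub: "f (U \<inter> W) + f (U \<union> W) \<le> f U + f W" for U W
    proof -
      have "of_bool ((U \<inter> W) \<inter> R2 \<noteq> {}) + of_bool ((U \<union> W) \<inter> R2 \<noteq> {})
        \<le> (of_bool (U \<inter> R2 \<noteq> {}) + of_bool (W \<inter> R2 \<noteq> {}) :: nat)"
        by (auto simp: of_bool_def)
      moreover have "card (entering hs ts A (U \<inter> W)) + card (entering hs ts A (U \<union> W))
        \<le> card (entering hs ts A U) + card (entering hs ts A W)"
        by (rule card_entering_submodular[OF finA]) (use arcs in blast)
      ultimately show ?thesis unfolding f_def by linarith
    qed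
    \<comment> \<open>A set with \<open>f U = 1\<close> forbids every arc entering it. Those inside
      \<open>R1\<close> are harmless, because the arc chosen has its head outside
      \<open>R1\<close>.\<close>
    define dangerous where "dangerous U \<longleftrightarrow> U \<subseteq> V \<and> U - R1 \<noteq> {} \<and> f U = 1" for U
    have "dangerous V"
    proof -
      have "entering hs ts A V = {}"
        using arcs unfolding entering_def enters_def is_arc_def by fastforce
      then have "f V \<le> 1" unfolding f_def by (simp add: of_bool_def)
      then show ?thesis using f1[of V] R1V unfolding dangerous_def by fastforce
    qed
    then obtain U0 where U0: "dangerous U0" and U0min: "\<And>U. dangerous U \<Longrightarrow> card U0 \<le> card U"
      using ex_has_least_nat[of dangerous V card] by blast
    have U0V: "U0 \<subseteq> V" and U0ne: "U0 - R1 \<noteq> {}" and fU0: "f U0 = 1"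
      using U0 unfolding dangerous_def by auto
    have "2 \<le> f (U0 - R1)" using f2[of "U0 - R1"] U0V U0ne by blast
    have "\<exists>a\<in>A. enters hs ts a (U0 - R1) \<and> \<not> enters hs ts a U0"
    proof (rule ccontr)
      assume "\<not> ?thesis"
      then have "entering hs ts A (U0 - R1) \<subseteq> entering hs ts A U0" unfolding entering_def by blast
      then have "card (entering hs ts A (U0 - R1)) \<le> card (entering hs ts A U0)"
        using finA by (simp add: card_mono)
      moreover have "of_bool ((U0 - R1) \<inter> R2 \<noteq> {}) \<le> (of_bool (U0 \<inter> R2 \<noteq> {}) :: nat)"
        by (auto simp: of_bool_def)
      ultimately show False using \<open>2 \<le> f (U0 - R1)\<close> fU0 unfolding f_def by linarith
    qed
    then obtain a where a: "a \<in> A" "enters hs ts a (U0 - R1)" "\<not> enters hs ts a U0" by blast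
    obtain u v where uv: "ts a = {u}" "hs a = {v}" using arcs[OF a(1)] unfolding is_arc_def by blast
    have v: "v \<in> U0" "v \<notin> R1" and u: "u \<in> U0" "u \<in> R1"
      using a(2,3) uv unfolding enters_def by auto
    have "card (V - insert v R1) < card (V - R1)"
      using v U0V finV by (intro psubset_card_mono) auto
    moreover have "2 \<le> card (entering hs ts (A - {a}) U) + of_bool (U \<inter> insert v R1 \<noteq> {})
        + of_bool (U \<inter> R2 \<noteq> {})" if U: "U \<subseteq> V" "U \<noteq> {}" for U
    proof (cases "enters hs ts a U")
      case False
      then have "entering hs ts (A - {a}) U = entering hs ts A U" unfolding entering_def by blast
      then show ?thesis using cond[OF U] by (auto simp: of_bool_def split: if_splits)
    next
      case True
      then have vU: "v \<in> U" and uU: "u \<notin> U" using uv unfolding enters_def by auto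
      have "entering hs ts A U = insert a (entering hs ts (A - {a}) U)"
        using True a(1) unfolding entering_def by blast
      then have c: "card (entering hs ts A U) = Suc (card (entering hs ts (A - {a}) U))"
        using finA by (simp add: entering_def)
      \<comment> \<open>Otherwise the intersection with \<open>U0\<close> is dangerous, as it
        contains v, and smaller, as u lies in \<open>U0\<close> but not in U.\<close>
      have "2 \<le> f U"
      proof (rule ccontr)
        assume "\<not> 2 \<le> f U"
        then have "f U = 1" using f1[OF U] by linarith
        moreover have "1 \<le> f (U \<union> U0)" using f1[of "U \<union> U0"] U U0V by blast
        ultimately have "f (U \<inter> U0) \<le> 1" using fsub[of U U0] fU0 by linarith
        moreover have "1 \<le> f (U \<inter> U0)" using f1[of "U \<inter> U0"] U U0V vU v by blast
        ultimately have "dangerous (U \<inter> U0)"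
          using U0V vU v unfolding dangerous_def by fastforce
        moreover have "card (U \<inter> U0) < card U0"
          using uU u U0V finV by (intro psubset_card_mono) (auto intro: finite_subset)
        ultimately show False using U0min by fastforce
      qed
      then show ?thesis using c vU unfolding f_def by (auto simp: of_bool_def split: if_splits)
    qed
    moreover have "insert v R1 \<subseteq> V" using R1 v U0V by blast
    moreover have "\<And>b. b \<in> A - {a} \<Longrightarrow> is_arc V hs ts b" using arcs by blast
    ultimately have "\<exists>A1 A2. A1 \<union> A2 = A - {a} \<and> A1 \<inter> A2 = {} \<and>
      (\<forall>U\<subseteq>V. U \<noteq> {} \<longrightarrow> U \<inter> insert v R1 \<noteq> {} \<or> (\<exists>a\<in>A1. enters hs ts a U)) \<and>
      (\<forall>U\<subseteq>V. U \<noteq> {} \<longrightarrow> U \<inter> R2 \<noteq> {} \<or> (\<exists>a\<in>A2. enters hs ts a U))"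
      using less.hyps[of "insert v R1" "A - {a}"] finV finA R2 by simp
    then obtain A1 A2 where IH: "A1 \<union> A2 = A - {a}" "A1 \<inter> A2 = {}"
      "\<forall>U\<subseteq>V. U \<noteq> {} \<longrightarrow> U \<inter> insert v R1 \<noteq> {} \<or> (\<exists>a\<in>A1. enters hs ts a U)"
      "\<forall>U\<subseteq>V. U \<noteq> {} \<longrightarrow> U \<inter> R2 \<noteq> {} \<or> (\<exists>a\<in>A2. enters hs ts a U)"
      by metis
    have "U \<inter> R1 \<noteq> {} \<or> (\<exists>a\<in>insert a A1. enters hs ts a U)" if "U \<subseteq> V" "U \<noteq> {}" for U
    proof -
      have "enters hs ts a U" if "v \<in> U" "u \<notin> U" using that uv unfolding enters_def by auto
      moreover have "U \<inter> insert v R1 \<noteq> {} \<or> (\<exists>a\<in>A1. enters hs ts a U)"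
        using IH(3) that by blast
      ultimately show ?thesis using u(2) by blast
    qed
    then have "\<forall>U\<subseteq>V. U \<noteq> {} \<longrightarrow> U \<inter> R1 \<noteq> {} \<or> (\<exists>a\<in>insert a A1. enters hs ts a U)" by blast
    moreover have "insert a A1 \<union> A2 = A" "insert a A1 \<inter> A2 = {}" using IH(1,2) a(1) by auto
    ultimately show ?thesis using IH(4) by metis
  qed
qed

text \<open>The heads of the items serve as the root sets of two branchings. If one arc enters U, a
  second arc or any item completes the count; if no arc does, both root sets must meet U, which
  \<open>two\<close> alone cannot ensure, since both entries might come from
  \<open>I1\<close>.\<close>

lemma two_coverings:
  assumes fin: "finite V" "finite A" "finite I1" "finite I2"
    and arcs: "\<And>a. a \<in> A \<Longrightarrow> is_arc V hs ts a"
    and items: "\<And>i. i \<in> I1 \<union> I2 \<Longrightarrow> is_item V hs ts i"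
    and two: "\<And>U. U \<subseteq> V \<Longrightarrow> U \<noteq> {} \<Longrightarrow> 2 \<le> card (entering hs ts (A \<union> I1 \<union> I2) U)"
    and both: "\<And>U. U \<subseteq> V \<Longrightarrow> U \<noteq> {} \<Longrightarrow> entering hs ts A U = {} \<Longrightarrow>
      (\<exists>i\<in>I1. enters hs ts i U) \<and> (\<exists>i\<in>I2. enters hs ts i U)"
  obtains A1 A2 where "A1 \<union> A2 = A" "A1 \<inter> A2 = {}"
    "covering V hs ts (A1 \<union> I1)" "covering V hs ts (A2 \<union> I2)"
proof -
  define R where "R I = (\<Union>i\<in>I. hs i)" for I
  have RI: "U \<inter> R I \<noteq> {} \<longleftrightarrow> (\<exists>i\<in>I. enters hs ts i U)" if "I \<subseteq> I1 \<union> I2" for I U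
    using items that unfolding R_def enters_def is_item_def by blast
  have R1: "U \<inter> R I1 \<noteq> {} \<longleftrightarrow> (\<exists>i\<in>I1. enters hs ts i U)"
    and R2: "U \<inter> R I2 \<noteq> {} \<longleftrightarrow> (\<exists>i\<in>I2. enters hs ts i U)" for U
    using RI by auto
  have cond: "2 \<le> card (entering hs ts A U) + of_bool (U \<inter> R I1 \<noteq> {}) + of_bool (U \<inter> R I2 \<noteq> {})"
    if U: "U \<subseteq> V" "U \<noteq> {}" for U
  proof (cases "entering hs ts A U = {}")
    case True
    then show ?thesis using both[OF U True] R1[of U] R2[of U] by simp
  next
    case False
    then have 1: "1 \<le> card (entering hs ts A U)" using fin by (simp add: Suc_le_eq card_gt_0_iff)
    show ?thesis
    proof (cases "\<exists>i\<in>I1 \<union> I2. enters hs ts i U")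
      case True
      then have "U \<inter> R I1 \<noteq> {} \<or> U \<inter> R I2 \<noteq> {}" using R1[of U] R2[of U] by blast
      then show ?thesis using 1 by (auto simp: of_bool_def split: if_splits)
    next
      case False
      then have "entering hs ts (A \<union> I1 \<union> I2) U = entering hs ts A U"
        unfolding entering_def by blast
      then show ?thesis using two[OF U] by simp
    qed
  qed
  have "R I1 \<subseteq> V" "R I2 \<subseteq> V" using items unfolding R_def is_item_def by blast+
  from two_branchings[OF fin(1,2) arcs this cond] obtain A1 A2 where
    A: "A1 \<union> A2 = A" "A1 \<inter> A2 = {}"
    "\<forall>U\<subseteq>V. U \<noteq> {} \<longrightarrow> U \<inter> R I1 \<noteq> {} \<or> (\<exists>a\<in>A1. enters hs ts a U)"
    "\<forall>U\<subseteq>V. U \<noteq> {} \<longrightarrow> U \<inter> R I2 \<noteq> {} \<or> (\<exists>a\<in>A2. enters hs ts a U)" by blast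
  show thesis
  proof (rule that[OF A(1,2)])
    show "covering V hs ts (A1 \<union> I1)" using A(3) R1 unfolding covering_def by (metis UnCI)
    show "covering V hs ts (A2 \<union> I2)" using A(4) R2 unfolding covering_def by (metis UnCI)
  qed
qed

section \<open>Exchanging two covers\<close>

lemma card_preimage_sum:
  assumes "finite S" "finite B"
  shows "card {j \<in> S. g j \<in> B} = (\<Sum>i\<in>B. card {j \<in> S. g j = i})"
proof -
  have "{j \<in> S. g j \<in> B} = (\<Union>i\<in>B. {j \<in> S. g j = i})" by blast
  then show ?thesis using assms by (simp add: card_UN_disjoint disjoint_iff)
qed

lemma card_le_card_hit:
  assumes "finite D" "\<And>J. J \<in> S \<Longrightarrow> J \<inter> D \<noteq> {}"
    and "\<And>J J'. J \<in> S \<Longrightarrow> J' \<in> S \<Longrightarrow> J \<inter> J' \<noteq> {} \<Longrightarrow> J = J'"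
  shows "card S \<le> card D"
proof -
  define g where "g J = (SOME d. d \<in> J \<inter> D)" for J
  have g: "g J \<in> J \<inter> D" if "J \<in> S" for J
  proof -
    have "\<exists>d. d \<in> J \<inter> D" using assms(2)[OF that] by blast
    then show ?thesis unfolding g_def by (rule someI_ex)
  qed
  have "inj_on g S"
  proof (rule inj_onI)
    fix J J' assume J: "J \<in> S" "J' \<in> S" "g J = g J'"
    then have "J \<inter> J' \<noteq> {}" using g[of J] g[of J'] by auto
    then show "J = J'" using assms(3) J by blast
  qed
  moreover have "g ` S \<subseteq> D" using g by blast
  ultimately show ?thesis using assms(1) by (rule card_inj_on_le)
qed

text \<open>S is the edge set of a multigraph on I with ends \<open>p j\<close> and
  \<open>q j\<close>. Connectedness is replaced by the inequality between items and internal links: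
  a largest C satisfying it is closed, since a link leaving C could be taken in together with its
  other end. C may also contain further components that have cycles.\<close>

lemma chain_exists:
  assumes "finite I" "finite S" "p ` S \<subseteq> I" "q ` S \<subseteq> I" "x \<in> I"
  shows "\<exists>C\<subseteq>I. x \<in> C \<and> (\<forall>j\<in>S. p j \<in> C \<longleftrightarrow> q j \<in> C) \<and> card C \<le> card {j \<in> S. p j \<in> C} + 1"
proof -
  define P where "P C \<longleftrightarrow> C \<subseteq> I \<and> x \<in> C \<and> card C \<le> card {j \<in> S. p j \<in> C \<and> q j \<in> C} + 1" for C
  have "P {x}" unfolding P_def using assms(5) by simp
  moreover have "\<forall>C. P C \<longrightarrow> card C < Suc (card I)"
    unfolding P_def using assms(1) by (simp add: card_mono less_Suc_eq_le)
  ultimately have "\<exists>C. P C \<and> (\<forall>C'. P C' \<longrightarrow> card C' \<le> card C)"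
    by (rule ex_has_greatest_nat)
  then obtain C where C: "P C" and max: "\<And>C'. P C' \<Longrightarrow> card C' \<le> card C" by blast
  have finC: "finite C" using C assms(1) unfolding P_def by (auto intro: finite_subset)
  have extend: False if j: "j \<in> S" and y: "y \<in> I" "y \<notin> C" "\<not> (p j \<in> C \<and> q j \<in> C)"
    "p j \<in> insert y C" "q j \<in> insert y C" for j y
  proof -
    have "insert j {j \<in> S. p j \<in> C \<and> q j \<in> C} \<subseteq> {j \<in> S. p j \<in> insert y C \<and> q j \<in> insert y C}"
      using j y by blast
    then have "card (insert j {j \<in> S. p j \<in> C \<and> q j \<in> C})
        \<le> card {j \<in> S. p j \<in> insert y C \<and> q j \<in> insert y C}"
      using assms(2) by (intro card_mono) auto
    moreover have "card (insert j {j \<in> S. p j \<in> C \<and> q j \<in> C}) = Suc (card {j \<in> S. p j \<in> C \<and> q j \<in> C})"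
      using y assms(2) by (subst card_insert_disjoint) auto
    ultimately have "P (insert y C)" using C y finC unfolding P_def by auto
    then show False using max[of "insert y C"] y finC by simp
  qed
  have closed: "p j \<in> C \<longleftrightarrow> q j \<in> C" if "j \<in> S" for j
    using extend[OF that, of "p j"] extend[OF that, of "q j"] that assms(3,4) by blast
  have "{j \<in> S. p j \<in> C \<and> q j \<in> C} = {j \<in> S. p j \<in> C}" using closed by blast
  then have "card C \<le> card {j \<in> S. p j \<in> C} + 1" "C \<subseteq> I" "x \<in> C" using C unfolding P_def by simp_all
  then show ?thesis using closed by blast
qed

section \<open>Two disjoint covers and the source components of their arcs\<close>

locale two_covers =
  fixes V :: "'v set" and hs ts :: "'j \<Rightarrow> 'v set" and F1 F2 :: "'j set"
  assumes finite_V: "finite V" and finite_F1: "finite F1" and finite_F2: "finite F2"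
    and disjoint_F: "F1 \<inter> F2 = {}"
    and covering_F1: "covering V hs ts F1" and covering_F2: "covering V hs ts F2"
    and element: "e \<in> F1 \<union> F2 \<Longrightarrow> (is_item V hs ts e \<and> card (hs e) \<le> 2) \<or> is_arc V hs ts e"
begin

definition "I1 = {e \<in> F1. ts e = {}}"
definition "I2 = {e \<in> F2. ts e = {}}"
definition "A = {e \<in> F1 \<union> F2. ts e \<noteq> {}}"

definition unentered :: "'v set \<Rightarrow> bool" where
  "unentered U \<longleftrightarrow> U \<subseteq> V \<and> U \<noteq> {} \<and> entering hs ts A U = {}"

text \<open>These are the source components of the digraph formed by the arcs of both covers: its
  strong components that no arc enters. Every unentered set contains one, so items may be
  redistributed freely as long as each source keeps one from either side.\<close>

definition sources :: "'v set set" where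
  "sources = {J. unentered J \<and> (\<forall>U. unentered U \<and> U \<subseteq> J \<longrightarrow> U = J)}"

lemma finite_items: "finite I1" "finite I2" "finite A"
  unfolding I1_def I2_def A_def using finite_F1 finite_F2 by auto

lemma I12: "I1 \<inter> I2 = {}" using disjoint_F unfolding I1_def I2_def by blast

lemma arc_A: "a \<in> A \<Longrightarrow> is_arc V hs ts a"
  using element unfolding A_def is_item_def by blast

lemma item_I: "i \<in> I1 \<union> I2 \<Longrightarrow> is_item V hs ts i"
  using element unfolding I1_def I2_def is_arc_def by blast

lemma card_item_I: "i \<in> I1 \<union> I2 \<Longrightarrow> card (hs i) \<le> 2"
  using element unfolding I1_def I2_def is_arc_def by blast

lemma enters_item: "i \<in> I1 \<union> I2 \<Longrightarrow> enters hs ts i U \<longleftrightarrow> hs i \<inter> U \<noteq> {}"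
  unfolding I1_def I2_def enters_def by auto

lemma all_split: "F1 \<union> F2 = A \<union> I1 \<union> I2"
  unfolding A_def I1_def I2_def by blast

lemma A_I: "A \<inter> (I1 \<union> I2) = {}"
  unfolding A_def I1_def I2_def by blast

lemma unentered_Int:
  assumes "unentered U" "unentered W" "U \<inter> W \<noteq> {}"
  shows "unentered (U \<inter> W)"
proof -
  have "entering hs ts A (U \<inter> W) \<subseteq> entering hs ts A U \<union> entering hs ts A W"
    using arc_A unfolding entering_def enters_def is_arc_def by fastforce
  then show ?thesis using assms unfolding unentered_def by blast
qed

lemma source_subset:
  assumes "J \<in> sources" "unentered U" "J \<inter> U \<noteq> {}"
  shows "J \<subseteq> U"
proof -
  have "unentered (J \<inter> U)" using assms unentered_Int unfolding sources_def by blast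
  then have "J \<inter> U = J" using assms(1) unfolding sources_def by blast
  then show ?thesis by blast
qed

lemma source_unentered: "J \<in> sources \<Longrightarrow> unentered J"
  unfolding sources_def by blast

lemma sources_disjoint: "J \<in> sources \<Longrightarrow> J' \<in> sources \<Longrightarrow> J \<inter> J' \<noteq> {} \<Longrightarrow> J = J'"
  using source_subset[of J J'] source_subset[of J' J] source_unentered by blast

lemma finite_sources: "finite sources"
  by (rule finite_subset[of _ "Pow V"]) (auto simp: sources_def unentered_def finite_V)

lemma source_exists:
  assumes "unentered U"
  obtains J where "J \<in> sources" "J \<subseteq> U"
proof -
  obtain J where J: "unentered J \<and> J \<subseteq> U"
    and min: "\<And>W. unentered W \<and> W \<subseteq> U \<Longrightarrow> card J \<le> card W"
    using ex_has_least_nat[of "\<lambda>W. unentered W \<and> W \<subseteq> U" U card] assms by blast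
  have "W = J" if "unentered W" "W \<subseteq> J" for W
  proof (rule card_subset_eq)
    show "finite J" using J finite_V unfolding unentered_def by (auto intro: finite_subset)
    then have "card W \<le> card J" using that by (simp add: card_mono)
    moreover have "card J \<le> card W" using min[of W] that J by blast
    ultimately show "card W = card J" by simp
  qed (use that in blast)
  then show thesis using J that[of J] unfolding sources_def by blast
qed

lemma unentered_touched1:
  assumes "unentered U" shows "\<exists>i\<in>I1. enters hs ts i U"
  using coveringD[OF covering_F1, of U] assms unfolding unentered_def entering_def A_def I1_def by blast

lemma unentered_touched2:
  assumes "unentered U" shows "\<exists>i\<in>I2. enters hs ts i U"
  using coveringD[OF covering_F2, of U] assms unfolding unentered_def entering_def A_def I2_def by blast

lemma card_entering_union:
  assumes "U \<subseteq> V" "U \<noteq> {}"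
  shows "2 \<le> card (entering hs ts (F1 \<union> F2) U)"
proof -
  have "entering hs ts (F1 \<union> F2) U = entering hs ts F1 U \<union> entering hs ts F2 U"
    "entering hs ts F1 U \<inter> entering hs ts F2 U = {}"
    using disjoint_F unfolding entering_def by auto
  then have "card (entering hs ts (F1 \<union> F2) U) = card (entering hs ts F1 U) + card (entering hs ts F2 U)"
    using finite_F1 finite_F2 by (simp add: card_Un_disjoint)
  then show ?thesis
    using covering_card[OF covering_F1 finite_F1 assms] covering_card[OF covering_F2 finite_F2 assms]
    by linarith
qed

end

section \<open>The link graph on the items and its chains\<close>

locale linked_covers = two_covers +
  fixes p q :: "'a set \<Rightarrow> 'b"
  assumes p: "J \<in> sources \<Longrightarrow> p J \<in> I1 \<and> enters hs ts (p J) J"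
    and q: "J \<in> sources \<Longrightarrow> q J \<in> I2 \<and> enters hs ts (q J) J"
begin

text \<open>
  Items are the vertices of a graph with one link per source J, joining the items \<open>p J\<close> and \<open>q J\<close> of
  different covers. Degrees are at most 2 because the sources are disjoint, so components are paths and
  cycles, and interchanging the two covers on a component leaves every source entered by both.
\<close>

definition "links i = {J \<in> sources. p J = i \<or> q J = i}"
definition "slack i = 2 - int (card (links i))"

definition link_closed :: "'b set \<Rightarrow> bool" where
  "link_closed C \<longleftrightarrow> C \<subseteq> I1 \<union> I2 \<and> (\<forall>J\<in>sources. p J \<in> C \<longleftrightarrow> q J \<in> C)"

lemma links_hit: "J \<in> links i \<Longrightarrow> J \<in> sources \<and> i \<in> I1 \<union> I2 \<and> J \<inter> hs i \<noteq> {}"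
  using p q unfolding links_def enters_def by blast

lemma card_links:
  assumes i: "i \<in> I1 \<union> I2" and B: "\<And>J. J \<in> links i \<Longrightarrow> J \<inter> B = {}"
  shows "card (links i) \<le> card (hs i - B)"
proof (rule card_le_card_hit)
  show "finite (hs i - B)" using item_I[OF i] unfolding is_item_def by blast
  show "J \<inter> (hs i - B) \<noteq> {}" if "J \<in> links i" for J
    using links_hit[OF that] B[OF that] by blast
  show "J = J'" if "J \<in> links i" "J' \<in> links i" "J \<inter> J' \<noteq> {}" for J J'
    using links_hit that sources_disjoint by blast
qed

lemma slack_ge: "i \<in> I1 \<union> I2 \<Longrightarrow> 2 - int (card (hs i)) \<le> slack i"
  using card_links[of i "{}"] unfolding slack_def by simp

lemma slack_nonneg: "i \<in> I1 \<union> I2 \<Longrightarrow> 0 \<le> slack i"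
  using slack_ge[of i] card_item_I[of i] by linarith

text \<open>As sources are disjoint, each head of an item accounts for at most one link, and a head
  in no linked source for none. So in this situation an edge has slack at least 1 and a half-edge
  slack 2.\<close>

lemma slack_missed:
  assumes "i \<in> I1 \<union> I2" "b \<in> hs i" "\<And>J. J \<in> links i \<Longrightarrow> b \<notin> J"
  shows "3 - int (card (hs i)) \<le> slack i"
proof -
  have "card (links i) \<le> card (hs i - {b})" using assms by (intro card_links) auto
  also have "card (hs i - {b}) = card (hs i) - 1" using assms(2) by simp
  finally have "card (links i) \<le> card (hs i) - 1" .
  moreover have "0 < card (hs i)"
    using assms item_I[OF assms(1)] unfolding is_item_def by (auto simp: card_gt_0_iff)
  ultimately show ?thesis unfolding slack_def by linarith
qed

text \<open>The total slack is at most 2 because a connected set of n items carries at least \<open>n - 1\<close> links.\<close>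

lemma chain:
  assumes x: "x \<in> I1 \<union> I2"
  obtains C where "link_closed C" "x \<in> C" "sum slack C \<le> 2"
    "sum slack (C \<inter> I1) - sum slack (C \<inter> I2) = 2 * int (card (C \<inter> I1)) - 2 * int (card (C \<inter> I2))"
proof -
  have "p ` sources \<subseteq> I1 \<union> I2" "q ` sources \<subseteq> I1 \<union> I2" using p q by auto
  moreover have "finite (I1 \<union> I2)" using finite_items by simp
  ultimately have "\<exists>C\<subseteq>I1 \<union> I2. x \<in> C \<and> (\<forall>J\<in>sources. p J \<in> C \<longleftrightarrow> q J \<in> C) \<and>
      card C \<le> card {J \<in> sources. p J \<in> C} + 1"
    using finite_sources x by (intro chain_exists)
  then obtain C where C': "C \<subseteq> I1 \<union> I2 \<and> x \<in> C \<and> (\<forall>J\<in>sources. p J \<in> C \<longleftrightarrow> q J \<in> C) \<and>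
      card C \<le> card {J \<in> sources. p J \<in> C} + 1" by (rule exE)
  have C: "C \<subseteq> I1 \<union> I2" "x \<in> C" "\<And>J. J \<in> sources \<Longrightarrow> p J \<in> C \<longleftrightarrow> q J \<in> C"
    "card C \<le> card {J \<in> sources. p J \<in> C} + 1"
    using C' by simp_all
  let ?l = "card {J \<in> sources. p J \<in> C}"
  have finC: "finite C" using C(1) finite_items by (auto intro: finite_subset)
  \<comment> \<open>The links in C are counted once at their ends in \<open>I1\<close> and once at
    their ends in \<open>I2\<close>. That both counts agree gives the equation between slacks and
    item counts of the two sides.\<close>
  have "{J \<in> sources. p J \<in> C} = {J \<in> sources. p J \<in> C \<inter> I1}" using p by blast
  then have "?l = (\<Sum>i\<in>C \<inter> I1. card {J \<in> sources. p J = i})"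
    using card_preimage_sum[OF finite_sources, of "C \<inter> I1" p] finC by simp
  also have "\<dots> = (\<Sum>i\<in>C \<inter> I1. card (links i))"
  proof (rule sum.cong[OF refl])
    fix i assume "i \<in> C \<inter> I1"
    then have "{J \<in> sources. p J = i} = links i" using q I12 unfolding links_def by blast
    then show "card {J \<in> sources. p J = i} = card (links i)" by simp
  qed
  finally have l1: "?l = (\<Sum>i\<in>C \<inter> I1. card (links i))" .
  have "{J \<in> sources. p J \<in> C} = {J \<in> sources. q J \<in> C \<inter> I2}" using q C(3) by blast
  then have "?l = (\<Sum>i\<in>C \<inter> I2. card {J \<in> sources. q J = i})"
    using card_preimage_sum[OF finite_sources, of "C \<inter> I2" q] finC by simp
  also have "\<dots> = (\<Sum>i\<in>C \<inter> I2. card (links i))"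
  proof (rule sum.cong[OF refl])
    fix i assume "i \<in> C \<inter> I2"
    then have "{J \<in> sources. q J = i} = links i" using p I12 unfolding links_def by blast
    then show "card {J \<in> sources. q J = i} = card (links i)" by simp
  qed
  finally have l2: "?l = (\<Sum>i\<in>C \<inter> I2. card (links i))" .
  have s1: "sum slack (C \<inter> I1) = 2 * int (card (C \<inter> I1)) - int ?l"
    unfolding slack_def l1 by (simp add: sum_subtractf)
  have s2: "sum slack (C \<inter> I2) = 2 * int (card (C \<inter> I2)) - int ?l"
    unfolding slack_def l2 by (simp add: sum_subtractf)
  have Csplit: "C = (C \<inter> I1) \<union> (C \<inter> I2)" and disj: "(C \<inter> I1) \<inter> (C \<inter> I2) = {}" using C(1) I12 by auto
  have "card C = card (C \<inter> I1) + card (C \<inter> I2)"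
    using card_Un_disjoint[of "C \<inter> I1" "C \<inter> I2"] finC disj Csplit by simp
  moreover have "sum slack C = sum slack (C \<inter> I1) + sum slack (C \<inter> I2)"
    using sum.union_disjoint[of "C \<inter> I1" "C \<inter> I2" slack] finC disj Csplit by simp
  ultimately have "sum slack C \<le> 2" using s1 s2 C(4) by linarith
  then show thesis using C s1 s2 by (intro that[of C]) (auto simp: link_closed_def)
qed

lemma slack_sum_ge:
  assumes "link_closed C" "D \<subseteq> C"
  shows "sum slack D \<le> sum slack C"
  using assms slack_nonneg finite_items unfolding link_closed_def
  by (intro sum_mono2) (auto intro: finite_subset)

definition "swap1 C = (I1 - C) \<union> (I2 \<inter> C)"
definition "swap2 C = (I2 - C) \<union> (I1 \<inter> C)"

lemma swap_both:
  assumes C: "link_closed C" and J: "J \<in> sources"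
  shows "{p J, q J} \<inter> swap1 C \<noteq> {} \<and> {p J, q J} \<inter> swap2 C \<noteq> {}"
  using p[OF J] q[OF J] C J unfolding link_closed_def swap1_def swap2_def by blast

text \<open>A closed set contains both ends of a link or neither, so after the swap
  \<open>p J\<close> and \<open>q J\<close> are again on different sides, and every unentered set,
  containing a source, is entered from both. The arcs cannot stay where they were, since they were
  laid out from the old items; \<open>two_coverings\<close> deals them out anew.\<close>

lemma swap_covers:
  assumes C: "link_closed C"
  obtains A1 A2 where "A1 \<union> A2 = A" "A1 \<inter> A2 = {}"
    "covering V hs ts (A1 \<union> swap1 C)" "covering V hs ts (A2 \<union> swap2 C)"
proof (rule two_coverings[of V A "swap1 C" "swap2 C" hs ts])
  have sw: "swap1 C \<union> swap2 C = I1 \<union> I2"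
    using C unfolding link_closed_def swap1_def swap2_def by blast
  then have "A \<union> swap1 C \<union> swap2 C = F1 \<union> F2" using all_split by blast
  then show "2 \<le> card (entering hs ts (A \<union> swap1 C \<union> swap2 C) U)" if "U \<subseteq> V" "U \<noteq> {}" for U
    using card_entering_union[OF that] by simp
  show "is_item V hs ts i" if "i \<in> swap1 C \<union> swap2 C" for i using that item_I sw by blast
  show "(\<exists>i\<in>swap1 C. enters hs ts i U) \<and> (\<exists>i\<in>swap2 C. enters hs ts i U)"
    if U: "U \<subseteq> V" "U \<noteq> {}" "entering hs ts A U = {}" for U
  proof -
    obtain J where J: "J \<in> sources" "J \<subseteq> U" using source_exists[of U] U unfolding unentered_def by blast
    have "enters hs ts (p J) U" "enters hs ts (q J) U"
      using p[OF J(1)] q[OF J(1)] J(2) enters_item by blast+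
    then show ?thesis using swap_both[OF C J(1)] by blast
  qed
  show "thesis" if "A1 \<union> A2 = A" "A1 \<inter> A2 = {}" "covering V hs ts (A1 \<union> swap1 C)"
    "covering V hs ts (A2 \<union> swap2 C)" for A1 A2
    by (rule \<open>\<And>A1 A2. A1 \<union> A2 = A \<Longrightarrow> A1 \<inter> A2 = {} \<Longrightarrow> covering V hs ts (A1 \<union> swap1 C) \<Longrightarrow> covering V hs ts (A2 \<union> swap2 C) \<Longrightarrow> thesis\<close>[OF that])
  show "finite V" "finite A" by (simp_all add: finite_V finite_items)
  show "finite (swap1 C)" "finite (swap2 C)" using finite_items unfolding swap1_def swap2_def by auto
  show "is_arc V hs ts a" if "a \<in> A" for a using arc_A that by blast
qed

end

text \<open>The links may be chosen freely. Preferring x makes it an end of the link of every source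
  it enters; \<open>one_item_per_comp\<close> needs this in order to remove x, since the other
  sources then lose nothing.\<close>

lemma (in two_covers) linked_exists:
  assumes "x \<in> I2"
  shows "\<exists>p q. linked_covers V hs ts F1 F2 p q \<and> (\<forall>J\<in>sources. enters hs ts x J \<longrightarrow> q J = x)"
proof -
  have "\<forall>J\<in>sources. \<exists>i. i \<in> I1 \<and> enters hs ts i J"
    using unentered_touched1 source_unentered by blast
  then obtain p where p: "\<forall>J\<in>sources. p J \<in> I1 \<and> enters hs ts (p J) J" by (rule bchoice[THEN exE])
  have "\<forall>J\<in>sources. \<exists>i. (i \<in> I2 \<and> enters hs ts i J) \<and> (enters hs ts x J \<longrightarrow> i = x)"
    using unentered_touched2 source_unentered assms by blast
  then obtain q where q: "\<forall>J\<in>sources. (q J \<in> I2 \<and> enters hs ts (q J) J) \<and> (enters hs ts x J \<longrightarrow> q J = x)"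
    by (rule bchoice[THEN exE])
  have "linked_covers V hs ts F1 F2 p q" by unfold_locales (use p q in auto)
  then show ?thesis using q by blast
qed

section \<open>Tagged copies of elements\<close>

lemma enters_fst: "enters (hs \<circ> fst) (ts \<circ> fst) e U \<longleftrightarrow> enters hs ts (fst e) U"
  unfolding enters_def by simp

lemma covering_image_fst:
  "covering V (hs \<circ> fst) (ts \<circ> fst) G \<Longrightarrow> covering V hs ts (fst ` G)"
  unfolding covering_def by (simp add: enters_fst)

lemma covering_tag:
  "covering V hs ts F \<Longrightarrow> covering V (hs \<circ> fst) (ts \<circ> fst) (F \<times> {n})"
  unfolding covering_def by (simp add: enters_fst)

lemma sum_tag: "(\<Sum>e\<in>F \<times> {n}. g (fst e)) = sum g F"
  by (simp add: sum.cartesian_product')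

text \<open>Two copies of one element merge under the projection, so a cover by copies bounds the
  cost of the cover it yields.\<close>

lemma sum_image_fst_le:
  fixes g :: "'i \<Rightarrow> nat"
  shows "finite G \<Longrightarrow> sum g (fst ` G) \<le> (\<Sum>e\<in>G. g (fst e))"
  using sum_image_le[of G g fst] by simp

lemma sum_tailless:
  "finite S \<Longrightarrow> (\<Sum>e\<in>S. of_bool (ts e = {})) = card {e \<in> S. ts e = {}}"
  by (simp add: of_bool_def sum.If_cases Int_def)

section \<open>Tight costs\<close>

text \<open>What is left when the reductions in \<open>cover_packing_exists\<close> no longer apply.
  \<open>useful\<close> excludes elements that half-edges could replace at no loss,
  \<open>tight\<close> supplies the covers used as exchange partners, and \<open>positive\<close>
  keeps the subtraction \<open>c - \<rho>\<close> on natural numbers from truncating.\<close>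

locale tight_system =
  fixes V :: "'v set" and hs ts :: "'i \<Rightarrow> 'v set" and X :: "'i set" and hf :: "'v \<Rightarrow> 'i" and c :: "'i \<Rightarrow> nat"
  assumes finV: "finite V" and V_ne: "V \<noteq> {}" and finX: "finite X"
    and X_element: "e \<in> X \<Longrightarrow> (is_item V hs ts e \<and> card (hs e) = 2) \<or> is_arc V hs ts e"
    and hs_hf: "v \<in> V \<Longrightarrow> hs (hf v) = {v}" and ts_hf: "v \<in> V \<Longrightarrow> ts (hf v) = {}"
    and useful: "e \<in> X \<Longrightarrow> c e < (\<Sum>v\<in>hs e. c (hf v))"
    and tight: "t \<in> V \<Longrightarrow> \<exists>F\<subseteq>X \<union> hf ` V. covering V hs ts F \<and> hf t \<in> F \<and>
      (\<forall>G\<subseteq>X \<union> hf ` V. covering V hs ts G \<longrightarrow> sum c F \<le> sum c G)"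
    and connected: "Q \<subseteq> V \<Longrightarrow> Q \<noteq> {} \<Longrightarrow> Q \<noteq> V \<Longrightarrow>
      \<exists>e\<in>X. (hs e \<union> ts e) \<inter> Q \<noteq> {} \<and> \<not> (hs e \<union> ts e) \<subseteq> Q"
    and positive: "e \<in> X \<union> hf ` V \<Longrightarrow> ts e = {} \<Longrightarrow> 1 \<le> c e"
begin

definition "Y = X \<union> hf ` V"
text \<open>
  \<open>\<rho>\<close> is the row of the constraint for the partition into arc components. Minimising \<open>\<kappa>\<close> means minimising
  \<open>c - \<rho>\<close> first and the number of tailless elements second, as no cover has more than \<open>card Y\<close> elements.
\<close>

definition "\<rho> e = (of_bool (ts e = {}) :: nat)"
definition "\<kappa> e = (card Y + 1) * (c e - \<rho> e) + \<rho> e"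
definition "copt F \<longleftrightarrow> F \<subseteq> Y \<and> covering V hs ts F \<and> (\<forall>G\<subseteq>Y. covering V hs ts G \<longrightarrow> sum c F \<le> sum c G)"
definition "kopt F \<longleftrightarrow> F \<subseteq> Y \<and> covering V hs ts F \<and> (\<forall>G\<subseteq>Y. covering V hs ts G \<longrightarrow> sum \<kappa> F \<le> sum \<kappa> G)"

lemma finY: "finite Y" unfolding Y_def using finX finV by simp

lemma hf_eq: "a \<in> V \<Longrightarrow> b \<in> V \<Longrightarrow> hf a = hf b \<longleftrightarrow> a = b"
  using hs_hf by (metis singleton_inject)

lemma Y_element: "e \<in> Y \<Longrightarrow> (is_item V hs ts e \<and> card (hs e) \<le> 2) \<or> is_arc V hs ts e"
  using X_element hs_hf ts_hf unfolding Y_def is_item_def by fastforce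

text \<open>Read as a formula for \<open>\<kappa>\<close>: a cover that costs no more under c and
  has no fewer tailless elements costs no more under \<open>\<kappa>\<close>.\<close>

lemma kappa_c: "e \<in> Y \<Longrightarrow> \<kappa> e + card Y * \<rho> e = (card Y + 1) * c e"
proof -
  assume e: "e \<in> Y"
  show ?thesis
  proof (cases "ts e = {}")
    case True
    then obtain k where "c e = Suc k" using positive[of e] e unfolding Y_def by (cases "c e") auto
    then show ?thesis using True unfolding \<kappa>_def \<rho>_def by simp
  qed (simp add: \<kappa>_def \<rho>_def)
qed

lemma kappa_hf: "v \<in> V \<Longrightarrow> \<kappa> (hf v) = (card Y + 1) * (c (hf v) - 1) + 1"
  unfolding \<kappa>_def \<rho>_def by (simp add: ts_hf)

lemma kappa_hf_pos: "v \<in> V \<Longrightarrow> 0 < \<kappa> (hf v)" by (simp add: kappa_hf)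

text \<open>Reducing the half-edge but not the arc turns the strict inequality \<open>useful\<close>
  into a weak one. The second summand of \<open>\<kappa>\<close> makes it strict again.\<close>

lemma kappa_arc:
  assumes "a \<in> X" "ts a \<noteq> {}" "hs a = {x}" "x \<in> V" shows "\<kappa> a < \<kappa> (hf x)"
proof -
  have "c a \<le> c (hf x) - 1" using useful[OF assms(1)] assms(3) by simp
  then have "(card Y + 1) * c a \<le> (card Y + 1) * (c (hf x) - 1)" by (rule mult_le_mono2)
  then show ?thesis using assms kappa_hf[OF assms(4)] unfolding \<kappa>_def \<rho>_def by simp
qed

text \<open>The reduction takes 1 from the left and 2 from the right, and by integrality a weak
  inequality survives. Strictness comes from counting two half-edges against one edge.\<close>

lemma kappa_edge:
  assumes "e \<in> X" "ts e = {}" "hs e = {x, y}" "x \<noteq> y" "x \<in> V" "y \<in> V"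
  shows "\<kappa> e < \<kappa> (hf x) + \<kappa> (hf y)"
proof -
  have "c e < c (hf x) + c (hf y)" using useful[OF assms(1)] assms(3,4) by simp
  moreover have "1 \<le> c (hf x)" "1 \<le> c (hf y)" using positive assms ts_hf by auto
  ultimately have "c e - 1 \<le> (c (hf x) - 1) + (c (hf y) - 1)" by linarith
  then have "(card Y + 1) * (c e - 1) \<le> (card Y + 1) * ((c (hf x) - 1) + (c (hf y) - 1))"
    by (rule mult_le_mono2)
  then show ?thesis
    using assms kappa_hf[OF assms(5)] kappa_hf[OF assms(6)] unfolding \<kappa>_def \<rho>_def
    by (simp add: distrib_left)
qed

lemma covering_hf: "covering V hs ts (hf ` V)"
  unfolding covering_def enters_def using hs_hf ts_hf by fastforce

lemma kopt_exists: "\<exists>F. kopt F"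
proof -
  have "hf ` V \<subseteq> Y \<and> covering V hs ts (hf ` V)" unfolding Y_def using covering_hf by blast
  then have "\<exists>F. (F \<subseteq> Y \<and> covering V hs ts F) \<and> (\<forall>G. (G \<subseteq> Y \<and> covering V hs ts G) \<longrightarrow> sum \<kappa> F \<le> sum \<kappa> G)"
    by (rule ex_has_least_nat)
  then show ?thesis unfolding kopt_def by blast
qed

lemma copt_exists: "t \<in> V \<Longrightarrow> \<exists>F. copt F \<and> hf t \<in> F"
  using tight[of t] unfolding copt_def Y_def by blast

lemma koptD: "kopt F \<Longrightarrow> F \<subseteq> Y" "kopt F \<Longrightarrow> covering V hs ts F" "kopt F \<Longrightarrow> finite F"
  unfolding kopt_def using finY by (auto intro: finite_subset)

lemma coptD: "copt F \<Longrightarrow> F \<subseteq> Y" "copt F \<Longrightarrow> covering V hs ts F" "copt F \<Longrightarrow> finite F"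
  unfolding copt_def using finY by (auto intro: finite_subset)

lemma kopt_le: "kopt F \<Longrightarrow> G \<subseteq> Y \<Longrightarrow> covering V hs ts G \<Longrightarrow> sum \<kappa> F \<le> sum \<kappa> G"
  unfolding kopt_def by blast

lemma kopt_le_tagged:
  assumes "kopt F" "fst ` G \<subseteq> Y" "finite G" "covering V (hs \<circ> fst) (ts \<circ> fst) G"
  shows "sum \<kappa> F \<le> (\<Sum>e\<in>G. \<kappa> (fst e))"
  using kopt_le[OF assms(1,2) covering_image_fst[OF assms(4)]] sum_image_fst_le[OF assms(3), of \<kappa>]
  by linarith

lemma koptI_tagged:
  assumes "kopt F" "fst ` G \<subseteq> Y" "finite G" "covering V (hs \<circ> fst) (ts \<circ> fst) G"
    and "(\<Sum>e\<in>G. \<kappa> (fst e)) \<le> sum \<kappa> F"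
  shows "kopt (fst ` G)"
  using assms(1,2,5) covering_image_fst[OF assms(4)] sum_image_fst_le[OF assms(3), of \<kappa>]
  unfolding kopt_def by (meson order_trans)

lemma two_covers_tagged:
  assumes "F \<subseteq> Y" "covering V hs ts F" "G \<subseteq> Y" "covering V hs ts G"
  shows "two_covers V (hs \<circ> fst) (ts \<circ> fst) (F \<times> {0::nat}) (G \<times> {1})"
proof
  show "finite V" by (rule finV)
  show "finite (F \<times> {0::nat})" "finite (G \<times> {1::nat})"
    using assms finY by (auto intro: finite_subset)
  show "F \<times> {0::nat} \<inter> G \<times> {1} = {}" by auto
  show "covering V (hs \<circ> fst) (ts \<circ> fst) (F \<times> {0::nat})" "covering V (hs \<circ> fst) (ts \<circ> fst) (G \<times> {1::nat})"
    using covering_tag[OF assms(2)] covering_tag[OF assms(4)] by this+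
  fix e :: "'i \<times> nat" assume "e \<in> F \<times> {0} \<union> G \<times> {1}"
  then have "fst e \<in> Y" using assms by auto
  then show "(is_item V (hs \<circ> fst) (ts \<circ> fst) e \<and> card ((hs \<circ> fst) e) \<le> 2) \<or> is_arc V (hs \<circ> fst) (ts \<circ> fst) e"
    using Y_element[of "fst e"] unfolding is_item_def is_arc_def by simp
qed

end

section \<open>Swaps between two tagged covers of a tight system\<close>

locale tagged_pair = tight_system V hs ts X hf c +
  linked_covers V "hs \<circ> fst" "ts \<circ> fst" "F \<times> {0::nat}" "G \<times> {1::nat}" p q
  for V :: "'v set" and hs ts :: "'i \<Rightarrow> 'v set" and X hf c F G p q +
  assumes FY: "F \<subseteq> Y" and GY: "G \<subseteq> Y"
begin

lemma hf_I1: "t \<in> V \<Longrightarrow> hf t \<in> F \<Longrightarrow> (hf t, 0) \<in> I1"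
  unfolding I1_def by (simp add: ts_hf)

lemma hf_I2: "t \<in> V \<Longrightarrow> hf t \<in> G \<Longrightarrow> (hf t, 1) \<in> I2"
  unfolding I2_def by (simp add: ts_hf)

lemma slack_hf1: "t \<in> V \<Longrightarrow> hf t \<in> F \<Longrightarrow> 1 \<le> slack (hf t, 0)"
  using slack_ge[of "(hf t, 0)"] hf_I1[of t] by (simp add: hs_hf)

lemma slack_hf2: "t \<in> V \<Longrightarrow> hf t \<in> G \<Longrightarrow> 1 \<le> slack (hf t, 1)"
  using slack_ge[of "(hf t, 1)"] hf_I2[of t] by (simp add: hs_hf)

lemma swap_tagged:
  assumes C: "link_closed C"
  obtains G1 G2 where "G1 \<union> G2 = F \<times> {0} \<union> G \<times> {1}" "G1 \<inter> G2 = {}"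
    "covering V (hs \<circ> fst) (ts \<circ> fst) G1" "covering V (hs \<circ> fst) (ts \<circ> fst) G2"
    "{e \<in> G1. ts (fst e) = {}} = swap1 C" "{e \<in> G2. ts (fst e) = {}} = swap2 C"
    "finite G1" "finite G2" "fst ` G1 \<subseteq> Y" "fst ` G2 \<subseteq> Y"
    "\<forall>g::'i \<Rightarrow> nat. (\<Sum>e\<in>G1. g (fst e)) + (\<Sum>e\<in>G2. g (fst e)) = sum g F + sum g G"
proof -
  obtain A1 A2 where A12: "A1 \<union> A2 = A" "A1 \<inter> A2 = {}"
    "covering V (hs \<circ> fst) (ts \<circ> fst) (A1 \<union> swap1 C)" "covering V (hs \<circ> fst) (ts \<circ> fst) (A2 \<union> swap2 C)"
    using swap_covers[OF C] by metis
  have sw: "swap1 C \<union> swap2 C = I1 \<union> I2" "swap1 C \<inter> swap2 C = {}"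
    using C I12 unfolding link_closed_def swap1_def swap2_def by blast+
  have un: "(A1 \<union> swap1 C) \<union> (A2 \<union> swap2 C) = F \<times> {0} \<union> G \<times> {1}"
    using all_split sw(1) A12(1) by blast
  have dis: "(A1 \<union> swap1 C) \<inter> (A2 \<union> swap2 C) = {}"
    using sw A12(1,2) A_I by blast
  have it: "ts (fst e) = {}" if "e \<in> I1 \<union> I2" for e using that unfolding I1_def I2_def by auto
  have ar: "ts (fst e) \<noteq> {}" if "e \<in> A" for e using that unfolding A_def by auto
  have "{e \<in> A1 \<union> swap1 C. ts (fst e) = {}} = swap1 C" "{e \<in> A2 \<union> swap2 C. ts (fst e) = {}} = swap2 C"
    using it ar A12(1) sw(1) by blast+
  moreover have fin: "finite (A1 \<union> swap1 C)" "finite (A2 \<union> swap2 C)"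
    using un finite_F1 finite_F2 by (metis finite_Un)+
  moreover have "fst ` (A1 \<union> swap1 C) \<subseteq> Y" "fst ` (A2 \<union> swap2 C) \<subseteq> Y"
  proof -
    have "fst ` (F \<times> {0::nat} \<union> G \<times> {1}) \<subseteq> Y" using FY GY by auto
    then show "fst ` (A1 \<union> swap1 C) \<subseteq> Y" "fst ` (A2 \<union> swap2 C) \<subseteq> Y" using un by blast+
  qed
  moreover have "(\<Sum>e\<in>A1 \<union> swap1 C. g (fst e)) + (\<Sum>e\<in>A2 \<union> swap2 C. g (fst e)) = sum g F + sum g G"
    for g :: "'i \<Rightarrow> nat"
  proof -
    have "(\<Sum>e\<in>A1 \<union> swap1 C. g (fst e)) + (\<Sum>e\<in>A2 \<union> swap2 C. g (fst e))
        = (\<Sum>e\<in>F \<times> {0::nat} \<union> G \<times> {1}. g (fst e))"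
      unfolding un[symmetric] by (rule sum.union_disjoint[OF fin dis, symmetric])
    also have "\<dots> = (\<Sum>e\<in>F \<times> {0::nat}. g (fst e)) + (\<Sum>e\<in>G \<times> {1::nat}. g (fst e))"
      by (rule sum.union_disjoint[OF finite_F1 finite_F2 disjoint_F])
    finally show ?thesis by (simp only: sum_tag)
  qed
  ultimately show thesis using that[OF un dis A12(3,4)] by blast
qed

end

section \<open>At most one half-edge in an optimal cover\<close>

context tight_system
begin

lemma tagged_pair_exists:
  assumes "F \<subseteq> Y" "covering V hs ts F" "G \<subseteq> Y" "covering V hs ts G" "x \<in> V" "hf x \<in> G"
  obtains p q where "tagged_pair V hs ts X hf c F G p q"
    "\<forall>J\<in>two_covers.sources V (hs \<circ> fst) (ts \<circ> fst) (F \<times> {0::nat}) (G \<times> {1::nat}).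
      x \<in> J \<longrightarrow> q J = (hf x, 1)"
proof -
  interpret T: two_covers V "hs \<circ> fst" "ts \<circ> fst" "F \<times> {0::nat}" "G \<times> {1::nat}"
    by (rule two_covers_tagged[OF assms(1-4)])
  have x: "(hf x, 1) \<in> T.I2" unfolding T.I2_def using assms by (simp add: ts_hf)
  obtain p where "\<exists>q. linked_covers V (hs \<circ> fst) (ts \<circ> fst) (F \<times> {0::nat}) (G \<times> {1::nat}) p q \<and>
      (\<forall>J\<in>T.sources. enters (hs \<circ> fst) (ts \<circ> fst) (hf x, 1::nat) J \<longrightarrow> q J = (hf x, 1))"
    using T.linked_exists[OF x] by (rule exE)
  then obtain q where "linked_covers V (hs \<circ> fst) (ts \<circ> fst) (F \<times> {0::nat}) (G \<times> {1::nat}) p q \<and>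
      (\<forall>J\<in>T.sources. enters (hs \<circ> fst) (ts \<circ> fst) (hf x, 1::nat) J \<longrightarrow> q J = (hf x, 1))"
    by (rule exE)
  then have lc: "linked_covers V (hs \<circ> fst) (ts \<circ> fst) (F \<times> {0::nat}) (G \<times> {1::nat}) p q"
    and q: "\<forall>J\<in>T.sources. enters (hs \<circ> fst) (ts \<circ> fst) (hf x, 1::nat) J \<longrightarrow> q J = (hf x, 1)"
    by simp_all
  have "tagged_pair V hs ts X hf c F G p q"
    using lc tight_system_axioms assms(1,3) unfolding tagged_pair_def tagged_pair_axioms_def
    by (simp add: Y_def)
  moreover have "\<forall>J\<in>T.sources. x \<in> J \<longrightarrow> q J = (hf x, 1)"
    using q assms(5) by (simp add: enters_def hs_hf ts_hf)
  ultimately show thesis by (rule that)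
qed

text \<open>Swap along the chain through the copy of \<open>hf t\<close> in a cover G optimal for c;
  nothing more is known of G, since \<open>tight\<close> speaks of c only. The second new cover
  costs at least as much as G, so the first costs at most \<open>sum c F\<close>, and it has no
  fewer tailless elements than F. By \<open>kappa_c\<close> it is optimal for
  \<open>\<kappa>\<close>. If two half-edges of F were lost, they and \<open>hf t\<close> would put
  slack 3 on the chain.\<close>

lemma exchange:
  assumes F: "kopt F" and t: "t \<in> V"
  shows "\<exists>F'. kopt F' \<and> hf t \<in> F' \<and>
    (\<forall>a\<in>V. \<forall>b\<in>V. a \<noteq> b \<longrightarrow> hf a \<in> F \<longrightarrow> hf b \<in> F \<longrightarrow> hf a \<in> F' \<or> hf b \<in> F')"
proof -
  obtain G where G: "copt G" "hf t \<in> G" using copt_exists[OF t] by blast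
  obtain p q where "tagged_pair V hs ts X hf c F G p q"
    using tagged_pair_exists[OF koptD(1,2)[OF F] coptD(1,2)[OF G(1)] t G(2)] by metis
  then interpret P: tagged_pair V hs ts X hf c F G p q .
  have x: "(hf t, 1) \<in> P.I1 \<union> P.I2" using P.hf_I2[OF t G(2)] by simp
  obtain C where C: "P.link_closed C" "(hf t, 1) \<in> C" "sum P.slack C \<le> 2"
    "sum P.slack (C \<inter> P.I1) - sum P.slack (C \<inter> P.I2) = 2 * int (card (C \<inter> P.I1)) - 2 * int (card (C \<inter> P.I2))"
    using P.chain[OF x] by metis
  have CI: "C \<subseteq> P.I1 \<union> P.I2" using C(1) unfolding P.link_closed_def by blast
  then have finC: "finite C" using P.finite_items by (auto intro: finite_subset)
  obtain G1 G2 where G12: "G1 \<union> G2 = F \<times> {0} \<union> G \<times> {1}" "G1 \<inter> G2 = {}"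
    "covering V (hs \<circ> fst) (ts \<circ> fst) G1" "covering V (hs \<circ> fst) (ts \<circ> fst) G2"
    "{e \<in> G1. ts (fst e) = {}} = P.swap1 C" "{e \<in> G2. ts (fst e) = {}} = P.swap2 C"
    "finite G1" "finite G2" "fst ` G1 \<subseteq> Y" "fst ` G2 \<subseteq> Y"
    "\<forall>g::'i \<Rightarrow> nat. (\<Sum>e\<in>G1. g (fst e)) + (\<Sum>e\<in>G2. g (fst e)) = sum g F + sum g G"
    by (rule P.swap_tagged[OF C(1)])
  have c1: "(\<Sum>e\<in>G1. c (fst e)) \<le> sum c F"
  proof -
    have "sum c G \<le> sum c (fst ` G2)"
      using G(1) G12(10) covering_image_fst[OF G12(4)] unfolding copt_def by blast
    also have "\<dots> \<le> (\<Sum>e\<in>G2. c (fst e))" by (rule sum_image_fst_le[OF G12(8)])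
    finally show ?thesis using G12(11)[rule_format, of c] by linarith
  qed
  \<comment> \<open>The side of G has slack at least 1 because of \<open>hf t\<close>, hence the
    side of F at most 1, and the item counts differ by half the difference of the slacks.\<close>
  have n12: "card (C \<inter> P.I1) \<le> card (C \<inter> P.I2)"
  proof -
    have "P.slack (hf t, 1) \<le> sum P.slack (C \<inter> P.I2)"
      using P.slack_nonneg C(2) P.hf_I2[OF t G(2)] finC by (intro member_le_sum) auto
    moreover have "sum P.slack C = sum P.slack (C \<inter> P.I1) + sum P.slack (C \<inter> P.I2)"
    proof -
      have "C = (C \<inter> P.I1) \<union> (C \<inter> P.I2)" using CI by blast
      moreover have "sum P.slack ((C \<inter> P.I1) \<union> (C \<inter> P.I2)) = sum P.slack (C \<inter> P.I1) + sum P.slack (C \<inter> P.I2)"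
        using finC P.I12 by (intro sum.union_disjoint) auto
      ultimately show ?thesis by simp
    qed
    ultimately have "int (card (C \<inter> P.I1)) \<le> int (card (C \<inter> P.I2))"
      using P.slack_hf2[OF t G(2)] C(3,4) by linarith
    then show ?thesis by simp
  qed
  have r1: "sum \<rho> F \<le> (\<Sum>e\<in>G1. \<rho> (fst e))"
  proof -
    have "sum \<rho> F = (\<Sum>e\<in>F \<times> {0::nat}. \<rho> (fst e))" by (simp only: sum_tag)
    also have "\<dots> = card P.I1"
      unfolding \<rho>_def P.I1_def using sum_tailless[OF P.finite_F1, of "ts \<circ> fst"] by simp
    also have "P.I1 = (P.I1 - C) \<union> (C \<inter> P.I1)" by blast
    also have "card \<dots> = card (P.I1 - C) + card (C \<inter> P.I1)"
      using P.finite_items by (intro card_Un_disjoint) auto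
    also have "\<dots> \<le> card (P.I1 - C) + card (P.I2 \<inter> C)" using n12 by (simp add: Int_commute)
    also have "\<dots> = card (P.swap1 C)"
      unfolding P.swap1_def using P.finite_items P.I12 by (intro card_Un_disjoint[symmetric]) auto
    also have "\<dots> = (\<Sum>e\<in>G1. \<rho> (fst e))"
      unfolding \<rho>_def G12(5)[symmetric] using sum_tailless[OF G12(7), of "ts \<circ> fst"] by simp
    finally show ?thesis .
  qed
  have "(\<Sum>e\<in>G1. \<kappa> (fst e)) + card Y * (\<Sum>e\<in>G1. \<rho> (fst e)) = (card Y + 1) * (\<Sum>e\<in>G1. c (fst e))"
  proof -
    have "(\<Sum>e\<in>G1. \<kappa> (fst e) + card Y * \<rho> (fst e)) = (\<Sum>e\<in>G1. (card Y + 1) * c (fst e))"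
      using G12(9) kappa_c by (intro sum.cong) auto
    then show ?thesis by (simp only: sum.distrib sum_distrib_left)
  qed
  also have "\<dots> \<le> (card Y + 1) * sum c F" using c1 by (rule mult_le_mono2)
  also have "\<dots> = sum \<kappa> F + card Y * sum \<rho> F"
  proof -
    have "(\<Sum>e\<in>F. \<kappa> e + card Y * \<rho> e) = (\<Sum>e\<in>F. (card Y + 1) * c e)"
      using koptD(1)[OF F] kappa_c by (intro sum.cong) auto
    then show ?thesis by (simp only: sum.distrib sum_distrib_left)
  qed
  also have "\<dots> \<le> sum \<kappa> F + card Y * (\<Sum>e\<in>G1. \<rho> (fst e))" using r1 by simp
  finally have "(\<Sum>e\<in>G1. \<kappa> (fst e)) \<le> sum \<kappa> F" by simp
  then have k: "kopt (fst ` G1)" using koptI_tagged[OF F G12(9,7,3)] by blast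
  have sw: "P.swap1 C \<subseteq> G1" using G12(5) by blast
  have "(hf t, 1) \<in> G1" using sw C(2) P.hf_I2[OF t G(2)] unfolding P.swap1_def by blast
  then have ht: "hf t \<in> fst ` G1" by force
  have "hf a \<in> fst ` G1 \<or> hf b \<in> fst ` G1" if ab: "a \<in> V" "b \<in> V" "a \<noteq> b" "hf a \<in> F" "hf b \<in> F" for a b
  proof (rule ccontr)
    assume n: "\<not> ?thesis"
    have "(hf a, 0) \<in> C" "(hf b, 0) \<in> C"
      using n sw P.hf_I1[OF ab(1,4)] P.hf_I1[OF ab(2,5)] unfolding P.swap1_def by force+
    then have "{(hf t, 1), (hf a, 0), (hf b, 0)} \<subseteq> C" using C(2) by blast
    from P.slack_sum_ge[OF C(1) this]
    have "P.slack (hf t, 1) + P.slack (hf a, 0) + P.slack (hf b, 0) \<le> sum P.slack C"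
      using hf_eq[OF ab(1,2)] ab(3) by simp
    then show False
      using P.slack_hf2[OF t G(2)] P.slack_hf1[OF ab(1,4)] P.slack_hf1[OF ab(2,5)] C(3) by linarith
  qed
  then show ?thesis using k ht by blast
qed

lemma kopt_strict:
  assumes F: "kopt F" and D: "D \<subseteq> F" and e: "e \<in> X" and cov: "covering V hs ts (insert e (F - D))"
    and lt: "\<kappa> e < sum \<kappa> D"
  shows False
proof -
  have "sum \<kappa> F \<le> sum \<kappa> (insert e (F - D))"
    using kopt_le[OF F _ cov] koptD(1)[OF F] e unfolding Y_def by blast
  also have "\<dots> \<le> \<kappa> e + sum \<kappa> (F - D)"
    using koptD(3)[OF F] by (simp add: sum.insert_if)
  finally show False
    using lt sum.subset_diff[OF D koptD(3)[OF F], of \<kappa>] by simp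
qed

text \<open>The cheaper arc can replace \<open>hf y\<close>: a set containing y either contains x
  too, and then \<open>hf x\<close> enters it, or is entered by the arc.\<close>

lemma not_both_halves_arc:
  assumes F: "kopt F" and a: "a \<in> X" "ts a = {x}" "hs a = {y}" "x \<in> V" "y \<in> V" "x \<noteq> y"
    and h: "hf x \<in> F" "hf y \<in> F"
  shows False
proof (rule kopt_strict[OF F _ a(1), of "{hf y}"])
  show "\<kappa> a < sum \<kappa> {hf y}" using kappa_arc[OF a(1) _ a(3,5)] a(2) by simp
  show "covering V hs ts (insert a (F - {hf y}))"
    unfolding covering_def
  proof (intro allI impI)
    fix U assume U: "U \<subseteq> V" "U \<noteq> {}"
    obtain e where e: "e \<in> F" "enters hs ts e U" using coveringD[OF koptD(2)[OF F] U] by blast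
    show "\<exists>e\<in>insert a (F - {hf y}). enters hs ts e U"
    proof (cases "e = hf y")
      case True
      then have y: "y \<in> U" using e(2) a(5) by (simp add: enters_def hs_hf)
      show ?thesis
      proof (cases "x \<in> U")
        case True
        then have "enters hs ts (hf x) U" using a(4) by (simp add: enters_def hs_hf ts_hf)
        then show ?thesis using h(1) hf_eq[OF a(4,5)] a(6) by blast
      next
        case False
        then have "enters hs ts a U" using y a(2,3) by (simp add: enters_def)
        then show ?thesis by blast
      qed
    qed (use e in blast)
  qed
qed (use h in blast)

lemma not_both_halves_edge:
  assumes F: "kopt F" and a: "a \<in> X" "ts a = {}" "hs a = {x, y}" "x \<in> V" "y \<in> V" "x \<noteq> y"
    and h: "hf x \<in> F" "hf y \<in> F"
  shows False
proof (rule kopt_strict[OF F _ a(1), of "{hf x, hf y}"])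
  show "\<kappa> a < sum \<kappa> {hf x, hf y}"
    using kappa_edge[OF a(1-3,6,4,5)] hf_eq[OF a(4,5)] a(6) by simp
  show "covering V hs ts (insert a (F - {hf x, hf y}))"
    unfolding covering_def
  proof (intro allI impI)
    fix U assume U: "U \<subseteq> V" "U \<noteq> {}"
    obtain e where e: "e \<in> F" "enters hs ts e U" using coveringD[OF koptD(2)[OF F] U] by blast
    show "\<exists>e\<in>insert a (F - {hf x, hf y}). enters hs ts e U"
    proof (cases "e = hf x \<or> e = hf y")
      case True
      then have "enters hs ts a U" using e(2) a by (auto simp: enters_def hs_hf)
      then show ?thesis by blast
    qed (use e in blast)
  qed
qed (use h in blast)

text \<open>The pattern of Gallai's lemma. By \<open>exchange\<close>, never occurring together in
  an optimal cover is a transitive relation on distinct vertices; the ends of an element of X are so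
  related, and connectivity extends this to all pairs.\<close>

lemma one_half:
  assumes F: "kopt F" and a: "a \<in> V" "hf a \<in> F" and b: "b \<in> V" "hf b \<in> F"
  shows "a = b"
proof (rule ccontr)
  assume "a \<noteq> b"
  define P where "P u v \<longleftrightarrow> (\<exists>F. kopt F \<and> hf u \<in> F \<and> hf v \<in> F)" for u v
  have Psym: "P u v \<Longrightarrow> P v u" for u v unfolding P_def by blast
  have Ptri: "P u w \<or> P w v" if uv: "P u v" "u \<in> V" "v \<in> V" "w \<in> V" "u \<noteq> v" for u v w
  proof -
    obtain F where F: "kopt F" "hf u \<in> F" "hf v \<in> F" using \<open>P u v\<close> unfolding P_def by blast
    obtain F' where "kopt F'" "hf w \<in> F'" "hf u \<in> F' \<or> hf v \<in> F'"
      using exchange[OF F(1) uv(4)] F uv by blast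
    then show ?thesis unfolding P_def by blast
  qed
  have nadj: False if euv: "e \<in> X" "u \<in> hs e \<union> ts e" "v \<in> hs e \<union> ts e" "u \<noteq> v" "P u v" for e u v
  proof -
    obtain F where F: "kopt F" "hf u \<in> F" "hf v \<in> F" using \<open>P u v\<close> unfolding P_def by blast
    consider "is_item V hs ts e" "card (hs e) = 2" | "is_arc V hs ts e" using X_element[OF euv(1)] by blast
    then show False
    proof cases
      case 1
      then have it: "ts e = {}" "hs e \<subseteq> V" "finite (hs e)" unfolding is_item_def by auto
      have "{u, v} = hs e" using that it 1(2) by (intro card_subset_eq) auto
      then show False using not_both_halves_edge[OF F(1) that(1) it(1), of u v] F that(4) it(2) by auto
    next
      case 2
      then obtain x y where xy: "x \<in> V" "y \<in> V" "x \<noteq> y" "ts e = {x}" "hs e = {y}"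
        unfolding is_arc_def by blast
      have "hf x \<in> F" "hf y \<in> F" using that(2-4) F xy by auto
      then show False using not_both_halves_arc[OF F(1) that(1) xy(4,5,1,2,3)] by blast
    qed
  qed
  \<comment> \<open>The vertices related to a. The vertex a itself is added by hand, because
    \<open>P a a\<close> holds.\<close>
  define W where "W = {w \<in> V. w = a \<or> \<not> P a w}"
  have "P a b" unfolding P_def using F a b by blast
  then have "W \<noteq> V" "W \<noteq> {}" "W \<subseteq> V" using a b \<open>a \<noteq> b\<close> unfolding W_def by auto
  then obtain e where e: "e \<in> X" "(hs e \<union> ts e) \<inter> W \<noteq> {}" "\<not> (hs e \<union> ts e) \<subseteq> W"
    using connected by metis
  obtain u v where uv: "u \<in> hs e \<union> ts e" "u \<in> W" "v \<in> hs e \<union> ts e" "v \<notin> W" using e(2,3) by blast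
  have "hs e \<union> ts e \<subseteq> V" using X_element[OF e(1)] unfolding is_item_def is_arc_def by auto
  then have V: "u \<in> V" "v \<in> V" using uv by auto
  have v: "v \<noteq> a" "P a v" using uv(4) V unfolding W_def by auto
  have "P a u \<or> P u v" using Ptri[OF v(2) a(1) V(2,1)] v(1) by blast
  moreover have "u \<noteq> v" using uv by blast
  ultimately have "P a u" "u \<noteq> a" using nadj[OF e(1) uv(1,3)] v by auto
  then show False using uv(2) unfolding W_def by blast
qed

lemma kopt_half_exists: "t \<in> V \<Longrightarrow> \<exists>F. kopt F \<and> hf t \<in> F"
  using kopt_exists exchange by blast

text \<open>\<open>one_half\<close> leaves only the case of two copies of the same half-edge. The
  projection does not change if one copy is dropped, but the cost falls strictly.\<close>

lemma two_halves_tagged: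
  assumes F: "kopt F" and G: "fst ` G \<subseteq> Y" "finite G" "covering V (hs \<circ> fst) (ts \<circ> fst) G"
    and le: "(\<Sum>e\<in>G. \<kappa> (fst e)) \<le> sum \<kappa> F"
    and ab: "a \<in> V" "b \<in> V" "(hf a, m) \<in> G" "(hf b, n) \<in> G" "m \<noteq> n"
  shows False
proof -
  have k: "kopt (fst ` G)" by (rule koptI_tagged[OF F G le])
  have "hf a \<in> fst ` G" "hf b \<in> fst ` G" using ab by force+
  then have "a = b" using one_half[OF k] ab by blast
  let ?G = "G - {(hf a, m)}"
  have img: "fst ` ?G = fst ` G"
  proof
    show "fst ` G \<subseteq> fst ` ?G"
    proof
      fix e assume "e \<in> fst ` G"
      then obtain g where g: "g \<in> G" "e = fst g" by blast
      show "e \<in> fst ` ?G"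
      proof (cases "g = (hf a, m)")
        case True
        then have "e = fst (hf b, n)" "(hf b, n) \<in> ?G" using g ab \<open>a = b\<close> by auto
        then show ?thesis by blast
      qed (use g in blast)
    qed
  qed blast
  have "sum \<kappa> F \<le> sum \<kappa> (fst ` ?G)"
    unfolding img using kopt_le[OF F G(1) covering_image_fst[OF G(3)]] .
  also have "\<dots> \<le> (\<Sum>e\<in>?G. \<kappa> (fst e))" using G(2) by (intro sum_image_fst_le) simp
  also have "\<dots> < (\<Sum>e\<in>G. \<kappa> (fst e))"
    using sum.remove[OF G(2) ab(3), of "\<lambda>e. \<kappa> (fst e)"] kappa_hf_pos[OF ab(1)] by simp
  finally show False using le by simp
qed

section \<open>Weak components with respect to arcs\<close>

definition "uncrossed U \<longleftrightarrow> U \<subseteq> V \<and>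
  (\<forall>e\<in>X. ts e \<noteq> {} \<longrightarrow> hs e \<union> ts e \<subseteq> U \<or> (hs e \<union> ts e) \<inter> U = {})"

text \<open>Uncrossed sets are the unions of weak components, so the minimal ones are the
  components. In this form it is immediate that an arc crosses every proper nonempty part of a
  component.\<close>

definition "arc_comps = {K. uncrossed K \<and> K \<noteq> {} \<and> (\<forall>U. uncrossed U \<and> U \<noteq> {} \<and> U \<subseteq> K \<longrightarrow> U = K)}"

lemma arc_compD: "K \<in> arc_comps \<Longrightarrow> uncrossed K" "K \<in> arc_comps \<Longrightarrow> K \<noteq> {}" "K \<in> arc_comps \<Longrightarrow> K \<subseteq> V"
  unfolding arc_comps_def uncrossed_def by auto

lemma uncrossed_Int: "uncrossed U \<Longrightarrow> uncrossed W \<Longrightarrow> uncrossed (U \<inter> W)"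
  unfolding uncrossed_def by blast

lemma arc_comps_disjoint:
  assumes "K \<in> arc_comps" "K' \<in> arc_comps" "K \<inter> K' \<noteq> {}"
  shows "K = K'"
proof -
  have u: "uncrossed (K \<inter> K')" using assms uncrossed_Int arc_compD by blast
  have "K \<inter> K' = K" using u assms unfolding arc_comps_def by blast
  moreover have "K \<inter> K' = K'" using u assms unfolding arc_comps_def by blast
  ultimately show ?thesis by simp
qed

lemma arc_comp_of:
  assumes v: "v \<in> V"
  obtains K where "K \<in> arc_comps" "v \<in> K"
proof -
  have "uncrossed V"
    using X_element unfolding uncrossed_def is_arc_def is_item_def by fastforce
  then obtain K where K: "uncrossed K \<and> v \<in> K"
    and min: "\<And>U. uncrossed U \<and> v \<in> U \<Longrightarrow> card K \<le> card U"
    using ex_has_least_nat[of "\<lambda>U. uncrossed U \<and> v \<in> U" V card] v by blast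
  have finK: "finite K" using K finV unfolding uncrossed_def by (auto intro: finite_subset)
  have "U = K" if U: "uncrossed U" "U \<noteq> {}" "U \<subseteq> K" for U
  proof (cases "v \<in> U")
    case True
    then show ?thesis using min[of U] U finK by (intro card_subset_eq) (auto simp: card_mono le_antisym)
  next
    case False
    \<comment> \<open>A smaller uncrossed set missing v would leave a smaller uncrossed set around v
      as its complement in K.\<close>
    have "uncrossed (K - U)" using U(1) K unfolding uncrossed_def by blast
    then have "card K \<le> card (K - U)" using min[of "K - U"] False K by blast
    moreover have "card (K - U) < card K" using U finK by (intro psubset_card_mono) auto
    ultimately show ?thesis by simp
  qed
  then show thesis using that[of K] K unfolding arc_comps_def by blast
qed

lemma arc_comp_connected:
  assumes K: "K \<in> arc_comps" and U: "K \<inter> U \<noteq> {}" "\<not> K \<subseteq> U"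
  obtains a where "a \<in> X" "ts a \<noteq> {}" "hs a \<union> ts a \<subseteq> K" "(hs a \<union> ts a) \<inter> U \<noteq> {}" "\<not> hs a \<union> ts a \<subseteq> U"
proof -
  have "\<not> uncrossed (K \<inter> U)" using K U unfolding arc_comps_def by blast
  then show thesis using that arc_compD(1,3)[OF K] unfolding uncrossed_def by blast
qed

lemma finite_arc_comps: "finite arc_comps"
  by (rule finite_subset[of _ "Pow V"]) (use arc_compD(3) finV in auto)

text \<open>
  If every x in K were in a set entered only once by F, and every arc inside K were contained in such a
  set, then by submodularity K itself would lie in one, although two items of F touch K.
\<close>

lemma attach:
  assumes F: "F \<subseteq> Y" "covering V hs ts F" and K: "K \<in> arc_comps"
    and ij: "i \<in> F" "j \<in> F" "i \<noteq> j" "ts i = {}" "ts j = {}" "hs i \<inter> K \<noteq> {}" "hs j \<inter> K \<noteq> {}"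
  shows "\<exists>x\<in>K. \<exists>D\<subseteq>X. (\<forall>a\<in>D. ts a \<noteq> {}) \<and> sum \<kappa> D < \<kappa> (hf x) \<and>
    (\<forall>U\<subseteq>V. x \<in> U \<longrightarrow> (\<exists>a\<in>D. enters hs ts a U) \<or> 2 \<le> card (entering hs ts F U))"
proof (rule ccontr)
  assume no: "\<not> ?thesis"
  define Q where "Q x \<longleftrightarrow> (\<exists>D\<subseteq>X. (\<forall>a\<in>D. ts a \<noteq> {}) \<and> sum \<kappa> D < \<kappa> (hf x) \<and>
      (\<forall>U\<subseteq>V. x \<in> U \<longrightarrow> (\<exists>a\<in>D. enters hs ts a U) \<or> 2 \<le> card (entering hs ts F U)))" for x
  have neg: "\<exists>U\<subseteq>V. x \<in> U \<and> \<not> (\<exists>a\<in>D. enters hs ts a U) \<and> \<not> 2 \<le> card (entering hs ts F U)"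
    if xD: "x \<in> K" "D \<subseteq> X" "\<forall>a\<in>D. ts a \<noteq> {}" "sum \<kappa> D < \<kappa> (hf x)" for x D
  proof (rule ccontr)
    assume "\<not> ?thesis"
    then have "\<forall>U\<subseteq>V. x \<in> U \<longrightarrow> (\<exists>a\<in>D. enters hs ts a U) \<or> 2 \<le> card (entering hs ts F U)" by blast
    with xD(3,4) have "\<exists>D\<subseteq>X. (\<forall>a\<in>D. ts a \<noteq> {}) \<and> sum \<kappa> D < \<kappa> (hf x) \<and>
      (\<forall>U\<subseteq>V. x \<in> U \<longrightarrow> (\<exists>a\<in>D. enters hs ts a U) \<or> 2 \<le> card (entering hs ts F U))"
      by (intro exI[of _ D] conjI xD(2))
    then have "Q x" unfolding Q_def .
    then have "\<exists>x\<in>K. Q x" using xD(1) by (rule bexI)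
    then show False using no unfolding Q_def by (rule notE[rotated])
  qed
  have finF: "finite F" using F finY by (auto intro: finite_subset)
  \<comment> \<open>Sets meeting K that F enters exactly once. The choice \<open>D = {}\<close>
    shows that there is one, and a largest is taken.\<close>
  define tgt where "tgt U \<longleftrightarrow> U \<subseteq> V \<and> U \<inter> K \<noteq> {} \<and> card (entering hs ts F U) = 1" for U
  have tgtI: "tgt U" if "U \<subseteq> V" "U \<inter> K \<noteq> {}" "\<not> 2 \<le> card (entering hs ts F U)" for U
    using that covering_card[OF F(2) finF that(1)] unfolding tgt_def by fastforce
  obtain z where z: "z \<in> K" using arc_compD(2)[OF K] by blast
  have "0 < \<kappa> (hf z)" using kappa_hf_pos arc_compD(3)[OF K] z by blast
  then obtain U1 where "U1 \<subseteq> V" "z \<in> U1" "\<not> 2 \<le> card (entering hs ts F U1)"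
    using neg[OF z, of "{}"] by auto
  then have "tgt U1" using tgtI z by blast
  moreover have "\<forall>U. tgt U \<longrightarrow> card U < Suc (card V)"
    unfolding tgt_def using finV by (simp add: card_mono less_Suc_eq_le)
  ultimately have "\<exists>U. tgt U \<and> (\<forall>W. tgt W \<longrightarrow> card W \<le> card U)" by (rule ex_has_greatest_nat)
  then obtain U0 where U0: "tgt U0" and max: "\<And>W. tgt W \<Longrightarrow> card W \<le> card U0" by blast
  show False
  proof (cases "K \<subseteq> U0")
    case True
    then have "{i, j} \<subseteq> entering hs ts F U0" using ij unfolding entering_def enters_def by auto
    then have "card {i, j} \<le> card (entering hs ts F U0)" using finF by (intro card_mono) auto
    then show False using U0 ij(3) unfolding tgt_def by simp
  next
    case False
    have "K \<inter> U0 \<noteq> {}" using U0 unfolding tgt_def by blast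
    then obtain a where a: "a \<in> X" "ts a \<noteq> {}" "hs a \<union> ts a \<subseteq> K" "(hs a \<union> ts a) \<inter> U0 \<noteq> {}" "\<not> hs a \<union> ts a \<subseteq> U0"
      using arc_comp_connected[OF K _ False] by blast
    have "is_arc V hs ts a" using X_element[OF a(1)] a(2) unfolding is_item_def by blast
    then obtain u x where ux: "u \<in> V" "x \<in> V" "ts a = {u}" "hs a = {x}" unfolding is_arc_def by blast
    have xK: "x \<in> K" using a(3) ux by blast
    \<comment> \<open>The choice \<open>D = {a}\<close> fails at x because of a set around x that
      the arc does not enter, so it contains both ends of the arc. Its union with \<open>U0\<close>
      is again entered only once, and it is larger since the arc is not inside
      \<open>U0\<close>.\<close>
    obtain U where U: "U \<subseteq> V" "x \<in> U" "\<not> enters hs ts a U" "\<not> 2 \<le> card (entering hs ts F U)"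
      using neg[OF xK, of "{a}"] a kappa_arc[OF a(1,2) ux(4,2)] by auto
    have uU: "u \<in> U" using U(2,3) ux by (simp add: enters_def)
    have tU: "card (entering hs ts F U) = 1" using tgtI[OF U(1) _ U(4)] xK U(2) unfolding tgt_def by blast
    have ne: "U \<inter> U0 \<noteq> {}" using a(4) ux U(2) uU by auto
    have "card (entering hs ts F (U \<inter> U0)) + card (entering hs ts F (U \<union> U0))
      \<le> card (entering hs ts F U) + card (entering hs ts F U0)"
      by (rule card_entering_submodular[OF finF, where V = V]) (use Y_element F(1) in blast)
    moreover have "U0 \<subseteq> V" using U0 unfolding tgt_def by blast
    moreover have "1 \<le> card (entering hs ts F (U \<inter> U0))"
      using U(1) by (intro covering_card[OF F(2) finF]) (use ne in auto)
    ultimately have "tgt (U \<union> U0)"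
      using U0 tU U(1) xK U(2) by (intro tgtI) (auto simp: tgt_def)
    then have "card (U \<union> U0) \<le> card U0" by (rule max)
    moreover have "U0 \<subset> U \<union> U0" using a(5) ux U(2) uU by auto
    moreover have "finite (U \<union> U0)" using U(1) \<open>U0 \<subseteq> V\<close> finV by (auto intro: finite_subset)
    ultimately show False using psubset_card_mono[of "U \<union> U0" U0] by simp
  qed
qed

end

section \<open>At most one end of an edge or half-edge in each component\<close>

context tagged_pair
begin

text \<open>Otherwise swapping C brings both half-edges into the same new cover. The other one costs
  at least the optimum, so this one costs at most the optimum, against
  \<open>two_halves_tagged\<close>.\<close>

lemma both_halves_in_chain:
  assumes F: "kopt F" and G: "kopt G" and t: "t \<in> V" "hf t \<in> F" and x: "x \<in> V" "hf x \<in> G"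
    and C: "link_closed C" "(hf t, 0) \<in> C"
  shows "(hf x, 1) \<in> C"
proof (rule ccontr)
  assume n: "(hf x, 1) \<notin> C"
  obtain G1 G2 where G12: "G1 \<union> G2 = F \<times> {0} \<union> G \<times> {1}" "G1 \<inter> G2 = {}"
    "covering V (hs \<circ> fst) (ts \<circ> fst) G1" "covering V (hs \<circ> fst) (ts \<circ> fst) G2"
    "{e \<in> G1. ts (fst e) = {}} = swap1 C" "{e \<in> G2. ts (fst e) = {}} = swap2 C"
    "finite G1" "finite G2" "fst ` G1 \<subseteq> Y" "fst ` G2 \<subseteq> Y"
    "\<forall>g::'i \<Rightarrow> nat. (\<Sum>e\<in>G1. g (fst e)) + (\<Sum>e\<in>G2. g (fst e)) = sum g F + sum g G"
    by (rule swap_tagged[OF C(1)])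
  have "sum \<kappa> F \<le> (\<Sum>e\<in>G1. \<kappa> (fst e))" by (rule kopt_le_tagged[OF F G12(9,7,3)])
  moreover have "sum \<kappa> G \<le> sum \<kappa> F" using kopt_le[OF G koptD(1,2)[OF F]] .
  ultimately have le: "(\<Sum>e\<in>G2. \<kappa> (fst e)) \<le> sum \<kappa> F" using G12(11)[rule_format, of \<kappa>] by linarith
  have "(hf t, 0) \<in> swap2 C" using C(2) hf_I1[OF t] unfolding swap2_def by blast
  moreover have "(hf x, 1) \<in> swap2 C" using n hf_I2[OF x] unfolding swap2_def by blast
  ultimately have g: "(hf t, 0) \<in> G2" "(hf x, 1) \<in> G2" using G12(6) by blast+
  show False by (rule two_halves_tagged[OF F G12(10,8,4) le t(1) x(1) g]) simp
qed

end

context tight_system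
begin

text \<open>
  With x and D as in \<open>attach\<close>, F together with an optimal cover G containing the half-edge at x can
  be redistributed into two covers that use D instead of that half-edge, which is cheaper.
\<close>

lemma one_item_per_comp:
  assumes F: "kopt F" and t: "t \<in> V" "hf t \<in> F" and K: "K \<in> arc_comps"
    and ij: "i \<in> F" "j \<in> F" "ts i = {}" "ts j = {}" "hs i \<inter> K \<noteq> {}" "hs j \<inter> K \<noteq> {}"
  shows "i = j"
proof (rule ccontr)
  assume neq: "i \<noteq> j"
  obtain x D where x: "x \<in> K" and D: "D \<subseteq> X" "\<forall>a\<in>D. ts a \<noteq> {}" "sum \<kappa> D < \<kappa> (hf x)"
    and twice: "\<forall>U\<subseteq>V. x \<in> U \<longrightarrow> (\<exists>a\<in>D. enters hs ts a U) \<or> 2 \<le> card (entering hs ts F U)"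
    using attach[OF koptD(1,2)[OF F] K ij(1,2) neq ij(3-6)] by (elim bexE exE conjE) rule
  have xV: "x \<in> V" using arc_compD(3)[OF K] x by blast
  obtain G where G: "kopt G" "hf x \<in> G" using kopt_half_exists[OF xV] by blast
  obtain p q where tp: "tagged_pair V hs ts X hf c F G p q"
    and q: "\<forall>J\<in>two_covers.sources V (hs \<circ> fst) (ts \<circ> fst) (F \<times> {0::nat}) (G \<times> {1::nat}).
        x \<in> J \<longrightarrow> q J = (hf x, 1)"
    by (rule tagged_pair_exists[OF koptD(1,2)[OF F] koptD(1,2)[OF G(1)] xV G(2)])
  interpret P: tagged_pair V hs ts X hf c F G p q by (rule tp)
  let ?hs = "hs \<circ> fst" and ?ts = "ts \<circ> fst"
  have t1: "(hf t, 0) \<in> P.I1" by (rule P.hf_I1[OF t])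
  have x2: "(hf x, 1) \<in> P.I2" by (rule P.hf_I2[OF xV G(2)])
  have t12: "(hf t, 0) \<in> P.I1 \<union> P.I2" using t1 by blast
  obtain C where C: "P.link_closed C" "(hf t, 0) \<in> C" "sum P.slack C \<le> 2" by (rule P.chain[OF t12])
  have CI: "C \<subseteq> P.I1 \<union> P.I2" using C(1) unfolding P.link_closed_def by blast
  have xC: "(hf x, 1) \<in> C" by (rule P.both_halves_in_chain[OF F G(1) t xV G(2) C(1,2)])
  \<comment> \<open>The tag 2 keeps the copies of D apart from those of F and G. The copy of
    \<open>hf x\<close> lies in C and would pass to the first cover; there it is left out.\<close>
  define A' where "A' = P.A \<union> D \<times> {2::nat}"
  define J1 where "J1 = P.swap1 C - {(hf x, 1)}"
  define J2 where "J2 = P.swap2 C"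
  have sw: "P.swap1 C \<union> P.swap2 C = P.I1 \<union> P.I2" "P.swap1 C \<inter> P.swap2 C = {}"
    using CI P.I12 unfolding P.swap1_def P.swap2_def by blast+
  have x_swap: "(hf x, 1) \<in> P.swap1 C" using xC x2 unfolding P.swap1_def by blast
  have H: "A' \<union> J1 \<union> J2 = (F \<times> {0::nat} \<union> G \<times> {1} - {(hf x, 1)}) \<union> D \<times> {2}"
  proof -
    have "(hf x, 1) \<notin> P.A" "(hf x, 1) \<notin> P.swap2 C" using x2 P.A_I x_swap sw(2) by blast+
    then show ?thesis unfolding A'_def J1_def J2_def P.all_split using sw(1) by auto
  qed
  have finD: "finite D" using D(1) finX by (rule finite_subset)
  have finH: "finite (A' \<union> J1 \<union> J2)" unfolding H using P.finite_F1 P.finite_F2 finD by simp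
  have arc: "is_arc V ?hs ?ts a" if "a \<in> A'" for a
  proof (cases "a \<in> P.A")
    case False
    then have "fst a \<in> X" "ts (fst a) \<noteq> {}" using that D unfolding A'_def by auto
    then have "is_arc V hs ts (fst a)" using X_element unfolding is_item_def by blast
    then show ?thesis unfolding is_arc_def by simp
  qed (rule P.arc_A)
  have item: "is_item V ?hs ?ts i" if "i \<in> J1 \<union> J2" for i
    using that sw(1) unfolding J1_def J2_def by (intro P.item_I) blast
  have two: "2 \<le> card (entering ?hs ?ts (A' \<union> J1 \<union> J2) U)" if U: "U \<subseteq> V" "U \<noteq> {}" for U
  proof (cases "x \<in> U")
    case False
    then have "\<not> enters ?hs ?ts (hf x, 1::nat) U" using xV by (simp add: enters_def hs_hf)
    then have "entering ?hs ?ts (F \<times> {0::nat} \<union> G \<times> {1}) U \<subseteq> entering ?hs ?ts (A' \<union> J1 \<union> J2) U"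
      unfolding H entering_def by blast
    then have "card (entering ?hs ?ts (F \<times> {0::nat} \<union> G \<times> {1}) U) \<le> card (entering ?hs ?ts (A' \<union> J1 \<union> J2) U)"
      using finH by (intro card_mono) simp_all
    then show ?thesis using P.card_entering_union[OF U] by linarith
  next
    case True
    \<comment> \<open>For sets containing x, the entries from F and D suffice by the choice of x and
      D. The cover G, which has lost \<open>hf x\<close>, is not counted.\<close>
    have sub: "entering hs ts F U \<times> {0::nat} \<subseteq> entering ?hs ?ts (A' \<union> J1 \<union> J2) U"
      unfolding H entering_def by (auto simp: enters_fst)
    have card0: "card (entering hs ts F U \<times> {0::nat}) = card (entering hs ts F U)"
      by (simp add: card_cartesian_product)
    show ?thesis
    proof (cases "\<exists>a\<in>D. enters hs ts a U")
      case True
      then obtain a where a: "a \<in> D" "enters hs ts a U" by blast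
      then have "insert (a, 2::nat) (entering hs ts F U \<times> {0::nat}) \<subseteq> entering ?hs ?ts (A' \<union> J1 \<union> J2) U"
        using sub unfolding H entering_def by (auto simp: enters_fst)
      then have "card (insert (a, 2::nat) (entering hs ts F U \<times> {0::nat})) \<le> card (entering ?hs ?ts (A' \<union> J1 \<union> J2) U)"
        using finH by (intro card_mono) simp_all
      moreover have "card (insert (a, 2::nat) (entering hs ts F U \<times> {0::nat})) = Suc (card (entering hs ts F U))"
        using koptD(3)[OF F] card0 by (subst card_insert_disjoint) auto
      ultimately show ?thesis using covering_card[OF koptD(2,3)[OF F] U] by linarith
    next
      case no: False
      have "card (entering hs ts F U \<times> {0::nat}) \<le> card (entering ?hs ?ts (A' \<union> J1 \<union> J2) U)"
        using sub finH by (intro card_mono) simp_all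
      moreover have "2 \<le> card (entering hs ts F U)" using twice[rule_format, OF U(1) True] no by blast
      ultimately show ?thesis using card0 by linarith
    qed
  qed
  have both: "(\<exists>i\<in>J1. enters ?hs ?ts i U) \<and> (\<exists>i\<in>J2. enters ?hs ?ts i U)"
    if U: "U \<subseteq> V" "U \<noteq> {}" "entering ?hs ?ts A' U = {}" for U
  proof -
    have un: "P.unentered U" using U unfolding P.unentered_def A'_def entering_def by blast
    have ent: "enters ?hs ?ts i U" if "i \<in> P.I1 \<union> P.I2" "enters ?hs ?ts i J" "J \<subseteq> U" for i J
      using that(2,3) unfolding P.enters_item[OF that(1)] by blast
    \<comment> \<open>A source without x is not affected by the loss of \<open>hf x\<close>. If all
      sources in U contain x, there is only one; its item from F passes to the second cover, and the
      first cover needs a substitute for \<open>hf x\<close>, namely a second item of F entering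
      U.\<close>
    show ?thesis
    proof (cases "\<exists>J\<in>P.sources. J \<subseteq> U \<and> x \<notin> J")
      case True
      then obtain J where J: "J \<in> P.sources" "J \<subseteq> U" "x \<notin> J" by blast
      have "\<not> enters ?hs ?ts (hf x, 1::nat) J" using J(3) xV by (simp add: enters_def hs_hf)
      then have ne: "p J \<noteq> (hf x, 1)" "q J \<noteq> (hf x, 1)" using P.p[OF J(1)] P.q[OF J(1)] by metis+
      have "enters ?hs ?ts (p J) U" "enters ?hs ?ts (q J) U"
        using ent[of _ J] P.p[OF J(1)] P.q[OF J(1)] J(2) by simp_all
      then show ?thesis using P.swap_both[OF C(1) J(1)] ne unfolding J1_def J2_def by blast
    next
      case False
      obtain J where J: "J \<in> P.sources" "J \<subseteq> U" by (rule P.source_exists[OF un])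
      then have xJ: "x \<in> J" using False by blast
      have qJ: "q J = (hf x, 1)" using q J(1) xJ by blast
      then have pC: "p J \<in> C" using C(1) J(1) xC unfolding P.link_closed_def by metis
      have "p J \<in> J2" using pC P.p[OF J(1)] unfolding J2_def P.swap2_def by blast
      moreover have "enters ?hs ?ts (p J) U" using ent[of _ J] P.p[OF J(1)] J(2) by simp
      moreover have "\<exists>i\<in>J1. enters ?hs ?ts i U"
      proof -
        have "\<not> (\<exists>a\<in>D. enters hs ts a U)"
        proof
          assume "\<exists>a\<in>D. enters hs ts a U"
          then obtain a where "a \<in> D" "enters hs ts a U" by blast
          then have "(a, 2) \<in> entering ?hs ?ts A' U" unfolding A'_def entering_def by (simp add: enters_fst)
          then show False using U(3) by blast
        qed
        then have "2 \<le> card (entering hs ts F U)" using twice U(1) xJ J(2) by blast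
        then obtain e where e: "e \<in> entering hs ts F U" "e \<noteq> fst (p J)" by (rule card_ge2_obtain)
        have eF: "e \<in> F" "enters hs ts e U" using e(1) unfolding entering_def by auto
        have "(e, 0) \<notin> P.A"
        proof
          assume "(e, 0) \<in> P.A"
          then have "(e, 0) \<in> entering ?hs ?ts P.A U" using eF(2) unfolding entering_def by (simp add: enters_fst)
          then show False using un unfolding P.unentered_def by blast
        qed
        then have e1: "(e, 0) \<in> P.I1" using eF(1) unfolding P.A_def P.I1_def by auto
        \<comment> \<open>Only an item off the chain stays in the first cover. On the chain, e would
          have a head in no source linked to it, and its slack would be too much beside that of
          \<open>hf t\<close> and \<open>hf x\<close>; if e is \<open>hf t\<close> itself, its slack
          is 2.\<close>
        have "(e, 0) \<notin> C"
        proof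
          assume eC: "(e, 0) \<in> C"
          obtain b where b: "b \<in> hs e" "b \<in> U" using eF(2) unfolding enters_def by blast
          have miss: "b \<notin> J'" if J': "J' \<in> P.links (e, 0)" for J'
          proof
            assume bJ: "b \<in> J'"
            have src: "J' \<in> P.sources" using P.links_hit[OF J'] by blast
            then have "J' \<subseteq> U" using P.source_subset[OF src un] b(2) bJ by blast
            then have "x \<in> J'" using False src by blast
            then have "J' = J" using P.sources_disjoint[OF src J(1)] xJ by blast
            then have "p J = (e, 0) \<or> q J = (e, 0)" using J' unfolding P.links_def by blast
            then show False using e(2) qJ by auto
          qed
          have se: "3 - int (card (hs e)) \<le> P.slack (e, 0)"
            using P.slack_missed[of "(e, 0)" b] e1 b(1) miss by auto
          have sx: "1 \<le> P.slack (hf x, 1)" by (rule P.slack_hf2[OF xV G(2)])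
          have st: "1 \<le> P.slack (hf t, 0)" by (rule P.slack_hf1[OF t])
          show False
          proof (cases "e = hf t")
            case True
            then have "2 \<le> P.slack (hf t, 0)" using se t(1) by (simp add: hs_hf)
            moreover have "sum P.slack {(hf t, 0), (hf x, 1)} \<le> sum P.slack C"
              by (rule P.slack_sum_ge[OF C(1)]) (use C(2) xC in blast)
            ultimately show False using sx C(3) by simp
          next
            case False
            have "card (hs e) \<le> 2" using P.card_item_I[of "(e, 0)"] e1 by simp
            then have "1 \<le> P.slack (e, 0)" using se by linarith
            moreover have "sum P.slack {(hf t, 0), (hf x, 1), (e, 0)} \<le> sum P.slack C"
              by (rule P.slack_sum_ge[OF C(1)]) (use C(2) xC eC in blast)
            ultimately show False using sx st C(3) False by simp
          qed
        qed
        then have "(e, 0) \<in> J1" using e1 unfolding J1_def P.swap1_def by simp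
        moreover have "enters ?hs ?ts (e, 0) U" using eF(2) by (simp add: enters_fst)
        ultimately show ?thesis by blast
      qed
      ultimately show ?thesis by blast
    qed
  qed
  have fin: "finite A'" "finite J1" "finite J2" using finH by simp_all
  obtain A1 A2 where A12: "A1 \<union> A2 = A'" "A1 \<inter> A2 = {}"
    "covering V ?hs ?ts (A1 \<union> J1)" "covering V ?hs ?ts (A2 \<union> J2)"
    by (rule two_coverings[OF finV fin arc item two both])
  have un: "(A1 \<union> J1) \<union> (A2 \<union> J2) = A' \<union> J1 \<union> J2" using A12(1) by blast
  have J12: "J1 \<inter> J2 = {}" "A' \<inter> (J1 \<union> J2) = {}"
  proof -
    show "J1 \<inter> J2 = {}" using sw(2) unfolding J1_def J2_def by blast
    have "J1 \<union> J2 \<subseteq> P.I1 \<union> P.I2" using sw(1) unfolding J1_def J2_def by blast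
    moreover have "snd e < 2" if "e \<in> P.I1 \<union> P.I2" for e using that unfolding P.I1_def P.I2_def by auto
    ultimately have "D \<times> {2} \<inter> (J1 \<union> J2) = {}" by fastforce
    then show "A' \<inter> (J1 \<union> J2) = {}" using P.A_I \<open>J1 \<union> J2 \<subseteq> P.I1 \<union> P.I2\<close> unfolding A'_def by blast
  qed
  have dis: "(A1 \<union> J1) \<inter> (A2 \<union> J2) = {}" using A12(1,2) J12 by blast
  have fin12: "finite (A1 \<union> J1)" "finite (A2 \<union> J2)" using finH unfolding un[symmetric] by simp_all
  have HY: "fst ` (A' \<union> J1 \<union> J2) \<subseteq> Y"
    unfolding H using koptD(1)[OF F] koptD(1)[OF G(1)] D(1) unfolding Y_def by auto
  have Y12: "fst ` (A1 \<union> J1) \<subseteq> Y" "fst ` (A2 \<union> J2) \<subseteq> Y" using HY unfolding un[symmetric] by blast+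
  have k1: "sum \<kappa> F \<le> (\<Sum>e\<in>A1 \<union> J1. \<kappa> (fst e))" by (rule kopt_le_tagged[OF F Y12(1) fin12(1) A12(3)])
  have k2: "sum \<kappa> G \<le> (\<Sum>e\<in>A2 \<union> J2. \<kappa> (fst e))" by (rule kopt_le_tagged[OF G(1) Y12(2) fin12(2) A12(4)])
  have "(\<Sum>e\<in>A1 \<union> J1. \<kappa> (fst e)) + (\<Sum>e\<in>A2 \<union> J2. \<kappa> (fst e)) = (\<Sum>e\<in>A' \<union> J1 \<union> J2. \<kappa> (fst e))"
    unfolding un[symmetric] by (rule sum.union_disjoint[OF fin12 dis, symmetric])
  also have "\<dots> = (\<Sum>e\<in>F \<times> {0::nat} \<union> G \<times> {1} - {(hf x, 1)}. \<kappa> (fst e)) + (\<Sum>e\<in>D \<times> {2::nat}. \<kappa> (fst e))"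
    unfolding H using P.finite_F1 P.finite_F2 finD by (intro sum.union_disjoint) auto
  also have "(\<Sum>e\<in>D \<times> {2::nat}. \<kappa> (fst e)) = sum \<kappa> D" by (simp only: sum_tag)
  finally have "sum \<kappa> F + sum \<kappa> G \<le> (\<Sum>e\<in>F \<times> {0::nat} \<union> G \<times> {1} - {(hf x, 1)}. \<kappa> (fst e)) + sum \<kappa> D"
    using k1 k2 by linarith
  moreover have "(\<Sum>e\<in>F \<times> {0::nat} \<union> G \<times> {1::nat}. \<kappa> (fst e))
      = \<kappa> (fst (hf x, 1::nat)) + (\<Sum>e\<in>F \<times> {0::nat} \<union> G \<times> {1} - {(hf x, 1)}. \<kappa> (fst e))"
    by (rule sum.remove) (use P.finite_F1 P.finite_F2 G(2) in auto)
  moreover have "(\<Sum>e\<in>F \<times> {0::nat} \<union> G \<times> {1::nat}. \<kappa> (fst e)) = sum \<kappa> F + sum \<kappa> G"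
    using sum.union_disjoint[OF P.finite_F1 P.finite_F2 P.disjoint_F, of "\<lambda>e. \<kappa> (fst e)"]
    by (simp only: sum_tag)
  ultimately show False using D(3) by simp
qed

text \<open>Let G be an optimal cover with the half-edge at \<open>b\<close>. By
  \<open>one_item_per_comp\<close>, e is the only item of F touching K and \<open>hf b\<close> the
  only one of G, so a source inside K can link only these two. The slack bound forces a second link
  at the copy of e, through \<open>b'\<close>; its source would have to contain \<open>b\<close> as
  well, although sources are disjoint.\<close>

lemma no_edge_inside:
  assumes F: "kopt F" and t: "t \<in> V" "hf t \<in> F" and K: "K \<in> arc_comps"
    and e: "e \<in> F" "ts e = {}" "hs e = {b, b'}" "b \<noteq> b'" "b \<in> K" "b' \<in> K"
  shows False
proof -
  have bV: "b \<in> V" using arc_compD(3)[OF K] e by blast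
  obtain G where G: "kopt G" "hf b \<in> G" using kopt_half_exists[OF bV] by blast
  obtain p q where tp: "tagged_pair V hs ts X hf c F G p q"
    by (rule tagged_pair_exists[OF koptD(1,2)[OF F] koptD(1,2)[OF G(1)] bV G(2)])
  interpret P: tagged_pair V hs ts X hf c F G p q by (rule tp)
  let ?hs = "hs \<circ> fst" and ?ts = "ts \<circ> fst"
  have t12: "(hf t, 0) \<in> P.I1 \<union> P.I2" using P.hf_I1[OF t] by blast
  obtain C where C: "P.link_closed C" "(hf t, 0) \<in> C" "sum P.slack C \<le> 2" by (rule P.chain[OF t12])
  have CI: "C \<subseteq> P.I1 \<union> P.I2" using C(1) unfolding P.link_closed_def by blast
  have bC: "(hf b, 1) \<in> C" by (rule P.both_halves_in_chain[OF F G(1) t bV G(2) C(1,2)])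
  have e_ne: "e \<noteq> hf t" using e(3,4) hs_hf[OF t(1)] by auto
  have st: "1 \<le> P.slack (hf t, 0)" by (rule P.slack_hf1[OF t])
  have sb: "1 \<le> P.slack (hf b, 1)" by (rule P.slack_hf2[OF bV G(2)])
  \<comment> \<open>No arc enters K, so a source meeting K lies inside it.\<close>
  have in_K: "J \<subseteq> K" if J: "J \<in> P.sources" "J \<inter> K \<noteq> {}" for J
  proof (rule P.source_subset[OF J(1) _ J(2)])
    have "\<not> enters ?hs ?ts a K" if a: "a \<in> P.A" for a
    proof -
      have "fst a \<in> Y" "ts (fst a) \<noteq> {}" using a P.FY P.GY unfolding P.A_def by auto
      then have "fst a \<in> X" using ts_hf unfolding Y_def by auto
      then have "hs (fst a) \<union> ts (fst a) \<subseteq> K \<or> (hs (fst a) \<union> ts (fst a)) \<inter> K = {}"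
        using arc_compD(1)[OF K] \<open>ts (fst a) \<noteq> {}\<close> unfolding uncrossed_def by blast
      then show ?thesis using \<open>ts (fst a) \<noteq> {}\<close> unfolding enters_def by auto
    qed
    then show "P.unentered K"
      using arc_compD(2,3)[OF K] unfolding P.unentered_def entering_def by blast
  qed
  have "P.links (hf b, 1) \<noteq> {}"
  proof
    assume "P.links (hf b, 1) = {}"
    then have "P.slack (hf b, 1) = 2" unfolding P.slack_def by simp
    moreover have "sum P.slack {(hf t, 0), (hf b, 1)} \<le> sum P.slack C"
      by (rule P.slack_sum_ge[OF C(1)]) (use C(2) bC in blast)
    ultimately show False using st C(3) by simp
  qed
  then obtain J where J: "J \<in> P.links (hf b, 1)" by blast
  have Js: "J \<in> P.sources" and bJ: "b \<in> J" using P.links_hit[OF J] by (auto simp: hs_hf bV)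
  have JK: "J \<subseteq> K" using in_K[OF Js] bJ e(5) by blast
  have qJ: "q J = (hf b, 1)"
  proof -
    have "p J \<in> P.I1" using P.p[OF Js] by simp
    then have "p J \<noteq> (hf b, 1)" unfolding P.I1_def by auto
    then show ?thesis using J unfolding P.links_def by simp
  qed
  have pe: "p J = (e, 0)"
  proof -
    have "p J \<in> P.I1" "enters ?hs ?ts (p J) J" using P.p[OF Js] by auto
    then have "snd (p J) = 0" "fst (p J) \<in> F" "ts (fst (p J)) = {}" "hs (fst (p J)) \<inter> K \<noteq> {}"
      using JK unfolding P.I1_def enters_def by auto
    then have "fst (p J) = e"
      using one_item_per_comp[OF F t K, of "fst (p J)" e] e by auto
    then show ?thesis using \<open>snd (p J) = 0\<close> by (metis prod.collapse)
  qed
  have eC: "(e, 0) \<in> C" using C(1) Js pe qJ bC unfolding P.link_closed_def by metis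
  have e1: "(e, 0) \<in> P.I1" using P.p[OF Js] pe by metis
  have b'J: "b' \<in> J'" if "J' \<in> P.links (e, 0)" "J' \<noteq> J" for J'
  proof -
    have "b \<notin> J'" using P.sources_disjoint[of J' J] P.links_hit[OF that(1)] Js bJ that(2) by blast
    then show ?thesis using P.links_hit[OF that(1)] e(3) by auto
  qed
  have "\<exists>J'. J' \<in> P.links (e, 0) \<and> J' \<noteq> J"
  proof (rule ccontr)
    assume "\<not> ?thesis"
    then have "P.links (e, 0) \<subseteq> {J}" by blast
    then have "card (P.links (e, 0)) \<le> card {J}" by (intro card_mono) auto
    then have "1 \<le> P.slack (e, 0)" unfolding P.slack_def by simp
    moreover have "sum P.slack {(hf t, 0), (hf b, 1), (e, 0)} \<le> sum P.slack C"
      by (rule P.slack_sum_ge[OF C(1)]) (use C(2) bC eC in blast)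
    ultimately show False using st sb C(3) e_ne by simp
  qed
  then obtain J' where J': "J' \<in> P.links (e, 0)" "J' \<noteq> J" by blast
  have J's: "J' \<in> P.sources" using P.links_hit[OF J'(1)] by blast
  have J'K: "J' \<subseteq> K" using in_K[OF J's] b'J[OF J'] e(6) by blast
  have "q J' \<in> P.I2" "enters ?hs ?ts (q J') J'" using P.q[OF J's] by auto
  then have "fst (q J') \<in> G" "ts (fst (q J')) = {}" "hs (fst (q J')) \<inter> K \<noteq> {}" "hs (fst (q J')) \<inter> J' \<noteq> {}"
    using J'K unfolding P.I2_def enters_def by auto
  moreover have "hs (hf b) \<inter> K \<noteq> {}" using hs_hf[OF bV] e(5) by auto
  ultimately have "fst (q J') = hf b" "hs (fst (q J')) \<inter> J' \<noteq> {}"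
    using one_item_per_comp[OF G(1) bV G(2) K, of "fst (q J')" "hf b"] G(2) ts_hf[OF bV] by auto
  then have "b \<in> J'" using hs_hf[OF bV] by auto
  then show False using P.sources_disjoint[OF J's Js] bJ J'(2) by blast
qed

text \<open>By \<open>one_half\<close> all items except \<open>hf t\<close> are edges, so there are
  \<open>2 * card I - 1\<close> pairs of an item and one of its ends. Different pairs lie in
  different components, by \<open>one_item_per_comp\<close> for different items and by
  \<open>no_edge_inside\<close> for the two ends of one edge.\<close>

lemma kopt_few_items:
  assumes F: "kopt F" and t: "t \<in> V" "hf t \<in> F"
  shows "2 * card {e \<in> F. ts e = {}} \<le> card arc_comps + 1"
proof -
  define I where "I = {e \<in> F. ts e = {}}"
  have finI: "finite I" and tI: "hf t \<in> I" using koptD(3)[OF F] t ts_hf unfolding I_def by auto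
  have edge: "card (hs e) = 2 \<and> hs e \<subseteq> V" if eI: "e \<in> I - {hf t}" for e
  proof (cases "e \<in> X")
    case True
    then show ?thesis using X_element[OF True] eI unfolding I_def is_arc_def is_item_def by auto
  next
    case False
    then obtain v where "v \<in> V" "e = hf v" using eI koptD(1)[OF F] unfolding I_def Y_def by blast
    then show ?thesis using one_half[OF F _ _ t, of v] eI unfolding I_def by auto
  qed
  have hsV: "hs e \<subseteq> V" if "e \<in> I" for e
    using edge[of e] that hs_hf[OF t(1)] t(1) by (cases "e = hf t") auto
  have "card (Sigma I hs) = (\<Sum>e\<in>I. card (hs e))"
    using finI hsV finV by (intro card_SigmaI) (auto intro: finite_subset)
  also have "\<dots> = card (hs (hf t)) + (\<Sum>e\<in>I - {hf t}. card (hs e))" by (rule sum.remove[OF finI tI])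
  also have "(\<Sum>e\<in>I - {hf t}. card (hs e)) = (\<Sum>e\<in>I - {hf t}. 2)"
    using edge by (intro sum.cong) auto
  also have "card (hs (hf t)) = 1" using hs_hf[OF t(1)] by simp
  also have "1 + (\<Sum>e\<in>I - {hf t}. 2) = 2 * card (I - {hf t}) + 1" by simp
  also have "card (I - {hf t}) = card I - 1" using tI by simp
  finally have "2 * card I = card (Sigma I hs) + 1"
    using tI finI by (cases "card I") auto
  moreover have "card (Sigma I hs) \<le> card arc_comps"
  proof -
    have "\<forall>v\<in>V. \<exists>K. K \<in> arc_comps \<and> v \<in> K" using arc_comp_of by metis
    then obtain cl where cl: "\<forall>v\<in>V. cl v \<in> arc_comps \<and> v \<in> cl v" by (rule bchoice[THEN exE])
    show ?thesis
    proof (rule card_inj_on_le[of "\<lambda>(e, v). cl v"])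
      show "(\<lambda>(e, v). cl v) ` Sigma I hs \<subseteq> arc_comps" using cl hsV by auto
      show "finite arc_comps" by (rule finite_arc_comps)
      show "inj_on (\<lambda>(e, v). cl v) (Sigma I hs)"
      proof (rule inj_onI)
        fix y y' assume y: "y \<in> Sigma I hs" "y' \<in> Sigma I hs" "(\<lambda>(e, v). cl v) y = (\<lambda>(e, v). cl v) y'"
        obtain e v e' v' where ev: "y = (e, v)" "y' = (e', v')" by (cases y, cases y') auto
        have e: "e \<in> I" "e' \<in> I" "v \<in> hs e" "v' \<in> hs e'" "cl v = cl v'" using y ev by auto
        have V: "v \<in> V" "v' \<in> V" using e hsV by auto
        have K: "cl v \<in> arc_comps" "v \<in> cl v" "v' \<in> cl v" using cl V e(5) by auto
        have "e = e'"
          using one_item_per_comp[OF F t K(1), of e e'] e K unfolding I_def by blast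
        moreover have "v = v'"
        proof (rule ccontr)
          assume ne: "v \<noteq> v'"
          then have "e \<noteq> hf t" using e \<open>e = e'\<close> hs_hf[OF t(1)] by auto
          then have c2: "card (hs e) = 2" "hs e \<subseteq> V" using edge e(1) by auto
          then have "finite (hs e)" using finV finite_subset by blast
          then have "{v, v'} = hs e" using e \<open>e = e'\<close> ne c2(1) by (intro card_subset_eq) auto
          then show False
            using no_edge_inside[OF F t K(1), of e v v'] e(1) ne K unfolding I_def by auto
        qed
        ultimately show "y = y'" using ev by simp
      qed
    qed
  qed
  ultimately show ?thesis unfolding I_def by simp
qed

text \<open>For a cover optimal under \<open>\<kappa>\<close> that contains a half-edge, the costs c
  and \<open>c - \<rho>\<close> differ by its number of tailless elements, which
  \<open>kopt_few_items\<close> bounds. The lexicographic weight in \<open>\<kappa>\<close> makes it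
  optimal for \<open>c - \<rho>\<close>.\<close>

lemma min_cost_drop:
  assumes F0: "copt F0" and G: "G \<subseteq> Y" "covering V hs ts G"
  shows "sum c F0 \<le> (\<Sum>e\<in>G. c e - \<rho> e) + (card arc_comps + 1) div 2"
proof -
  obtain t where t: "t \<in> V" using V_ne by blast
  obtain F where F: "kopt F" "hf t \<in> F" using kopt_half_exists[OF t] by blast
  have kap: "sum \<kappa> H = (card Y + 1) * (\<Sum>e\<in>H. c e - \<rho> e) + sum \<rho> H" for H
    unfolding \<kappa>_def by (simp only: sum.distrib sum_distrib_left)
  have rho: "sum \<rho> H \<le> card Y" if "H \<subseteq> Y" for H
  proof -
    have "sum \<rho> H \<le> (\<Sum>e\<in>H. 1)" by (rule sum_mono) (simp add: \<rho>_def of_bool_def)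
    also have "\<dots> = card H" by simp
    also have "\<dots> \<le> card Y" using that finY by (rule card_mono[rotated])
    finally show ?thesis .
  qed
  have le: "(\<Sum>e\<in>F. c e - \<rho> e) \<le> (\<Sum>e\<in>G. c e - \<rho> e)"
  proof (rule ccontr)
    assume "\<not> ?thesis"
    then have "Suc (\<Sum>e\<in>G. c e - \<rho> e) \<le> (\<Sum>e\<in>F. c e - \<rho> e)" by simp
    then have "(card Y + 1) * Suc (\<Sum>e\<in>G. c e - \<rho> e) \<le> (card Y + 1) * (\<Sum>e\<in>F. c e - \<rho> e)"
      by (rule mult_le_mono2)
    also have "\<dots> \<le> sum \<kappa> F" unfolding kap by simp
    also have "\<dots> \<le> sum \<kappa> G" by (rule kopt_le[OF F(1) G])
    finally show False using rho[OF G(1)] unfolding kap by simp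
  qed
  have "sum c F0 \<le> sum c F" using F0 koptD(1,2)[OF F(1)] unfolding copt_def by blast
  also have "\<dots> = (\<Sum>e\<in>F. (c e - \<rho> e) + \<rho> e)"
  proof (rule sum.cong[OF refl])
    fix e assume "e \<in> F"
    then have "e \<in> X \<union> hf ` V" using koptD(1)[OF F(1)] unfolding Y_def by blast
    then show "c e = (c e - \<rho> e) + \<rho> e" using positive[of e] unfolding \<rho>_def by (auto simp: of_bool_def)
  qed
  also have "\<dots> = (\<Sum>e\<in>F. c e - \<rho> e) + card {e \<in> F. ts e = {}}"
    unfolding sum.distrib using sum_tailless[OF koptD(3)[OF F(1)], of ts] by (simp add: \<rho>_def)
  also have "\<dots> \<le> (\<Sum>e\<in>G. c e - \<rho> e) + (card arc_comps + 1) div 2"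
    using le kopt_few_items[OF F(1) t F(2)] by linarith
  finally show ?thesis .
qed

end

section \<open>Minimum covers and packings of subpartitions\<close>

text \<open>The coefficient of e in the constraint of S is 1 or 0 according to whether e enters a
  member of S (see \<open>row_cover\<close>), so this is the sum of the rows chosen by Z.\<close>

definition load :: "('j \<Rightarrow> 'v set) \<Rightarrow> ('j \<Rightarrow> 'v set) \<Rightarrow> 'v set set multiset \<Rightarrow> 'j \<Rightarrow> nat" where
  "load hs ts Z e = (\<Sum>S\<in>#Z. of_bool (\<exists>U\<in>S. enters hs ts e U))"

definition packing_value :: "'v set set multiset \<Rightarrow> nat" where
  "packing_value Z = (\<Sum>S\<in>#Z. (card S + 1) div 2)"

text \<open>An element enters a set at one of its heads, where the half-edge enters too. Hence an
  element costing at least as much as the half-edges at its heads can be discarded: a packing that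
  respects those half-edges respects the element.\<close>

lemma load_halves:
  assumes "finite (hs e)" "\<And>v. v \<in> hs e \<Longrightarrow> hs (hf v) = {v} \<and> ts (hf v) = {}"
  shows "load hs ts Z e \<le> (\<Sum>v\<in>hs e. load hs ts Z (hf v))"
proof (induction Z)
  case (add S Z)
  have "of_bool (\<exists>U\<in>S. enters hs ts e U) \<le> (\<Sum>v\<in>hs e. of_bool (\<exists>U\<in>S. enters hs ts (hf v) U) :: nat)"
  proof (cases "\<exists>U\<in>S. enters hs ts e U")
    case True
    then obtain U v where U: "U \<in> S" "v \<in> hs e" "v \<in> U" unfolding enters_def by blast
    then have "enters hs ts (hf v) U" using assms(2) unfolding enters_def by simp
    then have "of_bool (\<exists>U\<in>S. enters hs ts (hf v) U) = (1::nat)" using U(1) by auto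
    then show ?thesis
      using member_le_sum[OF U(2), of "\<lambda>v. of_bool (\<exists>U\<in>S. enters hs ts (hf v) U) :: nat"] assms(1) True
      by simp
  qed simp
  then show ?case using add.IH unfolding load_def by (simp add: sum.distrib)
qed (simp add: load_def)

lemma load_zero:
  assumes "\<And>S. S \<in># Z \<Longrightarrow> \<Union>S \<inter> hs e = {}"
  shows "load hs ts Z e = 0"
  using assms
proof (induction Z)
  case (add S Z)
  have "\<not> (\<exists>U\<in>S. enters hs ts e U)" using add.prems[of S] unfolding enters_def by auto
  then show ?case using add.IH add.prems unfolding load_def by simp
qed (simp add: load_def)

lemma load_add: "load hs ts (Z1 + Z2) e = load hs ts Z1 e + load hs ts Z2 e"
  unfolding load_def by simp

lemma packing_value_add: "packing_value (Z1 + Z2) = packing_value Z1 + packing_value Z2"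
  unfolding packing_value_def by simp

text \<open>With at most two heads per element, \<open>packing_value_le\<close> gives the reverse
  inequality for every such pair, so F and Z certify each other's optimality.\<close>

definition cover_packing where
  "cover_packing V hs ts Y c \<longleftrightarrow> (\<exists>F Z. F \<subseteq> Y \<and> covering V hs ts F \<and> (\<forall>S\<in>#Z. subpartition V S) \<and>
    (\<forall>e\<in>Y. load hs ts Z e \<le> (c e :: nat)) \<and> sum c F \<le> packing_value Z)"

lemma cover_packingE:
  assumes "cover_packing V hs ts Y c"
  obtains F Z where "F \<subseteq> Y" "covering V hs ts F" "\<forall>S\<in>#Z. subpartition V S"
    "\<forall>e\<in>Y. load hs ts Z e \<le> c e" "sum c F \<le> packing_value Z"
  using assms unfolding cover_packing_def by (elim exE conjE)

lemma cover_packingI: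
  assumes "F \<subseteq> Y" "covering V hs ts F" "\<And>S. S \<in># Z \<Longrightarrow> subpartition V S"
    "\<And>e. e \<in> Y \<Longrightarrow> load hs ts Z e \<le> c e" "sum c F \<le> packing_value Z"
  shows "cover_packing V hs ts Y c"
  unfolding cover_packing_def using assms by (intro exI[of _ F] exI[of _ Z]) simp

lemma covering_replace:
  assumes F: "covering V hs ts F"
    and R: "\<And>U. U \<subseteq> V \<Longrightarrow> enters hs ts h U \<Longrightarrow> \<exists>e\<in>R. enters hs ts e U"
  shows "covering V hs ts ((F - {h}) \<union> R)"
  unfolding covering_def
proof (intro allI impI)
  fix U assume U: "U \<subseteq> V" "U \<noteq> {}"
  obtain e where e: "e \<in> F" "enters hs ts e U" using coveringD[OF F U] by blast
  show "\<exists>e\<in>F - {h} \<union> R. enters hs ts e U"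
  proof (cases "e = h")
    case True
    then show ?thesis using R[OF U(1)] e by blast
  qed (use e in blast)
qed

lemma covering_Un_disjoint:
  assumes F: "covering V1 hs ts F" and G: "covering V2 hs ts G"
    and in1: "\<And>e. e \<in> F \<Longrightarrow> hs e \<union> ts e \<subseteq> V1" and in2: "\<And>e. e \<in> G \<Longrightarrow> hs e \<union> ts e \<subseteq> V2"
  shows "covering (V1 \<union> V2) hs ts (F \<union> G)"
  unfolding covering_def
proof (intro allI impI)
  fix U assume U: "U \<subseteq> V1 \<union> V2" "U \<noteq> {}"
  have 1: "enters hs ts e U" if "e \<in> F" "enters hs ts e (U \<inter> V1)" for e
    using that in1[OF that(1)] unfolding enters_def by blast
  have 2: "enters hs ts e U" if "e \<in> G" "enters hs ts e (U \<inter> V2)" for e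
    using that in2[OF that(1)] unfolding enters_def by blast
  show "\<exists>e\<in>F \<union> G. enters hs ts e U"
  proof (cases "U \<inter> V1 = {}")
    case False
    then show ?thesis using coveringD[OF F, of "U \<inter> V1"] 1 by blast
  next
    case True
    then have "U \<inter> V2 \<noteq> {}" using U by blast
    then show ?thesis using coveringD[OF G, of "U \<inter> V2"] 2 by blast
  qed
qed

text \<open>In the measure, the 1 added for each element of X pays for discarding an element of cost
  0, \<open>card V\<close> for splitting a disconnected graph, and the costs of the half-edges for
  lowering one of them and for subtracting a row.\<close>

lemma cover_packing_exists:
  assumes "finite V" "finite X"
    and "\<And>e. e \<in> X \<Longrightarrow> (is_item V hs ts e \<and> card (hs e) = 2) \<or> is_arc V hs ts e"
    and "\<And>v. v \<in> V \<Longrightarrow> hs (hf v) = {v} \<and> ts (hf v) = {}"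
  shows "cover_packing V hs ts (X \<union> hf ` V) c"
  using assms
proof (induction "card V + (\<Sum>e\<in>X. c e + 1) + (\<Sum>v\<in>V. c (hf v))" arbitrary: V X c rule: less_induct)
  case less
  note IH = less.hyps and finV = less.prems(1) and finX = less.prems(2)
    and X_el = less.prems(3) and hf = less.prems(4)
  define Y where "Y = X \<union> hf ` V"
  define opt where "opt F \<longleftrightarrow> F \<subseteq> Y \<and> covering V hs ts F \<and>
    (\<forall>G\<subseteq>Y. covering V hs ts G \<longrightarrow> sum c F \<le> sum c G)" for F
  have finY: "finite Y" unfolding Y_def using finV finX by simp
  have cov_hf: "covering V hs ts (hf ` V)" unfolding covering_def enters_def using hf by fastforce
  have hf_eq: "hf u = hf v \<longleftrightarrow> u = v" if "u \<in> V" "v \<in> V" for u v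
    using hf[OF that(1)] hf[OF that(2)] by (metis singleton_inject)
  have hf_X: "hf v \<notin> X" if "v \<in> V" for v
    using X_el[of "hf v"] hf[OF that] unfolding is_arc_def by auto
  have fin_hs: "finite (hs e) \<and> hs e \<subseteq> V \<and> ts e \<subseteq> V" if "e \<in> X" for e
    using X_el[OF that] unfolding is_item_def is_arc_def by auto
  have "\<exists>F. (F \<subseteq> Y \<and> covering V hs ts F) \<and> (\<forall>G. (G \<subseteq> Y \<and> covering V hs ts G) \<longrightarrow> sum c F \<le> sum c G)"
    by (rule ex_has_least_nat[of _ "hf ` V"]) (use cov_hf Y_def in blast)
  then obtain F0 where F0: "opt F0" unfolding opt_def by blast
  have F0D: "F0 \<subseteq> Y" "covering V hs ts F0" using F0 unfolding opt_def by auto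
  show ?case
  proof (cases "\<exists>e\<in>X. (\<Sum>v\<in>hs e. c (hf v)) \<le> c e")
    case True
    then obtain e where e: "e \<in> X" "(\<Sum>v\<in>hs e. c (hf v)) \<le> c e" by blast
    have "(\<Sum>e\<in>X. c e + 1) = c e + 1 + (\<Sum>e\<in>X - {e}. c e + 1)" by (rule sum.remove[OF finX e(1)])
    then have "cover_packing V hs ts ((X - {e}) \<union> hf ` V) c"
      using finV finX X_el hf by (intro IH) auto
    then obtain F Z where FZ': "F \<subseteq> (X - {e}) \<union> hf ` V" "covering V hs ts F"
      "\<forall>S\<in>#Z. subpartition V S"
      "\<forall>e'\<in>(X - {e}) \<union> hf ` V. load hs ts Z e' \<le> c e'" "sum c F \<le> packing_value Z"
      by (rule cover_packingE)
    note FZ = FZ'[rule_format]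
    have "load hs ts Z e \<le> (\<Sum>v\<in>hs e. load hs ts Z (hf v))"
      using fin_hs[OF e(1)] hf by (intro load_halves) auto
    also have "\<dots> \<le> (\<Sum>v\<in>hs e. c (hf v))" using FZ(4) fin_hs[OF e(1)] by (intro sum_mono) auto
    finally have "load hs ts Z e \<le> c e" using e(2) by simp
    then have ld: "load hs ts Z e' \<le> c e'" if "e' \<in> X \<union> hf ` V" for e'
      using FZ(4)[of e'] that by (cases "e' = e") auto
    show ?thesis by (rule cover_packingI[OF _ FZ(2,3) ld FZ(5)]) (use FZ(1) in auto)
  next
    case False
    then have useful: "c e < (\<Sum>v\<in>hs e. c (hf v))" if "e \<in> X" for e using that by force
    show ?thesis
    proof (cases "\<exists>v\<in>V. 1 \<le> c (hf v) \<and> \<not> (\<exists>F. opt F \<and> hf v \<in> F)")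
      case True
      then obtain v where v: "v \<in> V" "1 \<le> c (hf v)" and no: "\<And>F. opt F \<Longrightarrow> hf v \<notin> F" by blast
      define c' where "c' = c(hf v := c (hf v) - 1)"
      have c': "c' e \<le> c e" "e \<noteq> hf v \<Longrightarrow> c' e = c e" for e unfolding c'_def by auto
      have "(\<Sum>u\<in>V. c' (hf u)) < (\<Sum>u\<in>V. c (hf u))"
        by (rule sum_strict_mono_ex1[OF finV]) (use c' v in \<open>auto simp: c'_def\<close>)
      moreover have "(\<Sum>e\<in>X. c' e + 1) \<le> (\<Sum>e\<in>X. c e + 1)" using c'(1) by (intro sum_mono) simp
      ultimately have "cover_packing V hs ts (X \<union> hf ` V) c'"
        using finV finX X_el hf by (intro IH) auto
      then obtain F Z where FZ': "F \<subseteq> X \<union> hf ` V" "covering V hs ts F"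
        "\<forall>S\<in>#Z. subpartition V S"
        "\<forall>e'\<in>X \<union> hf ` V. load hs ts Z e' \<le> c' e'" "sum c' F \<le> packing_value Z"
        by (rule cover_packingE)
      note FZ = FZ'[rule_format]
      \<comment> \<open>A cover with \<open>hf v\<close> is not optimal for c, so by integrality it
        exceeds the optimum by at least 1 and still does not undercut it after the
        reduction.\<close>
      have "sum c F0 \<le> sum c' F"
      proof (cases "hf v \<in> F")
        case False
        then have "sum c' F = sum c F" unfolding c'_def by (intro sum.cong) auto
        then show ?thesis using F0 FZ(1,2) unfolding opt_def Y_def by simp
      next
        case True
        then have "\<not> opt F" using no by blast
        then obtain G where G: "G \<subseteq> Y" "covering V hs ts G" "sum c G < sum c F"
          using FZ(1,2) unfolding opt_def Y_def by (auto simp: not_le)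
        have "sum c F0 \<le> sum c G" using F0 G(1,2) unfolding opt_def by blast
        have fF: "finite F" using FZ(1) finX finV by (auto intro: finite_subset)
        have "sum c F = c (hf v) + sum c (F - {hf v})" by (rule sum.remove[OF fF True])
        moreover have "sum c' F = c' (hf v) + sum c' (F - {hf v})" by (rule sum.remove[OF fF True])
        moreover have "sum c' (F - {hf v}) = sum c (F - {hf v})" unfolding c'_def by (intro sum.cong) auto
        moreover have "c' (hf v) = c (hf v) - 1" unfolding c'_def by simp
        ultimately show ?thesis using G(3) \<open>sum c F0 \<le> sum c G\<close> v(2) by linarith
      qed
      then have "sum c F0 \<le> packing_value Z" using FZ(5) by linarith
      moreover have "load hs ts Z e' \<le> c e'" if "e' \<in> X \<union> hf ` V" for e'
        using FZ(4)[OF that] c'(1)[of e'] by linarith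
      ultimately show ?thesis using F0D FZ(3) unfolding Y_def by (intro cover_packingI[of F0 _ V hs ts Z])
    next
      case False
      have tight: "\<exists>F. opt F \<and> hf t \<in> F" if t: "t \<in> V" for t
      proof (cases "1 \<le> c (hf t)")
        case True
        then show ?thesis using False t by blast
      next
        case z: False
        \<comment> \<open>A half-edge of cost 0 can be added to an optimal cover.\<close>
        have "finite F0" using F0D(1) finY by (rule finite_subset)
        then have "sum c (insert (hf t) F0) \<le> sum c F0" using z by (simp add: sum.insert_if)
        then have "\<forall>G\<subseteq>Y. covering V hs ts G \<longrightarrow> sum c (insert (hf t) F0) \<le> sum c G"
          using F0 unfolding opt_def by (meson order_trans)
        moreover have "insert (hf t) F0 \<subseteq> Y" using F0D(1) t unfolding Y_def by blast
        moreover have "covering V hs ts (insert (hf t) F0)" by (rule covering_mono[OF F0D(2)]) blast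
        ultimately have "opt (insert (hf t) F0)" unfolding opt_def by blast
        then show ?thesis by blast
      qed
      \<comment> \<open>As \<open>hf v\<close> lies in an optimal cover, whatever can stand in for
        it is at least as expensive. This yields a triangle inequality along arcs and an analogue
        for edges.\<close>
      have replace: "c (hf v) \<le> sum c R" if v: "v \<in> V" and R: "R \<subseteq> Y"
        "\<And>U. U \<subseteq> V \<Longrightarrow> enters hs ts (hf v) U \<Longrightarrow> \<exists>e\<in>R. enters hs ts e U" for v R
      proof -
        obtain F where F: "opt F" "hf v \<in> F" using tight[OF v] by blast
        have FY: "F \<subseteq> Y" "covering V hs ts F" using F unfolding opt_def by auto
        have fin: "finite F" "finite R" using FY(1) R(1) finY by (auto intro: finite_subset)
        have "covering V hs ts (F - {hf v} \<union> R)" by (rule covering_replace[OF FY(2) R(2)])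
        moreover have "F - {hf v} \<union> R \<subseteq> Y" using FY(1) R(1) by blast
        ultimately have "sum c F \<le> sum c (F - {hf v} \<union> R)" using F(1) unfolding opt_def by simp
        also have "\<dots> \<le> sum c (F - {hf v}) + sum c R" using fin by (simp add: sum_Un_nat)
        finally show ?thesis using sum.remove[OF fin(1) F(2), of c] by linarith
      qed
      have rep_edge: "c (hf v) \<le> c e" if e: "e \<in> X" "ts e = {}" "v \<in> hs e" for e v
      proof -
        have v: "v \<in> V" using fin_hs[OF e(1)] e(3) by blast
        have "c (hf v) \<le> sum c {e}"
        proof (rule replace[OF v])
          show "{e} \<subseteq> Y" using e unfolding Y_def by blast
          show "\<exists>e\<in>{e}. enters hs ts e U" if "enters hs ts (hf v) U" for U
            using that e hf[OF v] unfolding enters_def by auto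
        qed
        then show ?thesis by simp
      qed
      have rep_arc: "c (hf v) \<le> c (hf u) + c e" if e: "e \<in> X" "ts e = {u}" "hs e = {v}" for e u v
      proof -
        have v: "v \<in> V" "u \<in> V" using fin_hs[OF e(1)] e by auto
        have "c (hf v) \<le> sum c {hf u, e}"
        proof (rule replace[OF v(1)])
          show "{hf u, e} \<subseteq> Y" using e v unfolding Y_def by blast
          show "\<exists>e\<in>{hf u, e}. enters hs ts e U" if "enters hs ts (hf v) U" for U
            using that e hf[OF v(1)] hf[OF v(2)] unfolding enters_def by auto
        qed
        also have "\<dots> \<le> c (hf u) + c e" by (simp add: sum.insert_if)
        finally show ?thesis .
      qed
      show ?thesis
      proof (cases "\<exists>Q\<subseteq>V. Q \<noteq> {} \<and> Q \<noteq> V \<and> (\<forall>e\<in>X. (hs e \<union> ts e) \<inter> Q = {} \<or> hs e \<union> ts e \<subseteq> Q)")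
        case True
        then obtain Q where Q: "Q \<subseteq> V" "Q \<noteq> {}" "Q \<noteq> V"
          and sep: "\<And>e. e \<in> X \<Longrightarrow> (hs e \<union> ts e) \<inter> Q = {} \<or> hs e \<union> ts e \<subseteq> Q" by blast
        define XQ where "XQ = {e \<in> X. hs e \<union> ts e \<subseteq> Q}"
        have sub_pack: "cover_packing W hs ts (X' \<union> hf ` W) c"
          if W: "W \<subseteq> V" "W \<noteq> V" and X': "X' \<subseteq> X" "\<And>e. e \<in> X' \<Longrightarrow> hs e \<union> ts e \<subseteq> W" for W X'
        proof (rule IH)
          have "card W < card V" using W finV by (intro psubset_card_mono) auto
          moreover have "(\<Sum>e\<in>X'. c e + 1) \<le> (\<Sum>e\<in>X. c e + 1)" using X'(1) finX by (intro sum_mono2) auto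
          moreover have "(\<Sum>v\<in>W. c (hf v)) \<le> (\<Sum>v\<in>V. c (hf v))" using W(1) finV by (intro sum_mono2) auto
          ultimately show "card W + (\<Sum>e\<in>X'. c e + 1) + (\<Sum>v\<in>W. c (hf v))
            < card V + (\<Sum>e\<in>X. c e + 1) + (\<Sum>v\<in>V. c (hf v))" by linarith
          show "finite W" "finite X'" using W(1) X'(1) finV finX by (auto intro: finite_subset)
          show "(is_item W hs ts e \<and> card (hs e) = 2) \<or> is_arc W hs ts e" if "e \<in> X'" for e
          proof -
            have "e \<in> X" using X'(1) that by blast
            then show ?thesis using X_el[of e] X'(2)[OF that] unfolding is_item_def is_arc_def by auto
          qed
          show "hs (hf v) = {v} \<and> ts (hf v) = {}" if "v \<in> W" for v using hf W(1) that by blast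
        qed
        have XQ2: "hs e \<union> ts e \<subseteq> V - Q" if "e \<in> X - XQ" for e
          using sep[of e] fin_hs[of e] that unfolding XQ_def by blast
        have "cover_packing Q hs ts (XQ \<union> hf ` Q) c"
          using Q unfolding XQ_def by (intro sub_pack) auto
        then obtain F1 Z1 where one: "F1 \<subseteq> XQ \<union> hf ` Q" "covering Q hs ts F1"
          "\<forall>S\<in>#Z1. subpartition Q S"
          "\<forall>e\<in>XQ \<union> hf ` Q. load hs ts Z1 e \<le> c e" "sum c F1 \<le> packing_value Z1"
          by (rule cover_packingE)
        note 1 = one[rule_format]
        have "cover_packing (V - Q) hs ts ((X - XQ) \<union> hf ` (V - Q)) c"
          using Q XQ2 by (intro sub_pack) auto
        then obtain F2 Z2 where two: "F2 \<subseteq> (X - XQ) \<union> hf ` (V - Q)" "covering (V - Q) hs ts F2"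
          "\<forall>S\<in>#Z2. subpartition (V - Q) S"
          "\<forall>e\<in>(X - XQ) \<union> hf ` (V - Q). load hs ts Z2 e \<le> c e" "sum c F2 \<le> packing_value Z2"
          by (rule cover_packingE)
        note 2 = two[rule_format]
        have in1: "hs e \<union> ts e \<subseteq> Q" if "e \<in> XQ \<union> hf ` Q" for e
          using that hf Q(1) unfolding XQ_def by auto
        have in2: "hs e \<union> ts e \<subseteq> V - Q" if "e \<in> (X - XQ) \<union> hf ` (V - Q)" for e
        proof (cases "e \<in> X - XQ")
          case False
          then have "e \<in> hf ` (V - Q)" using that by blast
          then obtain v where "v \<in> V - Q" "e = hf v" by blast
          then show ?thesis using hf[of v] by simp
        qed (rule XQ2)
        show ?thesis
        proof (rule cover_packingI[of "F1 \<union> F2" _ _ _ _ "Z1 + Z2"])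
          show "F1 \<union> F2 \<subseteq> X \<union> hf ` V" using 1(1) 2(1) Q(1) unfolding XQ_def by blast
          have "covering (Q \<union> (V - Q)) hs ts (F1 \<union> F2)"
          proof (rule covering_Un_disjoint[OF 1(2) 2(2)])
            show "hs e \<union> ts e \<subseteq> Q" if "e \<in> F1" for e by (rule in1[OF subsetD[OF 1(1) that]])
            show "hs e \<union> ts e \<subseteq> V - Q" if "e \<in> F2" for e by (rule in2[OF subsetD[OF 2(1) that]])
          qed
          moreover have "Q \<union> (V - Q) = V" using Q(1) by blast
          ultimately show "covering V hs ts (F1 \<union> F2)" by simp
          show "subpartition V S" if "S \<in># Z1 + Z2" for S
            using that 1(3)[of S] 2(3)[of S] Q(1) unfolding subpartition_def by auto
          show "load hs ts (Z1 + Z2) e \<le> c e" if e: "e \<in> X \<union> hf ` V" for e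
          proof (cases "e \<in> XQ \<union> hf ` Q")
            case True
            have "load hs ts Z2 e = 0"
              using in1[OF True] 2(3) unfolding subpartition_def by (intro load_zero) blast
            then show ?thesis using 1(4)[OF True] unfolding load_add by simp
          next
            case False
            then have e2: "e \<in> (X - XQ) \<union> hf ` (V - Q)" using e by blast
            have "load hs ts Z1 e = 0"
              using in2[OF e2] 1(3) unfolding subpartition_def by (intro load_zero) blast
            then show ?thesis using 2(4)[OF e2] unfolding load_add by simp
          qed
          have "finite F1" "finite F2" using 1(1) 2(1) finX finV Q(1)
            unfolding XQ_def by (auto intro: finite_subset)
          then have "sum c (F1 \<union> F2) \<le> sum c F1 + sum c F2" by (simp add: sum_Un_nat)
          then show "sum c (F1 \<union> F2) \<le> packing_value (Z1 + Z2)"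
            using 1(5) 2(5) unfolding packing_value_add by linarith
        qed
      next
        case False
        then have connected: "\<exists>e\<in>X. (hs e \<union> ts e) \<inter> Q \<noteq> {} \<and> \<not> hs e \<union> ts e \<subseteq> Q"
          if "Q \<subseteq> V" "Q \<noteq> {}" "Q \<noteq> V" for Q using that by blast
        show ?thesis
        proof (cases "\<exists>v\<in>V. c (hf v) = 0")
          case True
          \<comment> \<open>For an element joining W to its complement, \<open>useful\<close>
            contradicts \<open>rep_edge\<close> or \<open>rep_arc\<close>. So W is all of V, and the
            half-edges are a cover of cost 0, matched by the empty packing.\<close>
          define W where "W = {v \<in> V. c (hf v) = 0}"
          have "W = V"
          proof (rule ccontr)
            assume "W \<noteq> V"
            moreover have "W \<subseteq> V" "W \<noteq> {}" using True unfolding W_def by auto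
            ultimately obtain e where e: "e \<in> X" "(hs e \<union> ts e) \<inter> W \<noteq> {}" "\<not> hs e \<union> ts e \<subseteq> W"
              using connected by blast
            obtain u v where uv: "u \<in> hs e \<union> ts e" "u \<in> W" "v \<in> hs e \<union> ts e" "v \<notin> W" using e(2,3) by blast
            have cu: "c (hf u) = 0" using uv(2) unfolding W_def by blast
            have uV: "u \<in> V" "v \<in> V" using uv fin_hs[OF e(1)] by auto
            consider "is_item V hs ts e" "card (hs e) = 2" | "is_arc V hs ts e" using X_el[OF e(1)] by blast
            then show False
            proof cases
              case 1
              then have it: "ts e = {}" "finite (hs e)" unfolding is_item_def by auto
              have ne: "u \<noteq> v" using uv by blast
              then have "{u, v} = hs e" using uv it 1(2) by (intro card_subset_eq) auto
              then have "hs e = {u, v}" by simp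
              then have "(\<Sum>v\<in>hs e. c (hf v)) = c (hf u) + c (hf v)" using ne by simp
              then have "c e < c (hf v)" using useful[OF e(1)] cu by simp
              then show False using rep_edge[OF e(1) it(1), of v] uv it(1) by auto
            next
              case 2
              then obtain x y where xy: "ts e = {x}" "hs e = {y}" unfolding is_arc_def by blast
              have "c e < c (hf y)" using useful[OF e(1)] xy by simp
              moreover have "c (hf y) \<le> c (hf x) + c e" by (rule rep_arc[OF e(1) xy])
              moreover have "u = x \<or> u = y" using uv(1) xy by auto
              ultimately show False using cu by auto
            qed
          qed
          then have "\<And>v. v \<in> V \<Longrightarrow> c (hf v) = 0" unfolding W_def by blast
          then have "sum c (hf ` V) = 0" by (intro sum.neutral) auto
          then show ?thesis
            by (intro cover_packingI[of "hf ` V" _ _ _ _ "{#}"]) (auto simp: cov_hf load_def)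
        next
          case False
          then have pos: "1 \<le> c (hf v)" if "v \<in> V" for v using that by (metis One_nat_def Suc_leI gr0I)
          show ?thesis
          proof (cases "V = {}")
            case True
            then show ?thesis
              by (intro cover_packingI[of "{}" _ _ _ _ "{#}"]) (auto simp: covering_def load_def)
          next
            case ne: False
            interpret T: tight_system V hs ts X hf c
            proof
              show "1 \<le> c e" if "e \<in> X \<union> hf ` V" "ts e = {}" for e
              proof (cases "e \<in> X")
                case True
                then have "card (hs e) = 2" using X_el that(2) unfolding is_arc_def by auto
                then obtain v where "v \<in> hs e" by fastforce
                then show ?thesis using rep_edge[OF True that(2), of v] pos[of v] fin_hs[OF True] by force
              qed (use that pos in auto)
              show "\<exists>F\<subseteq>X \<union> hf ` V. covering V hs ts F \<and> hf t \<in> F \<and>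
                (\<forall>G\<subseteq>X \<union> hf ` V. covering V hs ts G \<longrightarrow> sum c F \<le> sum c G)" if "t \<in> V" for t
                using tight[OF that] unfolding opt_def Y_def by blast
            qed (use finV ne finX X_el hf useful connected in auto)
            define c' where "c' e = c e - T.\<rho> e" for e
            have "(\<Sum>v\<in>V. c' (hf v)) < (\<Sum>v\<in>V. c (hf v))"
            proof (rule sum_strict_mono[OF finV ne])
              fix v assume v: "v \<in> V"
              then show "c' (hf v) < c (hf v)" using pos[OF v] hf[OF v] unfolding c'_def T.\<rho>_def by simp
            qed
            moreover have "(\<Sum>e\<in>X. c' e + 1) \<le> (\<Sum>e\<in>X. c e + 1)"
              unfolding c'_def by (intro sum_mono) simp
            ultimately have "cover_packing V hs ts (X \<union> hf ` V) c'"
              using finV finX X_el hf by (intro IH) auto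
            then obtain F Z where FZ': "F \<subseteq> X \<union> hf ` V" "covering V hs ts F"
              "\<forall>S\<in>#Z. subpartition V S"
              "\<forall>e'\<in>X \<union> hf ` V. load hs ts Z e' \<le> c' e'" "sum c' F \<le> packing_value Z"
              by (rule cover_packingE)
            note FZ = FZ'[rule_format]
            have "T.copt F0" using F0 unfolding opt_def T.copt_def T.Y_def Y_def .
            then have "sum c F0 \<le> (\<Sum>e\<in>F. c e - T.\<rho> e) + (card T.arc_comps + 1) div 2"
              by (rule T.min_cost_drop) (use FZ(1,2) in \<open>simp_all add: T.Y_def\<close>)
            then have val: "sum c F0 \<le> packing_value (add_mset T.arc_comps Z)"
              using FZ(5) unfolding packing_value_def c'_def by simp
            have sub: "subpartition V T.arc_comps"
              unfolding subpartition_def partition_on_def disjoint_def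
              using T.arc_compD T.arc_comps_disjoint by blast
            have ld: "load hs ts (add_mset T.arc_comps Z) e \<le> c e" if e: "e \<in> X \<union> hf ` V" for e
            proof -
              \<comment> \<open>Arcs enter no component, so the row added to the packing is bounded
                by \<open>\<rho>\<close>, exactly what was taken off the costs.\<close>
              have "of_bool (\<exists>U\<in>T.arc_comps. enters hs ts e U) \<le> T.\<rho> e"
              proof (cases "ts e = {}")
                case False
                then have eX: "e \<in> X" using e hf by auto
                have "\<not> enters hs ts e K" if K: "K \<in> T.arc_comps" for K
                proof -
                  have "hs e \<union> ts e \<subseteq> K \<or> (hs e \<union> ts e) \<inter> K = {}"
                    using T.arc_compD(1)[OF K] eX False unfolding T.uncrossed_def by blast
                  then show ?thesis using False unfolding enters_def by blast
                qed
                then show ?thesis by simp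
              qed (simp add: T.\<rho>_def of_bool_def)
              moreover have "T.\<rho> e \<le> c e" using T.positive[OF e] unfolding T.\<rho>_def by (simp add: of_bool_def)
              ultimately show ?thesis using FZ(4)[OF e] unfolding load_def c'_def by simp
            qed
            show ?thesis
              by (rule cover_packingI[OF _ F0D(2) _ ld val]) (use F0D(1) FZ(3) sub Y_def in auto)
          qed
        qed
      qed
    qed
  qed
qed

section \<open>Mixed graphs and the linear system\<close>

definition el_heads :: "('v, 'e) pre_digraph \<Rightarrow> 'e set \<Rightarrow> ('e \<Rightarrow> 'v set) \<Rightarrow> 'e \<Rightarrow> 'v set" where
  "el_heads D E ends e = (if e \<in> E then ends e else {head D e})"

definition el_tails :: "('v, 'e) pre_digraph \<Rightarrow> 'e set \<Rightarrow> 'e \<Rightarrow> 'v set" where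
  "el_tails D E e = (if e \<in> E then {} else {tail D e})"

text \<open>An element has at most two heads and the members of S are disjoint, so it enters at most
  two of them. This makes the cover constraints valid and, summed over a packing, gives
  \<open>packing_value_le\<close>.\<close>

lemma covering_number_bound:
  assumes S: "subpartition V S" and finV: "finite V" and finF: "finite F"
    and F: "covering V hs ts F" and hs: "\<And>e. e \<in> F \<Longrightarrow> finite (hs e) \<and> card (hs e) \<le> 2"
  shows "(card S + 1) div 2 \<le> card {e \<in> F. \<exists>U\<in>S. enters hs ts e U}"
proof -
  let ?F = "{e \<in> F. \<exists>U\<in>S. enters hs ts e U}"
  have SV: "\<And>U. U \<in> S \<Longrightarrow> U \<subseteq> V \<and> U \<noteq> {}"
    and dis: "\<And>U U'. U \<in> S \<Longrightarrow> U' \<in> S \<Longrightarrow> U \<inter> U' \<noteq> {} \<Longrightarrow> U = U'"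
    using S unfolding subpartition_def partition_on_def disjoint_def by auto
  have finS: "finite S" using SV finV by (auto intro: finite_subset[of _ "Pow V"])
  have "\<forall>U\<in>S. \<exists>e. e \<in> F \<and> enters hs ts e U" using coveringD[OF F] SV by blast
  then obtain g where g: "\<forall>U\<in>S. g U \<in> F \<and> enters hs ts (g U) U" by (rule bchoice[THEN exE])
  have "{U \<in> S. g U \<in> ?F} = S" using g by blast
  then have "card S = (\<Sum>e\<in>?F. card {U \<in> S. g U = e})"
    using card_preimage_sum[OF finS, of ?F g] finF by simp
  also have "\<dots> \<le> (\<Sum>e\<in>?F. 2)"
  proof (rule sum_mono)
    fix e assume e: "e \<in> ?F"
    have "card {U \<in> S. g U = e} \<le> card (hs e)"
    proof (rule card_le_card_hit)
      show "finite (hs e)" using hs e by blast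
      show "J \<inter> hs e \<noteq> {}" if "J \<in> {U \<in> S. g U = e}" for J
        using that g unfolding enters_def by blast
      show "J = J'" if "J \<in> {U \<in> S. g U = e}" "J' \<in> {U \<in> S. g U = e}" "J \<inter> J' \<noteq> {}" for J J'
        using that dis by blast
    qed
    then show "card {U \<in> S. g U = e} \<le> 2" using hs[of e] e by auto
  qed
  finally show ?thesis by simp
qed

lemma packing_value_le:
  assumes Z: "\<forall>S\<in>#Z. subpartition V S" and finV: "finite V" and finF: "finite F"
    and F: "covering V hs ts F" and hs: "\<And>e. e \<in> F \<Longrightarrow> finite (hs e) \<and> card (hs e) \<le> 2"
  shows "packing_value Z \<le> (\<Sum>e\<in>F. load hs ts Z e)"
  using Z
proof (induction Z)
  case (add S Z)
  have "(card S + 1) div 2 \<le> card {e \<in> F. \<exists>U\<in>S. enters hs ts e U}"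
    using add.prems by (intro covering_number_bound[OF _ finV finF F hs]) simp_all
  also have "\<dots> = (\<Sum>e\<in>F. of_bool (\<exists>U\<in>S. enters hs ts e U))"
    using finF by (simp add: of_bool_def sum.If_cases Int_def)
  finally show ?case using add.IH add.prems unfolding packing_value_def load_def by (simp add: sum.distrib)
qed (simp add: packing_value_def)

lemma sum_mset_count_sum:
  fixes f :: "'a \<Rightarrow> nat"
  assumes "finite A" "set_mset Z \<subseteq> A"
  shows "real (\<Sum>x\<in>#Z. f x) = (\<Sum>x\<in>A. real (count Z x) * real (f x))"
  using assms(2)
proof (induction Z)
  case (add y Z)
  have "(\<Sum>x\<in>A. real (count (add_mset y Z) x) * real (f x))
      = (\<Sum>x\<in>A. real (count Z x) * real (f x) + (if x = y then real (f x) else 0))"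
    by (intro sum.cong) (auto simp: algebra_simps)
  also have "\<dots> = (\<Sum>x\<in>A. real (count Z x) * real (f x)) + real (f y)"
    using add.prems assms(1) by (simp add: sum.distrib sum.delta')
  finally show ?case using add by simp
qed simp

lemma weak_duality:
  assumes y: "dual_feasible J I a c y" and x: "x \<in> solutions J I a b" and c: "c \<in> coord_space J"
    and fin: "finite I"
  shows "(\<Sum>i\<in>I. y i * b i) \<le> c \<bullet> x"
proof -
  have x0: "x $ j = 0" if "j \<notin> J" for j using x that unfolding solutions_def coord_space_def by blast
  have xJ: "z \<bullet> x = (\<Sum>j\<in>J. z $ j * x $ j)" for z :: "real ^ 'a"
    unfolding inner_vec_def using x0 by (intro sum.mono_neutral_cong_right) auto
  have "(\<Sum>i\<in>I. y i * b i) \<le> (\<Sum>i\<in>I. y i * (a i \<bullet> x))"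
    using x y unfolding solutions_def dual_feasible_def by (intro sum_mono mult_left_mono) auto
  also have "\<dots> = (\<Sum>i\<in>I. \<Sum>j\<in>J. y i * (a i $ j * x $ j))" by (simp add: xJ sum_distrib_left)
  also have "\<dots> = (\<Sum>j\<in>J. \<Sum>i\<in>I. y i * (a i $ j * x $ j))" by (rule sum.swap)
  also have "\<dots> = (\<Sum>j\<in>J. (\<Sum>i\<in>I. y i * a i $ j) * x $ j)" by (simp add: sum_distrib_right mult.assoc)
  also have "\<dots> = (\<Sum>j\<in>J. c $ j * x $ j)" using y unfolding dual_feasible_def by (intro sum.cong) auto
  also have "\<dots> = c \<bullet> x" by (rule xJ[symmetric])
  finally show ?thesis .
qed

section \<open>Mixed edge covers as coverings\<close>

context mixed_graph
begin

abbreviation "hds \<equiv> el_heads D E ends"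
abbreviation "tls \<equiv> el_tails D E"
abbreviation "els \<equiv> E \<union> arcs D"

lemma el_edge: "e \<in> E \<Longrightarrow> hds e = ends e \<and> tls e = {}"
  unfolding el_heads_def el_tails_def by simp

lemma el_arc: "a \<in> arcs D \<Longrightarrow> hds a = {head D a} \<and> tls a = {tail D a}"
  using edges_arcs_disjoint unfolding el_heads_def el_tails_def by auto

lemma finite_els: "finite els" using finite_edges finite_arcs by simp

lemma card_heads: "e \<in> els \<Longrightarrow> finite (hds e) \<and> card (hds e) \<le> 2"
  using el_edge el_arc card_ends by (auto intro: card_ge_0_finite)

lemma wf_sub: "wf_digraph (D\<lparr>arcs := F \<inter> arcs D\<rparr>)"
  using wellformed by unfold_locales auto

lemma apath_reachable:
  "(\<exists>p. pre_digraph.apath (D\<lparr>arcs := F \<inter> arcs D\<rparr>) u p v) \<longleftrightarrow> u \<rightarrow>\<^sup>*\<^bsub>D\<lparr>arcs := F \<inter> arcs D\<rparr>\<^esub> v"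
  using wf_digraph.reachable_apath[OF wf_sub] by metis

lemma reachable_enters:
  assumes "u \<rightarrow>\<^sup>*\<^bsub>D\<lparr>arcs := F \<inter> arcs D\<rparr>\<^esub> v" "u \<notin> U" "v \<in> U"
  shows "\<exists>a\<in>F \<inter> arcs D. enters hds tls a U"
  using assms
proof (induction rule: wf_digraph.reachable_induct[OF wf_sub, consumes 1])
  case (2 x y)
  show ?case
  proof (cases "x \<in> U")
    case False
    obtain a where a: "a \<in> F \<inter> arcs D" "tail D a = x" "head D a = y"
      using 2 by (auto simp: arcs_ends_def arc_to_ends_def)
    then have "enters hds tls a U" using el_arc[of a] 2 False unfolding enters_def by simp
    then show ?thesis using a(1) by blast
  qed (use 2 in blast)
qed auto

text \<open>A path that starts outside U and ends in U has an arc entering U. Conversely, no element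
  of F can enter the set of vertices that are not reached from an end of an edge of F.\<close>

lemma mixed_edge_cover_iff:
  "mixed_edge_cover D E ends F \<longleftrightarrow> F \<subseteq> els \<and> covering (verts D) hds tls F"
proof (intro iffI conjI)
  assume F: "mixed_edge_cover D E ends F"
  then show "F \<subseteq> els" unfolding mixed_edge_cover_def by blast
  show "covering (verts D) hds tls F"
    unfolding covering_def
  proof (intro allI impI)
    fix U assume U: "U \<subseteq> verts D" "U \<noteq> {}"
    then obtain v where v: "v \<in> U" "v \<in> verts D" by blast
    then obtain e u where e: "e \<in> F \<inter> E" "u \<in> ends e"
      "\<exists>p. pre_digraph.apath (D\<lparr>arcs := F \<inter> arcs D\<rparr>) u p v"
      using F unfolding mixed_edge_cover_def by blast
    show "\<exists>e\<in>F. enters hds tls e U"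
    proof (cases "u \<in> U")
      case True
      then have "enters hds tls e U" using e el_edge[of e] unfolding enters_def by auto
      then show ?thesis using e(1) by blast
    next
      case False
      then show ?thesis using reachable_enters[where u = u and v = v and F = F and U = U] e(3) v(1) unfolding apath_reachable by blast
    qed
  qed
next
  assume F: "F \<subseteq> els \<and> covering (verts D) hds tls F"
  let ?R = "\<lambda>u v. u \<rightarrow>\<^sup>*\<^bsub>D\<lparr>arcs := F \<inter> arcs D\<rparr>\<^esub> v"
  define U where "U = {v \<in> verts D. \<not> (\<exists>e\<in>F \<inter> E. \<exists>u\<in>ends e. ?R u v)}"
  have "U = {}"
  proof (rule ccontr)
    assume "U \<noteq> {}"
    then obtain e where e: "e \<in> F" "enters hds tls e U"
      using F coveringD[of "verts D" hds tls F U] unfolding U_def by blast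
    show False
    proof (cases "e \<in> E")
      case True
      then obtain u where u: "u \<in> ends e" "u \<in> U" using e el_edge[of e] unfolding enters_def by auto
      have "?R u u" using u ends_in_verts[OF True]
        by (intro wf_digraph.reachable_refl[OF wf_sub]) auto
      then show False using u e True unfolding U_def by blast
    next
      case False
      then have a: "e \<in> arcs D" using e F by blast
      have h: "head D e \<in> U" "tail D e \<notin> U" using e(2) el_arc[OF a] unfolding enters_def by auto
      have "tail D e \<in> verts D" using a by simp
      then obtain e' u where e': "e' \<in> F \<inter> E" "u \<in> ends e'" "?R u (tail D e)" using h unfolding U_def by blast
      have adj: "tail D e \<rightarrow>\<^bsub>D\<lparr>arcs := F \<inter> arcs D\<rparr>\<^esub> head D e"
        using a e(1) by (force simp: arcs_ends_def arc_to_ends_def)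
      have "?R u (head D e)" by (rule wf_digraph.reachable_adj_trans[OF wf_sub e'(3) adj])
      then show False using h(1) e' unfolding U_def by blast
    qed
  qed
  then show "mixed_edge_cover D E ends F"
    using F unfolding mixed_edge_cover_def apath_reachable[symmetric] U_def by blast
qed

lemma cover_and_packing:
  fixes c :: "'e \<Rightarrow> nat"
  assumes "\<exists>F. mixed_edge_cover D E ends F"
  obtains F Z where "mixed_edge_cover D E ends F" "\<forall>S\<in>#Z. subpartition (verts D) S"
    "\<forall>e\<in>els. load hds tls Z e \<le> c e" "sum c F \<le> packing_value Z"
proof -
  obtain F0 where F0: "F0 \<subseteq> els" "covering (verts D) hds tls F0"
    using assms mixed_edge_cover_iff by blast
  have finF0: "finite F0" using F0(1) finite_els by (rule finite_subset)
  define hs :: "'e + 'v \<Rightarrow> 'v set" where "hs = case_sum hds (\<lambda>v. {v})"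
  define ts :: "'e + 'v \<Rightarrow> 'v set" where "ts = case_sum tls (\<lambda>v. {})"
  \<comment> \<open>At this price a single half-edge costs more than \<open>F0\<close>. The cost of
    \<open>F0\<close> bounds the value of the packing, hence that of the cover found, which
    therefore has no half-edge.\<close>
  define c' where "c' = case_sum c (\<lambda>v::'v. sum c F0 + 1)"
  have ent: "enters hs ts (Inl e) U \<longleftrightarrow> enters hds tls e U" for e U
    unfolding enters_def hs_def ts_def by simp
  have ld: "load hs ts Z (Inl e) = load hds tls Z e" for Z e unfolding load_def ent by simp
  have "cover_packing (verts D) hs ts (Inl ` els \<union> Inr ` verts D) c'"
  proof (rule cover_packing_exists)
    show "finite (verts D)" by simp
    show "finite (Inl ` els)" using finite_els by blast
    show "hs (Inr v) = {v} \<and> ts (Inr v) = {}" if "v \<in> verts D" for v unfolding hs_def ts_def by simp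
    show "(is_item (verts D) hs ts e \<and> card (hs e) = 2) \<or> is_arc (verts D) hs ts e" if eI: "e \<in> Inl ` els" for e
    proof -
      obtain f where f: "e = Inl f" "f \<in> els" using eI by blast
      show ?thesis
      proof (cases "f \<in> E")
        case True
        then have "card (ends f) = 2" by (rule card_ends)
        then show ?thesis using el_edge[OF True] ends_in_verts[OF True] card_ge_0_finite[of "ends f"]
          unfolding f(1) is_item_def hs_def ts_def by simp
      next
        case False
        then have a: "f \<in> arcs D" using f(2) by blast
        then show ?thesis using el_arc[OF a] no_loops[OF a]
          unfolding f(1) is_arc_def hs_def ts_def by simp
      qed
    qed
  qed
  then obtain F Z where FZ: "F \<subseteq> Inl ` els \<union> Inr ` verts D" "covering (verts D) hs ts F"
    "\<forall>S\<in>#Z. subpartition (verts D) S"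
    "\<forall>e\<in>Inl ` els \<union> Inr ` verts D. load hs ts Z e \<le> c' e" "sum c' F \<le> packing_value Z"
    by (rule cover_packingE)
  have load_le: "\<forall>e\<in>els. load hds tls Z e \<le> c e"
  proof
    fix e assume "e \<in> els"
    then have "load hs ts Z (Inl e) \<le> c' (Inl e)" using FZ(4)[rule_format, of "Inl e"] by blast
    then show "load hds tls Z e \<le> c e" unfolding ld c'_def by simp
  qed
  have finF: "finite F" using FZ(1) finite_els by (auto intro: finite_subset)
  have "packing_value Z \<le> (\<Sum>e\<in>F0. load hds tls Z e)"
    using F0(1) card_heads by (intro packing_value_le[OF FZ(3) _ finF0 F0(2)]) auto
  also have "\<dots> \<le> sum c F0" using load_le F0(1) by (intro sum_mono) blast
  finally have le: "sum c' F \<le> sum c F0" using FZ(5) by linarith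
  have noR: "Inr v \<notin> F" for v
  proof
    assume "Inr v \<in> F"
    then have "c' (Inr v) \<le> sum c' F" using finF by (intro member_le_sum) auto
    then show False using le unfolding c'_def by simp
  qed
  define F1 where "F1 = {e. Inl e \<in> F}"
  have FF1: "F = Inl ` F1"
  proof
    show "F \<subseteq> Inl ` F1"
    proof
      fix e assume "e \<in> F"
      then show "e \<in> Inl ` F1" using noR unfolding F1_def by (cases e) auto
    qed
  qed (auto simp: F1_def)
  have "F1 \<subseteq> els" using FZ(1) unfolding FF1 by blast
  moreover have "covering (verts D) hds tls F1"
    using FZ(2) unfolding covering_def FF1 by (simp add: ent)
  moreover have "sum c' F = sum c F1" unfolding FF1 c'_def by (simp add: sum.reindex)
  ultimately show thesis using that[of F1 Z] FZ(3,5) load_le mixed_edge_cover_iff by simp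
qed

end

section \<open>Dual certificates, total dual integrality and the convex hull\<close>

context
  fixes D :: "('v, 'e::finite) pre_digraph" and E :: "'e set" and ends :: "'e \<Rightarrow> 'v set"
  assumes mixed: "mixed_graph D E ends"
begin

interpretation mixed_graph D E ends by (rule mixed)

lemma finite_subpartitions: "finite {S. subpartition (verts D) S}"
  by (rule finite_subset[of _ "Pow (Pow (verts D))"]) (auto simp: subpartition_def)

lemma finite_constrs: "finite (mec_constrs D E)"
  unfolding mec_constrs_def using finite_subpartitions by simp

lemma sum_constrs:
  fixes g :: "('v, 'e) constr \<Rightarrow> real"
  shows "sum g (mec_constrs D E) = (\<Sum>e\<in>els. g (Lower e)) + (\<Sum>e\<in>els. g (Upper e)) +
    (\<Sum>S\<in>{S. subpartition (verts D) S}. g (Cover S))"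
proof -
  let ?P = "{S. subpartition (verts D) S}"
  have "sum g (mec_constrs D E) = sum g (Lower ` els \<union> Upper ` els) + sum g (Cover ` ?P)"
    unfolding mec_constrs_def using finite_subpartitions by (intro sum.union_disjoint) auto
  also have "sum g (Lower ` els \<union> Upper ` els) = sum g (Lower ` els) + sum g (Upper ` els)"
    by (intro sum.union_disjoint) auto
  finally show ?thesis by (simp add: sum.reindex inj_on_def)
qed

lemma row_lower: "mec_row D E ends (Lower e) $ j = of_bool (j = e)"
  by (simp add: incidence_def)

lemma row_upper: "mec_row D E ends (Upper e) $ j = - of_bool (j = e)"
  by (simp add: incidence_def)

text \<open>An edge meeting the union of S is either induced or in the cut, never both. An arc has a
  single head and so enters at most one of the disjoint members, which keeps the sum over S at 0 or
  1.\<close>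

lemma row_cover:
  assumes S: "subpartition (verts D) S" and j: "j \<in> els"
  shows "mec_row D E ends (Cover S) $ j = of_bool (\<exists>U\<in>S. enters hds tls j U)"
proof (cases "j \<in> E")
  case True
  have card2: "card (ends j) = 2" and fin: "finite (ends j)"
    using card_ends[OF True] by (auto intro: card_ge_0_finite)
  have "j \<notin> in_cut D Z" for Z using True edges_arcs_disjoint unfolding in_cut_def by blast
  then have "mec_row D E ends (Cover S) $ j
      = of_bool (ends j \<subseteq> \<Union>S) + of_bool (card (ends j \<inter> \<Union>S) = 1)"
    using True by (simp add: incidence_def induced_edges_def edge_cut_def)
  also have "\<dots> = of_bool (ends j \<inter> \<Union>S \<noteq> {})"
  proof (cases "ends j \<subseteq> \<Union>S")
    case sub: True
    then have "ends j \<inter> \<Union>S = ends j" by blast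
    then show ?thesis using sub card2 by auto
  next
    case False
    then have "card (ends j \<inter> \<Union>S) < 2" using psubset_card_mono[OF fin, of "ends j \<inter> \<Union>S"] card2 by auto
    moreover have "card (ends j \<inter> \<Union>S) = 0 \<longleftrightarrow> ends j \<inter> \<Union>S = {}" using fin by simp
    ultimately have "card (ends j \<inter> \<Union>S) = 1 \<longleftrightarrow> ends j \<inter> \<Union>S \<noteq> {}" by linarith
    then show ?thesis using False by simp
  qed
  also have "ends j \<inter> \<Union>S \<noteq> {} \<longleftrightarrow> (\<exists>U\<in>S. enters hds tls j U)"
    using el_edge[OF True] unfolding enters_def by auto
  finally show ?thesis .
next
  case False
  then have a: "j \<in> arcs D" using j by blast
  have "S \<subseteq> Pow (verts D)" using S unfolding subpartition_def by blast
  then have finS: "finite S" by (rule finite_subset) simp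
  have dis: "\<And>U U'. U \<in> S \<Longrightarrow> U' \<in> S \<Longrightarrow> U \<inter> U' \<noteq> {} \<Longrightarrow> U = U'"
    using S unfolding subpartition_def partition_on_def disjoint_def by auto
  have en: "j \<in> in_cut D Z \<longleftrightarrow> enters hds tls j Z" for Z
    using a el_arc[OF a] unfolding in_cut_def enters_def by auto
  have "mec_row D E ends (Cover S) $ j = (\<Sum>Z\<in>S. of_bool (enters hds tls j Z))"
    using False by (simp add: incidence_def induced_edges_def edge_cut_def en of_bool_def)
  also have "\<dots> = of_bool (\<exists>U\<in>S. enters hds tls j U)"
  proof (cases "\<exists>U\<in>S. enters hds tls j U")
    case True
    then obtain U where U: "U \<in> S" "enters hds tls j U" by blast
    have "(\<Sum>Z\<in>S. of_bool (enters hds tls j Z) :: real) = (\<Sum>Z\<in>S. of_bool (Z = U))"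
    proof (rule sum.cong[OF refl])
      fix Z assume Z: "Z \<in> S"
      have "enters hds tls j Z \<longleftrightarrow> Z = U"
        using dis[OF Z U(1)] U(2) el_arc[OF a] unfolding enters_def by auto
      then show "(of_bool (enters hds tls j Z) :: real) = of_bool (Z = U)" by simp
    qed
    also have "\<dots> = 1" using finS U(1) by (simp add: of_bool_def)
    finally show ?thesis using True by simp
  qed auto
  finally show ?thesis .
qed

lemma ceiling_half: "of_int \<lceil>real n / 2\<rceil> = real ((n + 1) div 2)"
proof -
  have "\<lceil>real n / 2\<rceil> = int ((n + 1) div 2)"
  proof (cases "even n")
    case True
    then obtain k where "n = 2 * k" by blast
    then show ?thesis by simp
  next
    case False
    then obtain k where k: "n = 2 * k + 1" by (rule oddE)
    then show ?thesis by (intro ceiling_unique) (auto simp: field_simps)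
  qed
  then show ?thesis by simp
qed

lemma cover_in_solutions:
  assumes F: "mixed_edge_cover D E ends F"
  shows "incidence F \<in> solutions els (mec_constrs D E) (mec_row D E ends) mec_rhs"
proof -
  have Fe: "F \<subseteq> els" and cov: "covering (verts D) hds tls F" using F mixed_edge_cover_iff by auto
  have inc: "incidence F $ j = of_bool (j \<in> F)" for j by (simp add: incidence_def)
  have dot: "z \<bullet> incidence F = (\<Sum>j\<in>F. z $ j)" for z :: "real ^ 'e"
    using inner_incidence[of F z] by (simp add: inner_commute)
  have "mec_rhs i \<le> mec_row D E ends i \<bullet> incidence F" if i: "i \<in> mec_constrs D E" for i
  proof -
    consider e where "i = Lower e" | e where "i = Upper e"
      | S where "i = Cover S" "subpartition (verts D) S" using i unfolding mec_constrs_def by blast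
    then show ?thesis
    proof cases
      case 1
      then show ?thesis by (simp add: inner_incidence inc)
    next
      case 2
      then show ?thesis by (cases "e \<in> F") (simp_all add: inner_incidence inc)
    next
      case 3
      have "(card S + 1) div 2 \<le> card {e \<in> F. \<exists>U\<in>S. enters hds tls e U}"
        by (rule covering_number_bound[OF 3(2) _ _ cov]) (use Fe card_heads in auto)
      then have "mec_rhs i \<le> real (card {e \<in> F. \<exists>U\<in>S. enters hds tls e U})"
        unfolding 3(1) by (simp add: ceiling_half)
      also have "\<dots> = (\<Sum>j\<in>F. of_bool (\<exists>U\<in>S. enters hds tls j U))"
        by (simp add: of_bool_def sum.If_cases Int_def)
      also have "\<dots> = (\<Sum>j\<in>F. mec_row D E ends (Cover S) $ j)"
        by (intro sum.cong refl row_cover[OF 3(2), symmetric] subsetD[OF Fe])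
      also have "\<dots> = mec_row D E ends i \<bullet> incidence F" unfolding dot 3(1) ..
      finally show ?thesis .
    qed
  qed
  then show ?thesis using Fe unfolding solutions_def coord_space_def by (auto simp: inc)
qed

text \<open>The common source of both halves of the theorem: a cover and an integral dual solution
  whose values meet, for integral costs of any sign.\<close>

lemma integral_dual:
  assumes ex: "\<exists>F. mixed_edge_cover D E ends F"
    and c: "c \<in> coord_space els" "\<forall>j\<in>els. c $ j \<in> \<int>"
  obtains F y where "mixed_edge_cover D E ends F" "dual_feasible els (mec_constrs D E) (mec_row D E ends) c y"
    "\<forall>i\<in>mec_constrs D E. y i \<in> \<int>" "c \<bullet> incidence F \<le> (\<Sum>i\<in>mec_constrs D E. y i * mec_rhs i)"
proof -
  \<comment> \<open>The positive and the negative part of c. The packing theorem is applied to n,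
    and the multipliers of the upper bounds absorb m.\<close>
  define n where "n e = nat \<lfloor>c $ e\<rfloor>" for e
  define m where "m e = max 0 (- (c $ e))" for e
  have cm: "real (n e) = c $ e + m e" if "e \<in> els" for e
  proof -
    have "c $ e \<in> \<int>" using c(2) that by blast
    then obtain k where "c $ e = of_int k" by (rule Ints_cases)
    then show ?thesis unfolding n_def m_def by (auto simp: max_def)
  qed
  obtain F0 Z where FZ: "mixed_edge_cover D E ends F0" "\<forall>S\<in>#Z. subpartition (verts D) S"
    "\<forall>e\<in>els. load hds tls Z e \<le> n e" "sum n F0 \<le> packing_value Z"
    by (rule cover_and_packing[OF ex])
  \<comment> \<open>On the elements of negative cost n vanishes, so adding them all is free under n
    and collects the whole of m.\<close>
  define F where "F = F0 \<union> {e \<in> els. c $ e < 0}"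
  define y where "y i = (case i of Lower e \<Rightarrow> real (n e) - real (load hds tls Z e)
    | Upper e \<Rightarrow> m e | Cover S \<Rightarrow> real (count Z S))" for i :: "('v, 'e) constr"
  have Zsub: "set_mset Z \<subseteq> {S. subpartition (verts D) S}" using FZ(2) by blast
  have F0e: "F0 \<subseteq> els" "covering (verts D) hds tls F0" using FZ(1) mixed_edge_cover_iff by auto
  have "mixed_edge_cover D E ends F"
    using F0e covering_mono[OF F0e(2), of F] unfolding mixed_edge_cover_iff F_def by blast
  moreover have "dual_feasible els (mec_constrs D E) (mec_row D E ends) c y"
    unfolding dual_feasible_def
  proof (intro conjI ballI)
    show "0 \<le> y i" if "i \<in> mec_constrs D E" for i
      using that FZ(3) unfolding mec_constrs_def y_def m_def by auto
    fix j assume j: "j \<in> els"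
    have single: "(\<Sum>e\<in>els. f e * of_bool (j = e)) = f j" for f :: "'e \<Rightarrow> real"
    proof -
      have "(\<Sum>e\<in>els. f e * of_bool (j = e)) = (\<Sum>e\<in>els. if j = e then f e else 0)"
        by (intro sum.cong) auto
      also have "\<dots> = f j" using sum.delta[OF finite_els, of j f] j by simp
      finally show ?thesis .
    qed
    have "(\<Sum>i\<in>mec_constrs D E. y i * mec_row D E ends i $ j)
      = (\<Sum>e\<in>els. y (Lower e) * of_bool (j = e)) + (\<Sum>e\<in>els. y (Upper e) * - of_bool (j = e))
        + (\<Sum>S\<in>{S. subpartition (verts D) S}. y (Cover S) * mec_row D E ends (Cover S) $ j)"
      unfolding sum_constrs row_lower row_upper ..
    also have "(\<Sum>e\<in>els. y (Lower e) * of_bool (j = e)) = y (Lower j)"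
      by (rule single)
    also have "(\<Sum>e\<in>els. y (Upper e) * - of_bool (j = e)) = - y (Upper j)"
      unfolding mult_minus_right sum_negf by (rule arg_cong[OF single])
    also have "(\<Sum>S\<in>{S. subpartition (verts D) S}. y (Cover S) * mec_row D E ends (Cover S) $ j)
      = (\<Sum>S\<in>{S. subpartition (verts D) S}. real (count Z S) * real (of_bool (\<exists>U\<in>S. enters hds tls j U)))"
      by (intro sum.cong) (simp_all add: row_cover[OF _ j] y_def del: mec_row.simps)
    also have "\<dots> = real (load hds tls Z j)"
      unfolding load_def using sum_mset_count_sum[OF finite_subpartitions Zsub] by metis
    finally show "(\<Sum>i\<in>mec_constrs D E. y i * mec_row D E ends i $ j) = c $ j"
      using cm[OF j] unfolding y_def by simp
  qed
  moreover have "\<forall>i\<in>mec_constrs D E. y i \<in> \<int>"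
  proof
    fix i assume "i \<in> mec_constrs D E"
    then show "y i \<in> \<int>"
      using c(2) unfolding mec_constrs_def y_def m_def by (auto simp: max_def)
  qed
  moreover have "c \<bullet> incidence F \<le> (\<Sum>i\<in>mec_constrs D E. y i * mec_rhs i)"
  proof -
    have "c \<bullet> incidence F = (\<Sum>e\<in>F. c $ e)" using inner_incidence[of F c] by (simp add: inner_commute)
    also have "\<dots> = (\<Sum>e\<in>F. real (n e)) - (\<Sum>e\<in>F. m e)"
      using cm F0e(1) unfolding F_def sum_subtractf[symmetric] by (intro sum.cong) auto
    also have "(\<Sum>e\<in>F. real (n e)) = (\<Sum>e\<in>F0. real (n e))"
      unfolding F_def n_def by (intro sum.mono_neutral_right) auto
    also have "(\<Sum>e\<in>F. m e) = (\<Sum>e\<in>els. m e)"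
      using F0e(1) unfolding F_def m_def by (intro sum.mono_neutral_left) auto
    also have "(\<Sum>e\<in>F0. real (n e)) \<le> real (packing_value Z)" using FZ(4) by (metis of_nat_le_iff of_nat_sum)
    also have "real (packing_value Z) = (\<Sum>S\<in>{S. subpartition (verts D) S}. y (Cover S) * mec_rhs (Cover S))"
      unfolding packing_value_def sum_mset_count_sum[OF finite_subpartitions Zsub]
      by (simp add: y_def ceiling_half)
    finally show ?thesis unfolding sum_constrs by (simp add: y_def sum_negf)
  qed
  ultimately show thesis by (rule that)
qed

lemma rows_rational:
  assumes i: "i \<in> mec_constrs D E" and j: "j \<in> els"
  shows "mec_row D E ends i $ j \<in> \<rat>"
proof -
  consider e where "i = Lower e" | e where "i = Upper e"
    | S where "i = Cover S" "subpartition (verts D) S" using i unfolding mec_constrs_def by blast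
  then show ?thesis
    by cases (auto simp: row_lower row_upper row_cover[OF _ j] of_bool_def simp del: mec_row.simps)
qed

lemma mec_tdi:
  assumes ex: "\<exists>F. mixed_edge_cover D E ends F"
  shows "totally_dual_integral els (mec_constrs D E) (mec_row D E ends) mec_rhs"
  unfolding totally_dual_integral_def
proof (intro conjI ballI impI)
  show "finite (mec_constrs D E)" by (rule finite_constrs)
  show "mec_rhs i \<in> \<rat>" if "i \<in> mec_constrs D E" for i :: "('v, 'e) constr"
    by (cases i) auto
  show "mec_row D E ends i $ j \<in> \<rat>" if "i \<in> mec_constrs D E" "j \<in> els" for i j
    by (rule rows_rational[OF that])
  fix c :: "real ^ 'e"
  assume c: "c \<in> coord_space els" and "(\<forall>j\<in>els. c $ j \<in> \<int>) \<and>
    solutions els (mec_constrs D E) (mec_row D E ends) mec_rhs \<noteq> {} \<and>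
    bdd_below ((\<lambda>x. c \<bullet> x) ` solutions els (mec_constrs D E) (mec_row D E ends) mec_rhs)"
  then have cZ: "\<forall>j\<in>els. c $ j \<in> \<int>" by blast
  obtain F y where Fy: "mixed_edge_cover D E ends F" "dual_feasible els (mec_constrs D E) (mec_row D E ends) c y"
    "\<forall>i\<in>mec_constrs D E. y i \<in> \<int>" "c \<bullet> incidence F \<le> (\<Sum>i\<in>mec_constrs D E. y i * mec_rhs i)"
    by (rule integral_dual[OF ex c cZ])
  have "(\<Sum>i\<in>mec_constrs D E. y' i * mec_rhs i) \<le> (\<Sum>i\<in>mec_constrs D E. y i * mec_rhs i)"
    if "dual_feasible els (mec_constrs D E) (mec_row D E ends) c y'" for y'
    using weak_duality[OF that cover_in_solutions[OF Fy(1)] c finite_constrs] Fy(4) by linarith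
  then show "\<exists>y. dual_optimal els (mec_constrs D E) (mec_row D E ends) mec_rhs c y \<and>
      (\<forall>i\<in>mec_constrs D E. y i \<in> \<int>)"
    using Fy(2,3) unfolding dual_optimal_def by blast
qed

text \<open>A solution outside the hull is separated from it by a real vector a, whereas
  \<open>integral_dual\<close> needs integral costs. Scaling by N and rounding down errs by at most
  1 per element of a cover, which the gap \<open>N * (\<beta> - a \<bullet> x)\<close> outweighs; at
  x rounding down only lowers the value, as its entries are nonnegative.\<close>

lemma mec_hull:
  assumes ex: "\<exists>F. mixed_edge_cover D E ends F"
  shows "solutions els (mec_constrs D E) (mec_row D E ends) mec_rhs
    = convex hull {incidence F | F. mixed_edge_cover D E ends F}" (is "?P = convex hull ?H")
proof
  have mean: "b \<le> u * p + v * q" if "b \<le> p" "b \<le> q" "0 \<le> u" "0 \<le> v" "u + v = 1" for b p q u v :: real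
  proof -
    have "b = u * b + v * b" using that(5) by (simp add: distrib_right[symmetric])
    also have "\<dots> \<le> u * p + v * q" using that by (intro add_mono mult_left_mono)
    finally show ?thesis .
  qed
  have "convex ?P"
    unfolding solutions_def coord_space_def convex_def by (auto simp: inner_add_right intro!: mean)
  then show "convex hull ?H \<subseteq> ?P"
    using cover_in_solutions by (intro hull_minimal) auto
next
  show "?P \<subseteq> convex hull ?H"
  proof
    fix x assume x: "x \<in> ?P"
    show "x \<in> convex hull ?H"
    proof (rule ccontr)
      assume nx: "x \<notin> convex hull ?H"
      have "finite ?H" by (rule finite_subset[of _ "incidence ` UNIV"]) auto
      then have "closed (convex hull ?H)"
        by (intro compact_imp_closed finite_imp_compact_convex_hull)
      then obtain a \<beta> where sep: "a \<bullet> x < \<beta>" "\<And>z. z \<in> convex hull ?H \<Longrightarrow> \<beta> < a \<bullet> z"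
        using separating_hyperplane_closed_point[OF convex_convex_hull _ nx] by blast
      have x0: "0 \<le> x $ e" if "e \<in> els" for e
      proof -
        have "mec_rhs (Lower e :: ('v, 'e) constr) \<le> mec_row D E ends (Lower e) \<bullet> x"
          using x that unfolding solutions_def mec_constrs_def by blast
        then show ?thesis by (simp add: inner_incidence)
      qed
      have xz: "x $ e = 0" if "e \<notin> els" for e using x that unfolding solutions_def coord_space_def by blast
      obtain N :: nat where N: "real (card els) < real N * (\<beta> - a \<bullet> x)"
        using reals_Archimedean3[of "\<beta> - a \<bullet> x"] sep(1) by auto
      define c :: "real ^ 'e" where "c = (\<chi> e. if e \<in> els then of_int \<lfloor>real N * a $ e\<rfloor> else 0)"
      have c: "c \<in> coord_space els" "\<forall>j\<in>els. c $ j \<in> \<int>" unfolding c_def coord_space_def by auto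
      obtain F y where Fy: "mixed_edge_cover D E ends F" "dual_feasible els (mec_constrs D E) (mec_row D E ends) c y"
        "\<forall>i\<in>mec_constrs D E. y i \<in> \<int>" "c \<bullet> incidence F \<le> (\<Sum>i\<in>mec_constrs D E. y i * mec_rhs i)"
        by (rule integral_dual[OF ex c])
      have Fe: "F \<subseteq> els" using Fy(1) mixed_edge_cover_iff by blast
      have "real N * \<beta> \<le> real N * (a \<bullet> incidence F)"
        using sep(2)[of "incidence F"] Fy(1) by (intro mult_left_mono) (auto intro: hull_inc less_imp_le)
      also have "\<dots> = (\<Sum>e\<in>F. real N * a $ e)"
        using inner_incidence[of F a] by (simp add: inner_commute sum_distrib_left)
      also have "\<dots> \<le> (\<Sum>e\<in>F. c $ e + 1)"
      proof (rule sum_mono)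
        fix e assume "e \<in> F"
        then have "c $ e = of_int \<lfloor>real N * a $ e\<rfloor>" using Fe unfolding c_def by auto
        then show "real N * a $ e \<le> c $ e + 1" by linarith
      qed
      also have "\<dots> = c \<bullet> incidence F + real (card F)"
        using inner_incidence[of F c] by (simp add: inner_commute sum.distrib)
      also have "\<dots> \<le> c \<bullet> x + real (card els)"
        using Fy(4) weak_duality[OF Fy(2) x c(1) finite_constrs] card_mono[OF finite_els Fe] by simp
      also have "c \<bullet> x \<le> real N * (a \<bullet> x)"
      proof -
        have "c \<bullet> x = (\<Sum>e\<in>UNIV. c $ e * x $ e)" by (simp add: inner_vec_def)
        also have "\<dots> \<le> (\<Sum>e\<in>UNIV. real N * a $ e * x $ e)"
        proof (rule sum_mono)
          fix e :: 'e
          show "c $ e * x $ e \<le> real N * a $ e * x $ e"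
          proof (cases "e \<in> els")
            case True
            then show ?thesis using x0[OF True] unfolding c_def by (intro mult_right_mono) auto
          qed (simp add: xz)
        qed
        also have "\<dots> = real N * (a \<bullet> x)" by (simp add: inner_vec_def sum_distrib_left mult.assoc)
        finally show ?thesis .
      qed
      finally show False using N by (simp add: right_diff_distrib)
    qed
  qed
qed

end

theorem theorem9:
  fixes D :: "('v, 'e::finite) pre_digraph"
    and E :: "'e set"
    and ends :: "'e \<Rightarrow> 'v set"
  assumes "mixed_graph D E ends"
    and "\<exists>F. mixed_edge_cover D E ends F"
  shows "totally_dual_integral (E \<union> arcs D) (mec_constrs D E) (mec_row D E ends) mec_rhs
    \<and> solutions (E \<union> arcs D) (mec_constrs D E) (mec_row D E ends) mec_rhs
        = convex hull {incidence F | F. mixed_edge_cover D E ends F}"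
  using mec_tdi[OF assms] mec_hull[OF assms] by blast

end
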